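(* Let $k>20$ be an integer and let $H$ be a finite group with a normal subgroup $M\neq 1$ such that $H/M\cong A_k$ and the extension $1\to M\to H\to A_k\to 1$ is nonsplit (i.e. $M$ has no complement in $H$). If $H$ embeds in the symmetric group $S_\ell$, then $\ell\ge k(k-1)$. Equivalently, $P(H)\ge k(k-1)$.
   Context: $A_k$, $S_k$ denote the alternating and symmetric groups of degree $k$. For a finite group $H$, $P(H)$ denotes the minimal degree of a faithful permutation representation of $H$. *)

theory Defs
  imports "HOL-Algebra.Algebra"
begin

definition is_complement :: "('a, 'b) monoid_scheme \<Rightarrow> 'a set \<Rightarrow> 'a set \<Rightarrow> bool" where
  "is_complement G M K \<longleftrightarrow>
     subgroup K G \<and> K \<inter> M = {\<one>\<^bsub>G\<^esub>} \<and> K <#>\<^bsub>G\<^esub> M = carrier G"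

end

theory Submission
  imports Defs
begin

text \<open>
  Replace \<open>H\<close> by a minimal subgroup \<open>G\<close> that still maps onto \<open>A\<^sub>k\<close>, with kernel \<open>N\<close>; it is enough to
  find a proper subgroup of \<open>G\<close> that maps onto \<open>A\<^sub>k\<close>. A point moved by \<open>N\<close> has a stabilizer \<open>U\<close> of
  index below \<open>k(k - 1)\<close> that does not contain \<open>N\<close>, so the image of \<open>U\<close> has index below
  \<open>k(k - 1)/2\<close> in \<open>A\<^sub>k\<close>, and Bochert's argument shows that it is a point stabilizer \<open>A\<^bsub>k-1\<^esub>\<close>.
  By the Frattini argument the Sylow subgroups of \<open>N\<close> are normal in \<open>G\<close>. Enlarge \<open>U\<close> to be maximal among
  the subgroups that do not contain one of them, \<open>P\<close>. Then \<open>P/(P \<inter> U)\<close> is abelian of order less than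
  \<open>k - 1\<close>, so the simple group \<open>A\<^bsub>k-1\<^esub>\<close> acts trivially on it, and \<open>U\<close> is normal of prime index \<open>p\<close> in
  the preimage of \<open>A\<^bsub>k-1\<^esub>\<close>. Inducing the corresponding character of order \<open>p\<close> gives a monomial
  representation of \<open>G\<close> on \<open>k\<close> points, that is, a cocycle \<open>\<kappa>\<close> with values in the \<open>p\<close>-th roots of unity.
  On \<open>N\<close> it is either constant in the point, and then it is a coboundary on lifts of elements that have
  fixed points, or its values exhaust all vectors of product 1, and then lifts of 3-cycles can be
  corrected by elements of \<open>N\<close>. In both cases the stabilizer of a section maps onto \<open>A\<^sub>k\<close>.
\<close>

section \<open>Alternating groups and 3-cycles\<close>

text \<open>Minimality of G is contradicted by any proper subgroup mapping onto A_k; if N were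
  trivial, G would be a complement, and nonsplitness forbids this. Since U does not contain N, it
  meets N in index at least 2, which halves the bound for the image of U. The number k(k - 1)/2 is
  the index in A_k of the stabilizer of an unordered pair, so the strict inequality just excludes
  that subgroup. Once the image is known to have index k, fewer than k - 1 cosets remain for N
  modulo its intersection with U, and (k - 1)!/2 > (k - 2)! stops A_(k-1) from acting faithfully on
  so few points. The bound k > 20 comes from Bochert's argument with n = k/4 rounded up: it needs n!
  to be at least 4n(4n - 1), which begins at n = 6. Maximality of U makes P modulo its intersection
  with U irreducible under U, hence of order p once U acts trivially. No cohomology group is
  computed: the subgroup sought is the stabilizer of an explicit section s, that is, of all h with
  s(hi) = s(i) \<open>\<kappa> h i\<close>, and it is proper because \<open>\<kappa>\<close> is not
  identically 1 on N.\<close>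

definition alternating :: "'b set \<Rightarrow> ('b \<Rightarrow> 'b) set" where
  "alternating S = {p. p permutes S \<and> evenperm p}"

definition cyc3 :: "'b \<Rightarrow> 'b \<Rightarrow> 'b \<Rightarrow> 'b \<Rightarrow> 'b" where
  "cyc3 a b c = (\<lambda>w. if w = a then b else if w = b then c else if w = c then a else w)"

text \<open>Bare sets of functions instead of group structures: images of points and of sets, and
  counting, then apply directly.\<close>

definition perm_subgroup :: "'b set \<Rightarrow> ('b \<Rightarrow> 'b) set \<Rightarrow> bool" where
  "perm_subgroup S Y \<longleftrightarrow> Y \<subseteq> alternating S \<and> id \<in> Y \<and>
     (\<forall>p\<in>Y. \<forall>q\<in>Y. p \<circ> q \<in> Y) \<and> (\<forall>p\<in>Y. inv' p \<in> Y)"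

lemma finite_alternating: "finite S \<Longrightarrow> finite (alternating S)"
  unfolding alternating_def by (rule finite_subset[OF _ finite_permutations[of S]]) auto

lemma alternating_permutes: "p \<in> alternating S \<Longrightarrow> p permutes S"
  by (simp add: alternating_def)

lemma alternating_mono: "A \<subseteq> B \<Longrightarrow> alternating A \<subseteq> alternating B"
  by (auto simp: alternating_def intro: permutes_subset)

lemma alternating_comp:
  assumes "finite S" "p \<in> alternating S" "q \<in> alternating S"
  shows "p \<circ> q \<in> alternating S"
  using assms by (auto simp: alternating_def permutes_compose evenperm_comp permutes_imp_permutation)

lemma alternating_inv:
  assumes "finite S" "p \<in> alternating S"
  shows "inv' p \<in> alternating S"
  using assms by (auto simp: alternating_def permutes_inv evenperm_inv permutes_imp_permutation)

lemma perm_subgroup_alternating: "finite S \<Longrightarrow> perm_subgroup S (alternating S)"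
  unfolding perm_subgroup_def
  by (auto simp: alternating_comp alternating_inv) (simp add: alternating_def)

text \<open>Composition with a transposition matches the even permutations with the odd
  ones.\<close>

lemma card_alternating:
  assumes "finite S" "card S \<ge> 2"
  shows "2 * card (alternating S) = fact (card S)"
proof -
  obtain a b where ab: "a \<in> S" "b \<in> S" "a \<noteq> b"
    using assms by (metis One_nat_def card_le_Suc0_iff_eq not_less_eq_eq numeral_2_eq_2)
  let ?t = "transpose a b"
  let ?O = "{p. p permutes S \<and> \<not> evenperm p}"
  have t: "?t permutes S" "\<not> evenperm ?t"
    using ab by (auto simp: permutes_swap_id evenperm_swap)
  have pm: "p permutes S \<Longrightarrow> permutation p" for p
    using assms(1) by (rule permutes_imp_permutation)
  have "bij_betw (\<lambda>p. ?t \<circ> p) (alternating S) ?O"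
    by (rule bij_betw_byWitness[where f' = "\<lambda>p. ?t \<circ> p"])
       (auto simp: alternating_def fun_eq_iff permutes_compose t evenperm_comp pm
             intro!: permutes_compose t)
  then have "card ?O = card (alternating S)"
    by (simp add: bij_betw_same_card)
  moreover have "card {p. p permutes S} = card (alternating S) + card ?O"
    unfolding alternating_def
    by (subst card_Un_disjoint[symmetric])
       (auto intro!: arg_cong[where f = card] finite_subset[OF _ finite_permutations[OF assms(1)]])
  ultimately show ?thesis
    using card_permutations[OF refl assms(1)] by simp
qed

section \<open>Identities for 3-cycles and generation by them\<close>

lemma cyc3_transpose: "distinct [a, b, c] \<Longrightarrow> cyc3 a b c = transpose a b \<circ> transpose b c"
  by (auto simp: cyc3_def fun_eq_iff transpose_def)

lemma cyc3_alternating: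
  assumes "distinct [a, b, c]" "{a, b, c} \<subseteq> S"
  shows "cyc3 a b c \<in> alternating S"
  using assms unfolding alternating_def cyc3_transpose[OF assms(1)]
  by (auto intro!: permutes_compose permutes_swap_id
        simp: evenperm_comp permutation_swap_id evenperm_swap)

lemma inv_cyc3: "distinct [a, b, c] \<Longrightarrow> inv' (cyc3 a b c) = cyc3 a c b"
  by (rule inv_unique_comp) (auto simp: cyc3_def fun_eq_iff)

lemma cyc3_rotate: "distinct [a, b, c] \<Longrightarrow> cyc3 b c a = cyc3 a b c"
  by (auto simp: cyc3_def fun_eq_iff)

lemma cyc3_conj:
  assumes "bij s"
  shows "s \<circ> cyc3 a b c \<circ> inv' s = cyc3 (s a) (s b) (s c)"
proof
  fix w
  obtain v where v: "w = s v" using assms by (metis bij_pointE)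
  have "inj s" using assms bij_is_inj by auto
  then show "(s \<circ> cyc3 a b c \<circ> inv' s) w = cyc3 (s a) (s b) (s c) w"
    by (simp add: v cyc3_def inj_eq)
qed

text \<open>The supports meet only in \<open>a\<close>, so \<open>y\<close> fixes the image and the
  preimage of \<open>a\<close> under \<open>x\<close>, and conversely. Outside \<open>a\<close>,
  \<open>x a\<close> and \<open>y a\<close> every point meets moves of only one of the two
  permutations, and these cancel in the commutator.\<close>

lemma commutator_cyc3:
  assumes "bij x" "bij y" "x a \<noteq> a" "y a \<noteq> a"
    and only: "\<And>w. x w \<noteq> w \<Longrightarrow> y w \<noteq> w \<Longrightarrow> w = a"
  shows "x \<circ> y \<circ> inv' x \<circ> inv' y = cyc3 a (x a) (y a)"
proof
  have ix: "inj x" and iy: "inj y" using assms(1,2) bij_is_inj by auto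
  have x': "inv' x (x u) = u" "x (inv' x u) = u" "inv' y (y u) = u" "y (inv' y u) = u" for u
    using assms(1,2) by (simp_all add: bij_is_inj bij_is_surj surj_f_inv_f)
  have xf: "inv' x u = u" if "x u = u" for u using that x' by metis
  have yf: "inv' y u = u" if "y u = u" for u using that x' by metis
  have fx: "x u = u" if "u \<noteq> a" "y u \<noteq> u" for u using that only by blast
  have fy: "y u = u" if "u \<noteq> a" "x u \<noteq> u" for u using that only by blast
  have xa: "x (x a) \<noteq> x a" using assms(3) ix by (simp add: inj_eq)
  have ya: "y (y a) \<noteq> y a" using assms(4) iy by (simp add: inj_eq)
  have yxa: "y (x a) = x a" using fy xa assms(3) by blast
  have xya: "x (y a) = y a" using fx ya assms(4) by blast
  have ixa: "y (inv' x a) = inv' x a"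
    by (rule fy) (use assms(3) x' in metis)+
  have iya: "x (inv' y a) = inv' y a"
    by (rule fx) (use assms(4) x' in metis)+
  fix w
  show "(x \<circ> y \<circ> inv' x \<circ> inv' y) w = cyc3 a (x a) (y a) w"
  proof (cases "w = a \<or> w = x a \<or> w = y a")
    case True
    have "x a \<noteq> y a" using yxa ya by metis
    then show ?thesis using True assms(3,4)
      by (auto simp: cyc3_def xf yf yxa xya ixa iya x')
  next
    case False
    show ?thesis
    proof (cases "y w = w")
      case True
      have "y (inv' x w) = inv' x w"
      proof (cases "x w = w")
        case True then show ?thesis using xf \<open>y w = w\<close> by simp
      next
        case False2: False
        have "x (inv' x w) \<noteq> inv' x w" using False2 x' by metis
        moreover have "inv' x w \<noteq> a" using False x' by metis
        ultimately show ?thesis using fy by blast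
      qed
      then show ?thesis using True False by (auto simp: cyc3_def yf x')
    next
      case F2: False
      have xw: "x w = w" using F2 fx False by blast
      have "y (inv' y w) \<noteq> inv' y w" using F2 x' by metis
      moreover have "inv' y w \<noteq> a" using False x' by metis
      ultimately have "x (inv' y w) = inv' y w" using fx by blast
      then show ?thesis using False by (simp add: cyc3_def xf x' xw)
    qed
  qed
qed

text \<open>The two factors share only the point \<open>a\<close>. Writing a 3-cycle as a commutator
  later provides lifts on which every homomorphism to an abelian group vanishes.\<close>

lemma cyc3_commutator:
  assumes "distinct [a, b, c, d, e]"
  shows "cyc3 a b c = cyc3 a b d \<circ> cyc3 a c e \<circ> inv' (cyc3 a b d) \<circ> inv' (cyc3 a c e)"
proof -
  have bij: "bij (cyc3 u v w)" if "distinct [u, v, w]" for u v w :: 'a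
    using alternating_permutes[OF cyc3_alternating[OF that subset_UNIV]] permutes_bij by blast
  show ?thesis
    by (subst commutator_cyc3[where a = a, OF bij bij])
      (use assms in \<open>auto simp: cyc3_def split: if_splits\<close>)
qed

text \<open>Otherwise \<open>p\<close> would be the transposition of \<open>a\<close> and
  \<open>p a\<close>, which is odd.\<close>

lemma alternating_two_points:
  assumes "p \<in> alternating S" "p a \<noteq> a"
  obtains c where "p c \<noteq> c" "c \<noteq> a" "c \<noteq> p a"
proof (rule ccontr)
  assume "\<not> thesis"
  then have *: "\<And>c. p c \<noteq> c \<Longrightarrow> c = a \<or> c = p a" using that by blast
  have p: "p permutes S" "evenperm p" using assms by (auto simp: alternating_def)
  have "p permutes {a, p a}"
    using permutes_superset[OF p(1)] * by blast
  then have "p = transpose a (p a)"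
    using permutes_doubleton_iff[of p a "p a"] assms(2) by auto
  then show False using p(2) assms(2) evenperm_swap by metis
qed

text \<open>Induction on the number of moved points. Closure under composition suffices because the
  inverse of a 3-cycle is a 3-cycle, so the sets to which this is applied need no check of
  inverses.\<close>

lemma alternating_subset_of_cyc3:
  assumes "finite S" and Y: "id \<in> Y" "\<And>p q. p \<in> Y \<Longrightarrow> q \<in> Y \<Longrightarrow> p \<circ> q \<in> Y"
    and cyc: "\<And>a b c. distinct [a, b, c] \<Longrightarrow> {a, b, c} \<subseteq> S \<Longrightarrow> cyc3 a b c \<in> Y"
  shows "alternating S \<subseteq> Y"
proof
  fix p assume "p \<in> alternating S"
  then show "p \<in> Y"
  proof (induction "card {w. p w \<noteq> w}" arbitrary: p rule: less_induct)
    case less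
    have p: "p permutes S" using less.prems by (rule alternating_permutes)
    have sub: "{w. p w \<noteq> w} \<subseteq> S" using p by (auto simp: permutes_def)
    then have fin: "finite {w. p w \<noteq> w}" using assms(1) finite_subset by blast
    show ?case
    proof (cases "p = id")
      case True then show ?thesis using Y(1) by simp
    next
      case False
      then obtain a where a: "p a \<noteq> a" by (auto simp: fun_eq_iff)
      obtain c where c: "p c \<noteq> c" "c \<noteq> a" "c \<noteq> p a"
        using alternating_two_points[OF less.prems a] .
      have inj: "inj p" using p permutes_inj by blast
      have ppa: "p (p a) \<noteq> p a" using a inj by (simp add: inj_eq)
      \<comment> \<open>\<open>t\<close> brings \<open>p a\<close> back to \<open>a\<close>, so
        \<open>t \<circ> p\<close> fixes \<open>a\<close>; all three points of \<open>t\<close> are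
        moved by \<open>p\<close>, so no new point becomes moved.\<close>
      define t where "t = cyc3 (p a) a c"
      have d: "distinct [p a, a, c]" using a c by auto
      have S: "{p a, a, c} \<subseteq> S" using sub a c ppa by auto
      have q: "t \<circ> p \<in> alternating S"
        unfolding t_def by (intro alternating_comp cyc3_alternating less.prems assms(1) d S)
      have "{w. (t \<circ> p) w \<noteq> w} \<subseteq> {w. p w \<noteq> w} - {a}"
      proof -
        have "t w = w" if "p w = w" for w
        proof -
          have "w \<noteq> p a" "w \<noteq> a" "w \<noteq> c" using that a c ppa by auto
          then show ?thesis by (simp add: t_def cyc3_def)
        qed
        moreover have "(t \<circ> p) a = a" by (simp add: t_def cyc3_def)
        ultimately show ?thesis by (auto simp del: comp_apply) simp
      qed
      then have "{w. (t \<circ> p) w \<noteq> w} \<subset> {w. p w \<noteq> w}" using a by blast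
      then have "t \<circ> p \<in> Y" by (intro less.hyps q psubset_card_mono fin)
      moreover have "cyc3 (p a) c a \<in> Y" using cyc d S by auto
      ultimately have "cyc3 (p a) c a \<circ> (t \<circ> p) \<in> Y" by (rule Y(2)[rotated])
      moreover have "cyc3 (p a) c a \<circ> t = id"
        unfolding t_def inv_cyc3[OF d, symmetric]
        using permutes_inv_o(2)[OF alternating_permutes[OF cyc3_alternating[OF d S]]] .
      ultimately show ?thesis by (simp add: o_assoc)
    qed
  qed
qed

section \<open>Blocks formed by the 3-cycles of a permutation group\<close>

lemma perm_subgroupD:
  assumes "perm_subgroup S Y"
  shows "Y \<subseteq> alternating S" "id \<in> Y" "p \<in> Y \<Longrightarrow> q \<in> Y \<Longrightarrow> p \<circ> q \<in> Y" "p \<in> Y \<Longrightarrow> inv' p \<in> Y"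
    "p \<in> Y \<Longrightarrow> bij p" "p \<in> Y \<Longrightarrow> p permutes S"
  using assms by (auto simp: perm_subgroup_def alternating_def permutes_bij)

lemma perm_subgroup_conj:
  assumes "perm_subgroup S Y" "s \<in> Y" "cyc3 a b c \<in> Y"
  shows "cyc3 (s a) (s b) (s c) \<in> Y"
proof -
  have "s \<circ> cyc3 a b c \<circ> inv' s \<in> Y"
    using assms(2,3) perm_subgroupD[OF assms(1)] by simp
  then show ?thesis
    using cyc3_conj perm_subgroupD(5)[OF assms(1,2)] by metis
qed

lemma perm_subgroup_cyc3_inv:
  assumes "perm_subgroup S Y" "distinct [a, b, c]" "cyc3 a b c \<in> Y"
  shows "cyc3 a c b \<in> Y"
  using perm_subgroupD(4)[OF assms(1,3)] inv_cyc3[OF assms(2)] by simp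

text \<open>For a group \<open>Y\<close> this is the orbit of \<open>a\<close> under the subgroup
  generated by the 3-cycles in \<open>Y\<close>. The case \<open>b = a\<close> keeps
  \<open>a\<close> in its class when no 3-cycle moves it.\<close>

definition linked :: "('b \<Rightarrow> 'b) set \<Rightarrow> 'b \<Rightarrow> 'b set" where
  "linked Y a = {b. b = a \<or> (\<exists>c. distinct [a, b, c] \<and> cyc3 a b c \<in> Y)}"

context
  fixes S :: "'b set" and Y
  assumes Y: "perm_subgroup S Y" and finS: "finite S"
begin

lemma linked_refl: "a \<in> linked Y a"
  by (simp add: linked_def)

lemma linked_sym: "b \<in> linked Y a \<Longrightarrow> a \<in> linked Y b"
proof (cases "b = a")
  case False
  assume "b \<in> linked Y a"
  then obtain c where c: "distinct [a, b, c]" "cyc3 a b c \<in> Y" using False by (auto simp: linked_def)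
  have "cyc3 a c b \<in> Y" using perm_subgroup_cyc3_inv[OF Y c] .
  then have "cyc3 b a c \<in> Y" using cyc3_rotate[of b a c] c by auto
  then show ?thesis using c by (auto simp: linked_def)
qed (simp add: linked_refl)

text \<open>Conjugating a 3-cycle through \<open>a\<close> and \<open>b\<close> by (b d e) keeps
  \<open>a\<close> and replaces \<open>b\<close> by \<open>d\<close>. This fails only for
  \<open>e = a\<close>, and then (b d e) already contains \<open>a\<close> and
  \<open>d\<close>.\<close>

lemma linked_trans:
  assumes "b \<in> linked Y a" "d \<in> linked Y b"
  shows "d \<in> linked Y a"
proof (cases "a = b \<or> b = d \<or> a = d")
  case True then show ?thesis using assms linked_refl by auto
next
  case False
  obtain c where c: "distinct [a, b, c]" "cyc3 a b c \<in> Y" using assms(1) False by (auto simp: linked_def)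
  obtain e where e: "distinct [b, d, e]" "cyc3 b d e \<in> Y" using assms(2) False by (auto simp: linked_def)
  show ?thesis
  proof (cases "a = e")
    case True
    then have "cyc3 a b d \<in> Y" using e cyc3_rotate[of a b d] False by simp
    then have "cyc3 a d b \<in> Y" using perm_subgroup_cyc3_inv[OF Y, of a b d] e True by auto
    then show ?thesis using False by (auto simp: linked_def)
  next
    case ae: False
    let ?s = "cyc3 b d e"
    have s: "cyc3 (?s a) (?s b) (?s c) \<in> Y" using perm_subgroup_conj[OF Y e(2) c(2)] .
    have "inj ?s" using perm_subgroupD(5)[OF Y e(2)] bij_is_inj by blast
    then have "distinct [?s a, ?s b, ?s c]" using c(1) by (simp add: inj_eq)
    moreover have "?s a = a" "?s b = d" using False ae by (auto simp: cyc3_def)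
    ultimately show ?thesis using s by (auto simp: linked_def)
  qed
qed

lemma linked_eq: "b \<in> linked Y a \<Longrightarrow> linked Y b = linked Y a"
  using linked_sym linked_trans by blast

lemma linked_subset: "a \<in> S \<Longrightarrow> linked Y a \<subseteq> S"
proof
  fix b assume a: "a \<in> S" and "b \<in> linked Y a"
  then consider "b = a" | c where "distinct [a, b, c]" "cyc3 a b c \<in> Y" by (auto simp: linked_def)
  then show "b \<in> S"
  proof cases
    case 2
    then have "cyc3 a b c a \<in> S" using perm_subgroupD(6)[OF Y] a permutes_in_image by metis
    then show ?thesis by (simp add: cyc3_def)
  qed (use a in simp)
qed

lemma linked_image_subset: "p \<in> Y \<Longrightarrow> p ` linked Y a \<subseteq> linked Y (p a)"
proof
  fix b assume p: "p \<in> Y" and "b \<in> p ` linked Y a"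
  then obtain b0 where b0: "b = p b0" "b0 \<in> linked Y a" by blast
  show "b \<in> linked Y (p a)"
  proof (cases "b0 = a")
    case True then show ?thesis using b0 linked_refl by simp
  next
    case False
    then obtain c where "distinct [a, b0, c]" "cyc3 a b0 c \<in> Y" using b0 by (auto simp: linked_def)
    moreover have "inj p" using perm_subgroupD(5)[OF Y p] bij_is_inj by blast
    ultimately show ?thesis using perm_subgroup_conj[OF Y p] b0
      by (auto simp: linked_def inj_eq intro!: exI[of _ "p c"])
  qed
qed

lemma linked_image:
  assumes "p \<in> Y"
  shows "p ` linked Y a = linked Y (p a)"
proof
  have i: "inv' p (p x) = x" "p (inv' p x) = x" for x
    using perm_subgroupD(5)[OF Y assms] by (simp_all add: bij_is_inj bij_is_surj surj_f_inv_f)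
  have "inv' p ` linked Y (p a) \<subseteq> linked Y a"
    using linked_image_subset[OF perm_subgroupD(4)[OF Y assms], of "p a"] by (simp add: i)
  then have "p ` inv' p ` linked Y (p a) \<subseteq> p ` linked Y a" by blast
  then show "linked Y (p a) \<subseteq> p ` linked Y a" by (simp add: image_image i)
qed (rule linked_image_subset[OF assms])

text \<open>Some 3-cycle (a b c) is in \<open>Y\<close>, and \<open>c\<close> has to be replaced by
  \<open>d\<close>. A 3-cycle (c d e) of \<open>Y\<close> does this by conjugation if
  \<open>e\<close> differs from \<open>a\<close> and \<open>b\<close>; otherwise conjugation by its
  inverse (c e d) gives the inverse of the wanted cycle.\<close>

lemma linked_cyc3:
  assumes "b \<in> linked Y a" "d \<in> linked Y a" "distinct [a, b, d]"
  shows "cyc3 a b d \<in> Y"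
proof -
  obtain c where c: "distinct [a, b, c]" "cyc3 a b c \<in> Y" using assms by (auto simp: linked_def)
  show ?thesis
  proof (cases "c = d")
    case True then show ?thesis using c by simp
  next
    case False
    have "c \<in> linked Y a" using perm_subgroup_cyc3_inv[OF Y] c by (auto simp: linked_def)
    then have "d \<in> linked Y c" using assms(2) linked_eq by blast
    then obtain e where e: "distinct [c, d, e]" "cyc3 c d e \<in> Y" using False by (auto simp: linked_def)
    have e': "cyc3 c e d \<in> Y" using perm_subgroup_cyc3_inv[OF Y e] .
    consider "e = a" | "e = b" | "e \<noteq> a" "e \<noteq> b" by blast
    then show ?thesis
    proof cases
      case 1
      have "cyc3 c e d a = d" "cyc3 c e d b = b" "cyc3 c e d c = a"
        using 1 c assms(3) False by (auto simp: cyc3_def)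
      then have "cyc3 d b a \<in> Y" using perm_subgroup_conj[OF Y e' c(2)] by simp
      then have "cyc3 d a b \<in> Y" using perm_subgroup_cyc3_inv[OF Y, of d b a] assms(3) by auto
      then show ?thesis using cyc3_rotate[of d a b] assms(3) by auto
    next
      case 2
      have "cyc3 c e d a = a" "cyc3 c e d b = d" "cyc3 c e d c = b"
        using 2 c assms(3) False by (auto simp: cyc3_def)
      then have "cyc3 a d b \<in> Y" using perm_subgroup_conj[OF Y e' c(2)] by simp
      then show ?thesis using perm_subgroup_cyc3_inv[OF Y, of a d b] assms(3) by auto
    next
      case 3
      then have "cyc3 c d e a = a" "cyc3 c d e b = b" "cyc3 c d e c = d"
        using c assms(3) False by (auto simp: cyc3_def)
      then show ?thesis using perm_subgroup_conj[OF Y e(2) c(2)] by simp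
    qed
  qed
qed

lemma alternating_linked_subset: "alternating (linked Y a) \<subseteq> Y" if "a \<in> S"
proof (rule alternating_subset_of_cyc3)
  show "finite (linked Y a)" using linked_subset[OF that] finS finite_subset by blast
  fix u v w assume uvw: "distinct [u, v, w]" "{u, v, w} \<subseteq> linked Y a"
  then have "linked Y u = linked Y a" using linked_eq by blast
  then show "cyc3 u v w \<in> Y" using linked_cyc3 uvw by auto
qed (use perm_subgroupD[OF Y] in auto)

text \<open>The products of an element of \<open>Z\<close> and an element of \<open>Y\<close> are
  pairwise distinct, since a coincidence would put a quotient into both groups.\<close>

lemma perm_subgroup_inter_trivial:
  assumes Z: "perm_subgroup S Z" and triv: "Y \<inter> Z = {id}"
  shows "card Z * card Y \<le> card (alternating S)"
proof -
  have inj: "inj_on (\<lambda>(z, y). z \<circ> y) (Z \<times> Y)"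
  proof (rule inj_onI, clarify)
    fix z y z' y' assume m: "z \<in> Z" "y \<in> Y" "z' \<in> Z" "y' \<in> Y" and eq: "z \<circ> y = z' \<circ> y'"
    have b: "z permutes S" "y permutes S" "z' permutes S" "y' permutes S"
      using m perm_subgroupD(6) Y Z by blast+
    have e: "inv' z' \<circ> z = y' \<circ> inv' y"
    proof
      fix w
      have "z (y (inv' y w)) = z' (y' (inv' y w))" using fun_cong[OF eq, of "inv' y w"] by simp
      then show "(inv' z' \<circ> z) w = (y' \<circ> inv' y) w"
        using b by (simp add: permutes_inverses)
    qed
    have "inv' z' \<circ> z \<in> Z" "y' \<circ> inv' y \<in> Y"
      by (intro perm_subgroupD(3,4)[OF Z] m) (intro perm_subgroupD(3,4)[OF Y] m)
    then have "inv' z' \<circ> z = id" "y' \<circ> inv' y = id" using e triv by auto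
    then have *: "inv' z' (z w) = w" "y' (inv' y w) = w" for w by (metis comp_apply id_apply)+
    have "z w = z' w" for w using *(1)[of w] permutes_inverses(1)[OF b(3), of "z w"] by simp
    moreover have "y w = y' w" for w using *(2)[of "y w"] permutes_inverses(2)[OF b(2), of w] by simp
    ultimately show "z = z' \<and> y = y'" by blast
  qed
  have "(\<lambda>(z, y). z \<circ> y) ` (Z \<times> Y) \<subseteq> alternating S"
    using perm_subgroupD(1)[OF Y] perm_subgroupD(1)[OF Z]
    by (auto intro!: alternating_comp[OF finS])
  then have "card (Z \<times> Y) \<le> card (alternating S)"
    using card_mono[OF finite_alternating[OF finS]] card_image[OF inj] by metis
  then show ?thesis by (simp add: card_cartesian_product)
qed

text \<open>Bochert's argument: if \<open>L\<close> is maximal with \<open>Y \<inter> alternating L\<close> trivial, then a nontrivial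
  element of \<open>Y\<close> supported off \<open>L\<close> and one supported on \<open>L\<close> plus one point have supports
  meeting in a single point, so their commutator is a 3-cycle.\<close>
lemma linked_class_card_ge_4:
  assumes small: "\<And>L. L \<subseteq> S \<Longrightarrow> Y \<inter> alternating L = {id} \<Longrightarrow> card L < n"
    and n: "4 * n \<le> card S + 3" "n \<ge> 2"
  shows "\<exists>a\<in>S. card (linked Y a) \<ge> 4"
proof (rule ccontr)
  assume "\<not> ?thesis"
  then have small_class: "\<And>a. a \<in> S \<Longrightarrow> card (linked Y a) \<le> 3" by force
  define F where "F = {L. L \<subseteq> S \<and> Y \<inter> alternating L = {id}}"
  have finF: "finite F" using finS by (simp add: F_def)
  have "{} \<in> F" using perm_subgroupD(2)[OF Y] by (auto simp: F_def alternating_def)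
  then have "Max (card ` F) \<in> card ` F" using finF by (intro Max_in) auto
  then obtain L where L: "L \<in> F" "card L = Max (card ` F)" by auto
  have L_max: "card L' \<le> card L" if "L' \<in> F" for L' using that finF L by simp
  have Ls: "L \<subseteq> S" "Y \<inter> alternating L = {id}" using L(1) by (auto simp: F_def)
  have cL: "card L < n" using small Ls by blast
  \<comment> \<open>The choice depends on the class alone, so the values of \<open>f\<close> are
    representatives outside \<open>L\<close>, one per class. The contradiction at the end is a
    3-cycle linking two different representatives, \<open>a\<close> and \<open>y a\<close>.\<close>
  define f where "f a = (SOME b. b \<in> linked Y a \<and> b \<in> S - L)" for a
  have f: "f a \<in> linked Y a" "f a \<in> S - L" if "a \<in> S - L" for a
    unfolding atomize_conj f_def by (rule someI[of _ a]) (use that linked_refl in auto)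
  have f_eq: "f a = f b" if "linked Y a = linked Y b" for a b
    using that by (simp add: f_def)
  let ?R = "f ` (S - L)"
  have "S - L \<subseteq> (\<Union>r\<in>?R. linked Y r)" using f linked_sym by blast
  then have "card (S - L) \<le> card (\<Union>r\<in>?R. linked Y r)"
    using finS linked_subset f by (intro card_mono finite_UN_I) (auto intro: finite_subset[OF linked_subset])
  also have "\<dots> \<le> (\<Sum>r\<in>?R. card (linked Y r))" using finS by (intro card_UN_le) auto
  also have "\<dots> \<le> (\<Sum>r\<in>?R. 3)" using f small_class by (intro sum_mono) auto
  finally have "card (S - L) \<le> 3 * card ?R" by simp
  moreover have "card (S - L) = card S - card L" using Ls finS by (simp add: card_Diff_subset finite_subset)
  \<comment> \<open>At least (4n - 3) - (n - 1) = 3n - 2 points lie outside \<open>L\<close>, and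
    classes have at most 3 points, so n - 1 representatives could not cover them.\<close>
  ultimately have "n \<le> card ?R" using cL n by linarith
  then obtain D where D: "D \<subseteq> ?R" "card D = n" by (meson obtain_subset_with_card_n)
  have DS: "D \<subseteq> S - L" using D f by blast
  then have "Y \<inter> alternating D \<noteq> {id}" using small[of D] D(2) by auto
  moreover have "id \<in> Y \<inter> alternating D" using perm_subgroupD(2)[OF Y] by (auto simp: alternating_def)
  ultimately obtain y where y: "y \<in> Y" "y \<in> alternating D" "y \<noteq> id" by blast
  then obtain a where a: "y a \<noteq> a" by (auto simp: fun_eq_iff)
  have yD: "\<And>w. y w \<noteq> w \<Longrightarrow> w \<in> D" using alternating_permutes[OF y(2)] by (auto simp: permutes_def)
  have aD: "a \<in> D" "y a \<in> D" using a yD alternating_permutes[OF y(2)] permutes_in_image by metis+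
  have "card (insert a L) > card L" using aD DS Ls finS by (subst card_insert_disjoint) (auto intro: finite_subset)
  then have "insert a L \<notin> F" using L_max by force
  then have "Y \<inter> alternating (insert a L) \<noteq> {id}" using aD DS Ls by (auto simp: F_def)
  moreover have "id \<in> Y \<inter> alternating (insert a L)" using perm_subgroupD(2)[OF Y] by (auto simp: alternating_def)
  ultimately obtain x where x: "x \<in> Y" "x \<in> alternating (insert a L)" "x \<noteq> id" by blast
  have xL: "\<And>w. x w \<noteq> w \<Longrightarrow> w \<in> insert a L" using alternating_permutes[OF x(2)] by (auto simp: permutes_def)
  have xa: "x a \<noteq> a"
  proof
    assume "x a = a"
    then have "x \<in> alternating L" using x(2) xL permutes_superset[of x "insert a L" L]
      by (auto simp: alternating_def)
    then show False using x Ls by blast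
  qed
  have bij: "bij x" "bij y" using perm_subgroupD(5)[OF Y] x y by auto
  have only: "w = a" if "x w \<noteq> w" "y w \<noteq> w" for w using xL[OF that(1)] yD[OF that(2)] DS by blast
  have c3: "cyc3 a (x a) (y a) \<in> Y"
  proof -
    have "x \<circ> y \<circ> inv' x \<circ> inv' y \<in> Y"
      by (intro perm_subgroupD(3,4)[OF Y] x(1) y(1))
    moreover have "x \<circ> y \<circ> inv' x \<circ> inv' y = cyc3 a (x a) (y a)"
      by (rule commutator_cyc3[OF bij xa a only])
    ultimately show ?thesis by simp
  qed
  have dist: "distinct [a, x a, y a]"
  proof -
    have "x a \<noteq> y a"
    proof
      assume eq: "x a = y a"
      have "x (x a) \<noteq> x a" "y (y a) \<noteq> y a" using xa a bij bij_is_inj inj_eq by metis+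
      then have "x a = a" using only[of "x a"] eq by simp
      then show False using xa by simp
    qed
    then show ?thesis using xa a by auto
  qed
  have "cyc3 a (y a) (x a) \<in> Y" using perm_subgroup_cyc3_inv[of S Y a "x a" "y a"] Y dist c3 by simp
  then have "\<exists>c. distinct [a, y a, c] \<and> cyc3 a (y a) c \<in> Y" using dist by (intro exI[of _ "x a"]) auto
  then have link: "y a \<in> linked Y a" unfolding linked_def by simp
  obtain u v where uv: "u \<in> S - L" "v \<in> S - L" "a = f u" "y a = f v" using aD D by blast
  have "linked Y (f u) = linked Y u" "linked Y (f v) = linked Y v"
    by (intro linked_eq f(1) uv)+
  then have "linked Y u = linked Y v" using linked_eq[OF link] uv(3,4) by simp
  then have "f u = f v" by (rule f_eq)
  then show False using uv(3,4) a by simp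
qed

end

section \<open>Subgroups of small index in alternating groups\<close>

text \<open>The stabilizer of \<open>B\<close> among all permutations embeds in the product of the
  symmetric groups on \<open>B\<close> and on its complement, and a transposition inside
  \<open>B\<close> pairs its even elements with odd ones.\<close>

lemma card_alternating_stabilizer:
  assumes S: "finite S" and B: "B \<subseteq> S" "card B \<ge> 2"
  shows "2 * card {p \<in> alternating S. p ` B = B} \<le> fact (card B) * fact (card (S - B))"
proof -
  have finB: "finite B" using S B(1) finite_subset by blast
  obtain a b where ab: "a \<in> B" "b \<in> B" "a \<noteq> b"
    using finB B(2) by (metis One_nat_def card_le_Suc0_iff_eq not_less_eq_eq numeral_2_eq_2)
  let ?t = "transpose a b"
  let ?E = "{p. p permutes S \<and> p ` B = B}"
  let ?A = "{p \<in> alternating S. p ` B = B}"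
  let ?O = "{p. p permutes S \<and> \<not> evenperm p \<and> p ` B = B}"
  have t: "?t permutes S" "\<not> evenperm ?t" using ab B(1) by (auto intro!: permutes_swap_id simp: evenperm_swap)
  have tB: "?t ` B = B" using permutes_image[OF permutes_swap_id[OF ab(1,2)]] .
  have pm: "p permutes S \<Longrightarrow> permutation p" for p using S by (rule permutes_imp_permutation)
  have inj: "inj_on (\<lambda>p. ?t \<circ> p) ?A"
    by (rule inj_onI) (metis (no_types, lifting) comp_assoc transpose_comp_involutory id_comp)
  have sub: "(\<lambda>p. ?t \<circ> p) ` ?A \<subseteq> ?O"
  proof (rule image_subsetI)
    fix p assume "p \<in> ?A"
    then have p: "p permutes S" "evenperm p" "p ` B = B" by (auto simp: alternating_def)
    have "\<not> evenperm (?t \<circ> p)" using evenperm_comp[OF pm[OF t(1)] pm[OF p(1)]] p(2) t(2) by simp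
    moreover have "(?t \<circ> p) ` B = B" unfolding image_comp[symmetric] p(3) tB ..
    ultimately show "?t \<circ> p \<in> ?O" using permutes_compose[OF p(1) t(1)] by simp
  qed
  have finE: "finite ?E" using finite_subset[OF _ finite_permutations[OF S]] by (auto)
  have "card ?A \<le> card ?O"
    using card_mono[OF _ sub] card_image[OF inj] finite_subset[OF _ finE, of ?O] by force
  moreover have "card ?E = card ?A + card ?O"
    by (subst card_Un_disjoint[symmetric])
       (auto simp: alternating_def intro!: arg_cong[where f = card] finite_subset[OF _ finE])
  moreover have "card ?E \<le> fact (card B) * fact (card (S - B))"
  proof -
    let ?f = "\<lambda>p. (restrict_id p B, restrict_id p (S - B))"
    have img: "?f ` ?E \<subseteq> {p. p permutes B} \<times> {p. p permutes (S - B)}"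
    proof (clarsimp, intro conjI permutes_restrict_id)
      fix p assume p: "p permutes S" "p ` B = B"
      show "bij_betw p B B" using p by (auto simp: bij_betw_def permutes_inj_on)
      have "p ` (S - B) = S - B"
        using p by (simp add: image_set_diff permutes_inj permutes_image)
      then show "bij_betw p (S - B) (S - B)" using p by (auto simp: bij_betw_def permutes_inj_on)
    qed
    have inj': "inj_on ?f ?E"
    proof (rule inj_onI, clarify)
      fix p q assume p: "p permutes S" "q permutes S"
        and e: "restrict_id p B = restrict_id q B" "restrict_id p (S - B) = restrict_id q (S - B)"
      show "p = q"
      proof
        fix x
        consider "x \<in> B" | "x \<in> S - B" | "x \<notin> S" by blast
        then show "p x = q x"
          using fun_cong[OF e(1), of x] fun_cong[OF e(2), of x] p B(1)
          by cases (auto simp: permutes_def)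
      qed
    qed
    have "card ?E \<le> card ({p. p permutes B} \<times> {p. p permutes (S - B)})"
      unfolding card_image[OF inj', symmetric]
      by (rule card_mono[OF _ img]) (auto intro!: finite_permutations finB S)
    moreover have "finite (S - B)" using S by simp
    ultimately show ?thesis
      using card_permutations[OF refl finB] card_permutations[OF refl, of "S - B"]
      by (simp add: card_cartesian_product)
  qed
  ultimately show ?thesis by simp
qed

lemma card_perm_subgroup_orbit:
  assumes Y: "perm_subgroup S Y" and S: "finite S"
  shows "card Y \<le> card ((\<lambda>p. p ` B) ` Y) * card {p \<in> Y. p ` B = B}"
proof -
  let ?O = "(\<lambda>p. p ` B) ` Y"
  have finY: "finite Y" using perm_subgroupD(1)[OF Y] finite_alternating[OF S] finite_subset by blast
  have "Y = (\<Union>C\<in>?O. {p \<in> Y. p ` B = C})" by auto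
  then have "card Y \<le> (\<Sum>C\<in>?O. card {p \<in> Y. p ` B = C})"
    using card_UN_le[of ?O "\<lambda>C. {p \<in> Y. p ` B = C}"] finY by simp
  also have "\<dots> \<le> (\<Sum>C\<in>?O. card {p \<in> Y. p ` B = B})"
  proof (rule sum_mono)
    fix C assume "C \<in> ?O"
    then obtain q where q: "q \<in> Y" "q ` B = C" by auto
    have qi: "inv' q (q x) = x" for x
      using perm_subgroupD(5)[OF Y q(1)] by (simp add: bij_is_inj)
    have qi': "q (inv' q x) = x" for x
      using perm_subgroupD(5)[OF Y q(1)] by (simp add: bij_is_surj surj_f_inv_f)
    have inj: "inj_on (\<lambda>p. inv' q \<circ> p) {p \<in> Y. p ` B = C}"
    proof (rule inj_onI)
      fix p p' assume eq: "inv' q \<circ> p = inv' q \<circ> p'"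
      have "p x = p' x" for x using fun_cong[OF eq, of x] qi' by (metis comp_apply)
      then show "p = p'" by blast
    qed
    have sub: "(\<lambda>p. inv' q \<circ> p) ` {p \<in> Y. p ` B = C} \<subseteq> {p \<in> Y. p ` B = B}"
    proof clarify
      fix p assume p: "p \<in> Y" "C = p ` B"
      have "inv' q \<circ> p \<in> Y" by (intro perm_subgroupD(3,4)[OF Y] p q)
      moreover have "(inv' q \<circ> p) ` B = inv' q ` q ` B"
        unfolding image_comp[symmetric] p(2)[symmetric] q(2) ..
      moreover have "inv' q ` q ` B = B" by (simp add: image_image qi)
      ultimately show "inv' q \<circ> p \<in> Y \<and> (inv' q \<circ> p) ` B = B" by simp
    qed
    show "card {p \<in> Y. p ` B = C} \<le> card {p \<in> Y. p ` B = B}"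
      using card_mono[OF _ sub] finY card_image[OF inj] by simp
  qed
  finally show ?thesis by simp
qed

text \<open>This is the source of the bound k > 20: for n = 6 the two sides are 552 and 720, while n
  = 5 fails.\<close>

lemma fact_ge_quarter: "n \<ge> 6 \<Longrightarrow> 4 * n * (4 * n - 1) \<le> (fact n :: nat)"
proof (induction n rule: dec_induct)
  case base show ?case by (simp add: fact_numeral)
next
  case (step n)
  have "4 * Suc n * (4 * Suc n - 1) = Suc n * (16 * n + 12)" by (simp add: algebra_simps)
  also have "\<dots> \<le> Suc n * (4 * n * (4 * n - 1))"
  proof (rule mult_left_mono)
    have "(16 * n + 12) \<le> 4 * n * 5" using step by simp
    also have "\<dots> \<le> 4 * n * (4 * n - 1)" using step by (intro mult_left_mono) auto
    finally show "16 * n + 12 \<le> 4 * n * (4 * n - 1)" .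
  qed simp
  also have "\<dots> \<le> Suc n * fact n" using step by (intro mult_left_mono) auto
  finally show ?case by (simp add: algebra_simps)
qed

text \<open>Monotonicity and symmetry of the binomial coefficients reduce the claim to
  \<open>j = 3\<close>. It is used for \<open>n = k - 1\<close> and \<open>j = b - 1\<close>, where
  \<open>b\<close> is a class size; this is why classes of at least 4 points are sought.\<close>

lemma binomial_lower_bound:
  assumes "3 \<le> j" "j + 3 \<le> n" "n \<ge> 8"
  shows "n * (n + 1) \<le> 2 * (n choose j)"
proof -
  have c3: "n choose 3 \<le> n choose j"
  proof (cases "2 * j \<le> n")
    case True then show ?thesis using assms by (intro binomial_mono) auto
  next
    case False
    have "n choose 3 \<le> n choose (n - j)" using assms False by (intro binomial_mono) auto
    then show ?thesis using binomial_symmetric[of j n] assms by simp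
  qed
  have "6 * (n choose 3) = n * ((n - 1) * (n - 2))"
  proof -
    have "3 * (n choose 3) = n * ((n - 1) choose 2)" using times_binomial_minus1_eq[of 3 n] by simp
    moreover have "2 * ((n - 1) choose 2) = (n - 1) * (n - 2)"
      using times_binomial_minus1_eq[of 2 "n - 1"] by (simp add: numeral_2_eq_2)
    moreover have "6 * (n choose 3) = 2 * (3 * (n choose 3))" by simp
    ultimately show ?thesis by (metis mult.left_commute)
  qed
  moreover have "3 * (n + 1) \<le> (n - 1) * (n - 2)"
  proof -
    obtain m where m: "n = m + 8" using assms(3) by (metis add.commute le_Suc_ex)
    show ?thesis unfolding m by (simp add: algebra_simps)
  qed
  then have "n * (3 * (n + 1)) \<le> n * ((n - 1) * (n - 2))" by (rule mult_left_mono) simp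
  ultimately have "3 * (n * (n + 1)) \<le> 3 * (2 * (n choose 3))" by (simp add: algebra_simps)
  then show ?thesis using c3 by linarith
qed

text \<open>The hypothesis says that the index of \<open>Y\<close> is below k(k - 1)/2. The classes
  of linked points are blocks; a class of size b has at most k/b translates, so the index is at
  least \<open>(k - 1) choose (b - 1)\<close>. This is too large for b between 4 and k - 3. For b =
  k - 2 the class has only one translate and the index is at least \<open>k choose 2\<close>,
  exactly the excluded value. Hence b is k or k - 1.\<close>

theorem alternating_subgroup_of_small_index:
  assumes S: "finite S" "card S > 20" and Y: "perm_subgroup S Y"
    and small: "fact (card S) < card S * (card S - 1) * card Y"
  shows "Y = alternating S \<or> (\<exists>z\<in>S. Y = alternating (S - {z}))"
proof -
  define k where "k = card S"
  \<comment> \<open>k/4 rounded up: \<open>k \<le> 4 * n\<close> gives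
    \<open>k * (k - 1) \<le> fact n\<close>, and \<open>4 * n \<le> k + 3\<close> is what Bochert's
    argument needs.\<close>
  define n where "n = (k + 3) div 4"
  have k: "k > 20" "fact k < k * (k - 1) * card Y" using S small by (simp_all add: k_def)
  have n: "n \<ge> 6" "k \<le> 4 * n" "4 * n \<le> k + 3" using k by (auto simp: n_def)
  have kn: "k * (k - 1) \<le> fact n"
  proof -
    have "k * (k - 1) \<le> 4 * n * (4 * n - 1)" using n by (intro mult_le_mono) auto
    then show ?thesis using fact_ge_quarter[OF n(1)] by linarith
  qed
  \<comment> \<open>If \<open>card L\<close> were at least \<open>n\<close>, trivial intersection
    with \<open>alternating L\<close> would force the index of \<open>Y\<close> up to n!/2, hence to
    at least k(k - 1)/2.\<close>
  have "card L < n" if L: "L \<subseteq> S" "Y \<inter> alternating L = {id}" for L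
  proof (rule ccontr)
    assume "\<not> card L < n"
    then have cL: "card L \<ge> n" by simp
    have fL: "finite L" using L S finite_subset by blast
    have pL: "perm_subgroup S (alternating L)"
      using perm_subgroup_alternating[OF fL] alternating_mono[OF L(1)] by (auto simp: perm_subgroup_def)
    have "card (alternating L) * card Y \<le> card (alternating S)"
      by (rule perm_subgroup_inter_trivial[OF Y S(1) pL L(2)])
    then have "2 * (card (alternating L) * card Y) \<le> 2 * card (alternating S)" by (rule mult_le_mono2)
    moreover have "2 * card (alternating L) = fact (card L)" using cL n by (intro card_alternating fL) simp
    moreover have "2 * card (alternating S) = fact k" using k card_alternating[OF S(1)] by (simp add: k_def)
    ultimately have "fact (card L) * card Y \<le> fact k" by (metis mult.assoc)
    moreover have "k * (k - 1) \<le> fact (card L)" using kn fact_mono[OF cL, where 'a = nat] by linarith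
    then have "k * (k - 1) * card Y \<le> fact (card L) * card Y" by (rule mult_le_mono1)
    ultimately show False using k(2) by linarith
  qed
  then obtain a where a: "a \<in> S" "card (linked Y a) \<ge> 4"
    using linked_class_card_ge_4[OF Y S(1), of n] n by (auto simp: k_def)
  define B where "B = linked Y a"
  define b where "b = card B"
  have B: "B \<subseteq> S" "finite B" "b \<ge> 4" "b \<le> k"
    using linked_subset[OF Y S(1) a(1)] S(1) a(2) finite_subset card_mono
    by (auto simp: B_def b_def k_def)
  let ?O = "(\<lambda>p. p ` B) ` Y"
  have finY: "finite Y" using perm_subgroupD(1)[OF Y] finite_alternating[OF S(1)] finite_subset by blast
  have Oeq: "p ` B = linked Y (p a)" if "p \<in> Y" for p
    unfolding B_def by (rule linked_image[OF Y S(1) that])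
  have disj: "C \<inter> D = {}" if "C \<in> ?O" "D \<in> ?O" "C \<noteq> D" for C D
  proof (rule ccontr)
    assume "C \<inter> D \<noteq> {}"
    then obtain x where x: "x \<in> C" "x \<in> D" by blast
    obtain p q where pq: "C = linked Y (p a)" "D = linked Y (q a)"
      using \<open>C \<in> ?O\<close> \<open>D \<in> ?O\<close> Oeq by auto
    show False
      using x linked_eq[OF Y S(1), of x "p a"] linked_eq[OF Y S(1), of x "q a"] \<open>C \<noteq> D\<close>
      unfolding pq by simp
  qed
  have sub: "C \<subseteq> S" "card C = b" if "C \<in> ?O" for C
  proof -
    obtain p where p: "p \<in> Y" "C = p ` B" using \<open>C \<in> ?O\<close> by blast
    have "p permutes S" by (rule perm_subgroupD(6)[OF Y p(1)])
    then show "C \<subseteq> S" "card C = b"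
      using p(2) B(1) permutes_image[of p S] card_image[OF permutes_inj_on, of p S B] by (auto simp: b_def)
  qed
  have O: "card ?O * b \<le> k"
  proof -
    have "card (\<Union>C\<in>?O. C) = (\<Sum>C\<in>?O. card C)"
      using finY sub S(1) disj by (intro card_UN_disjoint) (auto intro: finite_subset)
    also have "\<dots> = card ?O * b" using sub by simp
    finally show ?thesis using card_mono[OF S(1), of "\<Union>C\<in>?O. C"] sub(1) by (auto simp: k_def)
  qed
  have st: "2 * card Y \<le> card ?O * (fact b * fact (k - b))"
  proof -
    have "card {p \<in> Y. p ` B = B} \<le> card {p \<in> alternating S. p ` B = B}"
      using perm_subgroupD(1)[OF Y] finite_alternating[OF S(1)] by (intro card_mono) auto
    moreover have "2 * card {p \<in> alternating S. p ` B = B} \<le> fact b * fact (k - b)"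
      using card_alternating_stabilizer[OF S(1) B(1)] B
      by (simp add: b_def k_def card_Diff_subset)
    ultimately have "2 * card {p \<in> Y. p ` B = B} \<le> fact b * fact (k - b)" by linarith
    then have "card ?O * (2 * card {p \<in> Y. p ` B = B}) \<le> card ?O * (fact b * fact (k - b))"
      by (rule mult_le_mono2)
    moreover have "2 * card Y \<le> card ?O * (2 * card {p \<in> Y. p ` B = B})"
      using mult_le_mono2[OF card_perm_subgroup_orbit[OF Y S(1), of B], of 2] by (simp only: mult.left_commute)
    ultimately show ?thesis by linarith
  qed
  \<comment> \<open>Translates of \<open>B\<close> are disjoint and of equal size, so a class with
    more than half of the points is its own only translate.\<close>
  have O1: "card ?O \<le> 1" if "2 * b > k"
  proof (rule ccontr)
    assume "\<not> card ?O \<le> 1"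
    then have "2 \<le> card ?O" by simp
    then have "2 * b \<le> card ?O * b" by (rule mult_le_mono1)
    then show False using O that by linarith
  qed
  have binom: "fact b * fact (k - b) * (k choose b) = fact k" by (rule binomial_fact_lemma[OF B(4)])
  consider "b \<le> k - 3" | "b = k - 2" | "b \<ge> k - 1" using B k by linarith
  then have bk: "b \<ge> k - 1"
  proof cases
    case 1
    have "b * (2 * card Y) \<le> b * (card ?O * (fact b * fact (k - b)))" by (rule mult_le_mono2[OF st])
    also have "\<dots> = (card ?O * b) * (fact b * fact (k - b))" by simp
    also have "\<dots> \<le> k * (fact b * fact (k - b))" by (rule mult_le_mono1[OF O])
    finally have le: "2 * b * card Y \<le> k * (fact b * fact (k - b))" by simp
    have bc: "b * (k choose b) = k * ((k - 1) choose (b - 1))" using times_binomial_minus1_eq[of b k] B by simp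
    have "k * (k - 1) * (2 * b * card Y) \<le> k * (k - 1) * (k * (fact b * fact (k - b)))"
      by (rule mult_le_mono2[OF le])
    also have "\<dots> \<le> 2 * ((k - 1) choose (b - 1)) * (k * (fact b * fact (k - b)))"
      using binomial_lower_bound[of "b - 1" "k - 1"] 1 B k by (intro mult_le_mono1) (simp add: mult.commute)
    also have "\<dots> = 2 * b * (fact b * fact (k - b) * (k choose b))"
      using bc by (simp add: mult.assoc mult.left_commute) 
    finally have "2 * b * (k * (k - 1) * card Y) \<le> 2 * b * fact k" unfolding binom by (simp add: ac_simps)
    then have "k * (k - 1) * card Y \<le> fact k" using B(3) by simp
    then show ?thesis using k(2) by simp
  next
    case 2
    have "2 * card Y \<le> 1 * (fact b * fact (k - b))"
      using st O1 2 k mult_le_mono1[of "card ?O" 1 "fact b * fact (k - b)"] by linarith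
    moreover have "k - b = 2" using 2 k by simp
    ultimately have "card Y \<le> fact (k - 2)" using 2 by (simp add: fact_numeral)
    then have "k * (k - 1) * card Y \<le> k * (k - 1) * fact (k - 2)" by (rule mult_le_mono2)
    also have "\<dots> = fact k"
      using k fact_reduce[of k, where 'a = nat] fact_reduce[of "k - 1", where 'a = nat]
      by (simp add: numeral_2_eq_2 mult.assoc)
    finally show ?thesis using k(2) by simp
  qed auto
  have altB: "alternating B \<subseteq> Y" unfolding B_def by (rule alternating_linked_subset[OF Y S(1) a(1)])
  show ?thesis
  proof (cases "b = k")
    case True
    then have "B = S" using card_subset_eq[OF S(1) B(1)] by (simp add: b_def k_def)
    then show ?thesis using altB perm_subgroupD(1)[OF Y] by blast
  next
    case False
    then have "card (S - B) = 1" using bk B by (simp add: card_Diff_subset b_def k_def)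
    then obtain z where z: "S - B = {z}" by (rule card_1_singletonE)
    have zB: "B = S - {z}" "z \<in> S" using z B(1) by blast+
    have "Y \<subseteq> alternating B"
    proof
      fix p assume p: "p \<in> Y"
      have ps: "p permutes S" by (rule perm_subgroupD(6)[OF Y p])
      have "B \<in> ?O" using perm_subgroupD(2)[OF Y] by (metis image_id rev_image_eqI id_apply)
      moreover have "p ` B \<in> ?O" using p by blast
      moreover have "card ?O \<le> 1" using O1 bk k by simp
      ultimately have "p ` B = B" using finY by (metis card_le_Suc0_iff_eq One_nat_def finite_imageI)
      have "p z \<notin> B"
      proof
        assume "p z \<in> B"
        then obtain w where w: "w \<in> B" "p z = p w" using \<open>p ` B = B\<close> by (metis imageE)
        then have "z = w" using permutes_inj[OF ps] by (simp add: inj_eq)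
        then show False using w(1) zB by simp
      qed
      moreover have "p z \<in> S" using zB(2) permutes_in_image[OF ps] by simp
      ultimately have "p z = z" using zB(1) by simp
      then have "p permutes B" using ps zB by (intro permutes_superset[OF ps]) auto
      moreover have "evenperm p" using perm_subgroupD(1)[OF Y] p by (auto simp: alternating_def)
      ultimately show "p \<in> alternating B" by (simp add: alternating_def)
    qed
    then show ?thesis using altB zB by blast
  qed
qed

section \<open>Normal subgroups of alternating groups\<close>

text \<open>The extra point \<open>f\<close> closes up the 3-cycles \<open>cyc3 d e f\<close> that move \<open>D\<close> into \<open>E\<close>
  one element at a time.\<close>
lemma alternating_move:
  assumes "finite D" "finite E" "D \<inter> E = {}" "card D \<le> card E" "f \<notin> D \<union> E"
  shows "\<exists>u \<in> alternating (insert f (D \<union> E)). u ` D \<subseteq> E"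
  using assms
proof (induction D arbitrary: E rule: finite_induct)
  case empty
  show ?case by (rule bexI[of _ id]) (auto simp: alternating_def)
next
  case (insert d D)
  have "E \<noteq> {}" using insert.prems insert.hyps by auto
  then obtain e where e: "e \<in> E" by blast
  have "\<exists>u \<in> alternating (insert f (D \<union> (E - {e}))). u ` D \<subseteq> E - {e}"
    by (rule insert.IH) (use insert.prems insert.hyps e in auto)
  then obtain u where u: "u \<in> alternating (insert f (D \<union> (E - {e})))" "u ` D \<subseteq> E - {e}" by blast
  let ?T = "insert f (insert d D \<union> E)"
  have dist: "distinct [d, e, f]" using insert.prems insert.hyps e by auto
  have "cyc3 d e f \<in> alternating ?T" by (rule cyc3_alternating[OF dist]) (use e in auto)
  moreover have "insert f (D \<union> (E - {e})) \<subseteq> ?T" by blast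
  then have "u \<in> alternating ?T" using u(1) alternating_mono by blast
  ultimately have "cyc3 d e f \<circ> u \<in> alternating ?T"
    using insert.hyps insert.prems by (intro alternating_comp) auto
  moreover have "(cyc3 d e f \<circ> u) ` insert d D \<subseteq> E"
  proof -
    have ud: "u d = d"
      by (rule permutes_not_in[OF alternating_permutes[OF u(1)]]) (use dist insert.hyps insert.prems in auto)
    show ?thesis
    proof (rule image_subsetI)
      fix w assume "w \<in> insert d D"
      show "(cyc3 d e f \<circ> u) w \<in> E"
      proof (cases "w = d")
        case True then show ?thesis using ud e by (simp add: cyc3_def)
      next
        case False
        then have uw: "u w \<in> E" "u w \<noteq> e" using u(2) \<open>w \<in> insert d D\<close> by auto
        then have "u w \<noteq> d" "u w \<noteq> f" using insert.prems by auto
        then show ?thesis using uw by (simp add: cyc3_def)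
      qed
    qed
  qed
  ultimately show ?case by blast
qed

text \<open>The aim is a 3-cycle in \<open>N\<close>. The commutator of a nontrivial element with a
  3-cycle gives a nontrivial \<open>h\<close> in \<open>N\<close> moving at most five points. A
  conjugate \<open>h'\<close> whose support meets that of \<open>h\<close> in the single point
  \<open>c\<close> is then arranged, and the commutator of \<open>h\<close> and \<open>h'\<close> is
  a 3-cycle through \<open>c\<close>. Its conjugates link \<open>c\<close> with every point.\<close>

lemma alternating_normal_subgroup:
  assumes S: "finite S" "card S \<ge> 10" and N: "perm_subgroup S N"
    and normal: "\<And>p q. p \<in> alternating S \<Longrightarrow> q \<in> N \<Longrightarrow> p \<circ> q \<circ> inv' p \<in> N"
    and "N \<noteq> {id}"
  shows "N = alternating S"
proof -
  have avoid: "\<exists>c\<in>S. c \<notin> F" if "finite F" "card F < card S" for F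
  proof (rule ccontr)
    assume "\<not> ?thesis"
    then have "S \<subseteq> F" by blast
    then show False using card_mono[OF that(1), of S] that(2) by linarith
  qed
  have avoid_list: "\<exists>c\<in>S. c \<notin> set xs" if "length xs < 10" for xs
    using avoid[of "set xs"] card_length[of xs] that S(2) by simp
  have NS: "p permutes S" if "p \<in> N" for p by (rule perm_subgroupD(6)[OF N that])
  have comm: "p \<circ> q \<circ> inv' p \<circ> inv' q \<in> N" if "p \<in> N" "q \<in> alternating S" for p q
  proof -
    have "q \<circ> inv' p \<circ> inv' q \<in> N"
      using normal[OF that(2) perm_subgroupD(4)[OF N that(1)]] .
    then have "p \<circ> (q \<circ> inv' p \<circ> inv' q) \<in> N"
      using perm_subgroupD(3)[OF N that(1), of "q \<circ> inv' p \<circ> inv' q"] by simp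
    then show ?thesis by (simp add: comp_assoc)
  qed
  obtain g where g: "g \<in> N" "g \<noteq> id" using \<open>N \<noteq> {id}\<close> perm_subgroupD(2)[OF N] by blast
  then obtain a where a: "g a \<noteq> a" by (auto simp: fun_eq_iff)
  have gS: "g permutes S" by (rule NS[OF g(1)])
  have aS: "a \<in> S" "g a \<in> S" "g (g a) \<in> S" using gS a by (auto simp: permutes_def permutes_in_image)
  obtain c where c: "c \<in> S" "c \<notin> {a, g a, g (g a)}"
    using avoid_list[of "[a, g a, g (g a)]"] by auto
  define t where "t = cyc3 a (g a) c"
  \<comment> \<open>Read as the 3-cycle \<open>g \<circ> t \<circ> inv' g\<close> times the inverse
    of \<open>t\<close>: the two cycles share the point \<open>g a\<close>, which bounds the support
    by five points.\<close>
  define h where "h = g \<circ> t \<circ> inv' g \<circ> inv' t"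
  define D where "D = {a, g a, c, g (g a), g c}"
  have dt: "distinct [a, g a, c]" using a c by auto
  have tA: "t \<in> alternating S" unfolding t_def by (rule cyc3_alternating[OF dt]) (use aS c in auto)
  have hN: "h \<in> N" unfolding h_def by (rule comm[OF g(1) tA])
  have h_eq: "h = cyc3 (g a) (g (g a)) (g c) \<circ> cyc3 a c (g a)"
    unfolding h_def t_def cyc3_conj[OF permutes_bij[OF gS]] inv_cyc3[OF dt] ..
  have hD: "h w = w" if "w \<notin> D" for w using that by (simp add: h_eq D_def cyc3_def)
  have DS: "D \<subseteq> S" using aS c gS by (auto simp: D_def permutes_in_image)
  have cD: "card D \<le> 5" "finite D" by (auto simp: D_def card_insert_if)
  have ga: "g (g a) \<noteq> g a" using a gS by (metis permutes_inverses(2))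
  have "h c \<noteq> c"
  proof -
    have "cyc3 a c (g a) c = g a" using dt by (auto simp: cyc3_def)
    then have "h c = g (g a)" by (simp add: h_eq cyc3_def)
    then show ?thesis using c by auto
  qed
  define D' where "D' = D - {c}"
  have cD': "c \<in> D" "card D' \<le> 4" "finite D'" using cD by (auto simp: D'_def D_def card_insert_if)
  obtain f where f: "f \<in> S" "f \<notin> D" using avoid[of D] cD S by auto
  \<comment> \<open>The origin of 10: at most five points in \<open>D\<close>, the spare point
    \<open>f\<close>, and four more points to receive \<open>D'\<close>, that is \<open>D\<close>
    without \<open>c\<close>.\<close>
  have "card D' \<le> card (S - insert f D)"
  proof -
    have "card (insert f D) \<le> 6" using cD card_insert_le_m1[of 6 D f] by simp
    moreover have "card (S - insert f D) = card S - card (insert f D)"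
      using DS f cD by (intro card_Diff_subset) auto
    ultimately show ?thesis using S(2) cD' by linarith
  qed
  then obtain u where u: "u \<in> alternating (insert f (D' \<union> (S - insert f D)))" "u ` D' \<subseteq> S - insert f D"
    using alternating_move[of D' "S - insert f D" f] cD' S f by (auto simp: D'_def)
  have uA: "u \<in> alternating S" using u(1) DS f alternating_mono[of "insert f (D' \<union> (S - insert f D))" S]
    by (auto simp: D'_def)
  have uc: "u c = c" using alternating_permutes[OF u(1)] cD' f by (auto simp: permutes_def D'_def)
  have ub: "bij u" by (rule permutes_bij[OF alternating_permutes[OF uA]])
  have ui: "inv' u (u x) = x" "u (inv' u x) = x" for x
    using ub by (simp_all add: bij_is_inj bij_is_surj surj_f_inv_f)
  define h' where "h' = u \<circ> h \<circ> inv' u"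
  have h'N: "h' \<in> N" unfolding h'_def by (rule normal[OF uA hN])
  have iuc: "inv' u c = c" using ui(1)[of c] uc by simp
  have only: "w = c" if "h w \<noteq> w" "h' w \<noteq> w" for w
  proof (rule ccontr)
    assume "w \<noteq> c"
    have "h (inv' u w) \<noteq> inv' u w" using that(2) ui(2)[of w] by (auto simp: h'_def)
    then have "inv' u w \<in> D" using hD by blast
    moreover have "inv' u w \<noteq> c" using \<open>w \<noteq> c\<close> ui(2)[of w] uc by auto
    ultimately have "u (inv' u w) \<in> S - insert f D" using u(2) by (auto simp: D'_def)
    then have "w \<notin> D" using ui(2)[of w] by simp
    then show False using hD that(1) by blast
  qed
  have h'c: "h' c \<noteq> c"
  proof
    assume "h' c = c"
    then have "u (h c) = u c" by (simp add: h'_def iuc uc)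
    then show False using \<open>h c \<noteq> c\<close> ui(1) by metis
  qed
  have hb: "bij h" "bij h'" using permutes_bij NS hN h'N by blast+
  define x y where "x = h c" and "y = h' c"
  have cyc: "cyc3 c x y \<in> N"
  proof -
    have "h' \<in> alternating S" using perm_subgroupD(1)[OF N] h'N by blast
    then have "h \<circ> h' \<circ> inv' h \<circ> inv' h' \<in> N" by (rule comm[OF hN])
    then show ?thesis unfolding x_def y_def
      using commutator_cyc3[OF hb \<open>h c \<noteq> c\<close> h'c only] by simp
  qed
  have xy: "x \<in> S" "y \<in> S" using c NS[OF hN] NS[OF h'N] by (auto simp: x_def y_def permutes_in_image)
  have "x \<noteq> y"
  proof
    assume "x = y"
    have "h x \<noteq> x" "h' y \<noteq> y"
      using \<open>h c \<noteq> c\<close> h'c bij_is_inj[OF hb(1)] bij_is_inj[OF hb(2)] by (auto simp: x_def y_def inj_eq)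
    then have "x = c" using only[of x] \<open>x = y\<close> by simp
    then show False using \<open>h c \<noteq> c\<close> by (simp add: x_def)
  qed
  then have dist: "distinct [c, x, y]" using \<open>h c \<noteq> c\<close> h'c by (auto simp: x_def y_def)
  have "S \<subseteq> linked N c"
  proof
    fix d assume d: "d \<in> S"
    show "d \<in> linked N c"
    proof (cases "d = c \<or> d = x \<or> d = y")
      case True
      have "cyc3 c y x \<in> N" using perm_subgroup_cyc3_inv[of S N c x y] N dist cyc by simp
      then have "y \<in> linked N c" unfolding linked_def using dist by (auto intro!: exI[of _ x])
      moreover have "x \<in> linked N c" unfolding linked_def using dist cyc by (auto intro!: exI[of _ y])
      ultimately show ?thesis using True linked_refl[OF N S(1)] by blast
    next
      case False
      obtain e where e: "e \<in> S" "e \<notin> {c, x, y, d}"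
        using avoid_list[of "[c, x, y, d]"] by auto
      \<comment> \<open>It carries \<open>x\<close> to \<open>d\<close> and fixes \<open>c\<close>
        and \<open>y\<close>; \<open>e\<close> is a spare point.\<close>
      let ?s = "cyc3 x d e"
      have sA: "?s \<in> alternating S" by (rule cyc3_alternating) (use False e d xy dist in auto)
      have "?s \<circ> cyc3 c x y \<circ> inv' ?s \<in> N" by (rule normal[OF sA cyc])
      then have "cyc3 (?s c) (?s x) (?s y) \<in> N"
        using cyc3_conj[OF permutes_bij[OF alternating_permutes[OF sA]]] by metis
      moreover have "?s c = c" "?s x = d" "?s y = y" using False e dist by (auto simp: cyc3_def)
      ultimately have "cyc3 c d y \<in> N" by simp
      then show ?thesis unfolding linked_def using False dist by (auto intro!: exI[of _ y])
    qed
  qed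
  then have "linked N c = S" using linked_subset[OF N S(1) c(1)] by blast
  then have "alternating S \<subseteq> N" using alternating_linked_subset[OF N S(1) c(1)] by simp
  then show ?thesis using perm_subgroupD(1)[OF N] by blast
qed

section \<open>Covers of alternating groups split by cocycles\<close>

lemma exists_fresh:
  assumes "length xs < card S"
  shows "\<exists>c\<in>S. c \<notin> set xs"
proof (rule ccontr)
  assume "\<not> ?thesis"
  then have "S \<subseteq> set xs" by blast
  then show False using card_mono[of "set xs" S] card_length[of xs] assms by simp
qed

lemma alternating_transitive:
  assumes "card S > 3" "a \<in> S" "b \<in> S" "u \<noteq> a" "u \<noteq> b"
  shows "\<exists>p\<in>alternating S. p a = b \<and> p u = u"
proof (cases "a = b")
  case True
  then show ?thesis by (intro bexI[of _ id]) (auto simp: alternating_def)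
next
  case False
  obtain c where c: "c \<in> S" "c \<notin> set [a, b, u]" using exists_fresh[of "[a, b, u]" S] assms(1) by auto
  have "cyc3 a b c \<in> alternating S" by (rule cyc3_alternating) (use False c assms in auto)
  then show ?thesis using assms c by (intro bexI[of _ "cyc3 a b c"]) (auto simp: cyc3_def)
qed

lemma alternating_2_transitive:
  assumes S: "finite S" "card S > 3" and "a \<in> S" "b \<in> S" "u \<in> S" "v \<in> S" "a \<noteq> b" "u \<noteq> v"
  shows "\<exists>p\<in>alternating S. p a = u \<and> p b = v"
proof -
  obtain c where c: "c \<in> S" "c \<notin> set [a, u]" using exists_fresh[of "[a, u]" S] S(2) by auto
  obtain p where p: "p \<in> alternating S" "p a = u" "p c = c"
    using alternating_transitive[OF S(2) \<open>a \<in> S\<close> \<open>u \<in> S\<close>, of c] c by auto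
  have ps: "p permutes S" using alternating_permutes[OF p(1)] .
  have "p b \<in> S" using ps assms(4) by (simp add: permutes_in_image)
  moreover have "p b \<noteq> u" using permutes_inj[OF ps] p(2) assms(7) by (metis injD)
  ultimately obtain q where q: "q \<in> alternating S" "q (p b) = v" "q u = u"
    using alternating_transitive[OF S(2), of "p b" v u] assms by auto
  show ?thesis
    by (rule bexI[of _ "q \<circ> p"]) (use p q alternating_comp[OF S(1) q(1) p(1)] in auto)
qed

section \<open>Groups mapped onto an alternating group\<close>

locale alternating_cover = group G for G :: "('a, 'm) monoid_scheme" (structure) +
  fixes S :: "'b set" and act :: "'a \<Rightarrow> 'b \<Rightarrow> 'b"
  assumes finite_S: "finite S"
    and act_mult: "\<lbrakk>g \<in> carrier G; h \<in> carrier G\<rbrakk> \<Longrightarrow> act (g \<otimes> h) = act g \<circ> act h"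
    and act_onto: "act ` carrier G = alternating S"
begin

lemma act_alternating: "g \<in> carrier G \<Longrightarrow> act g \<in> alternating S"
  using act_onto by blast

lemma act_permutes: "g \<in> carrier G \<Longrightarrow> act g permutes S"
  using act_alternating alternating_permutes by blast

lemma act_in: "g \<in> carrier G \<Longrightarrow> i \<in> S \<Longrightarrow> act g i \<in> S"
  using act_permutes by (simp add: permutes_in_image)

lemma act_mult_apply: "\<lbrakk>g \<in> carrier G; h \<in> carrier G\<rbrakk> \<Longrightarrow> act (g \<otimes> h) i = act g (act h i)"
  by (simp add: act_mult)

lemma act_one: "act \<one> = id"
proof -
  have "act \<one> \<circ> act \<one> = act \<one>" using act_mult[of \<one> \<one>] by simp
  then have "act \<one> (act \<one> x) = act \<one> x" for x by (metis comp_apply)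
  then show ?thesis using permutes_inj[OF act_permutes[OF one_closed]] by (metis eq_id_iff injD)
qed

lemma act_inv_apply:
  assumes "g \<in> carrier G"
  shows "act (inv g) (act g i) = i" "act g (act (inv g) i) = i"
  using act_mult_apply[of "inv g" g i] act_mult_apply[of g "inv g" i] assms by (simp_all add: act_one)

lemma act_inv: "g \<in> carrier G \<Longrightarrow> act (inv g) = inv' (act g)"
  by (rule inv_unique_comp[symmetric]) (auto simp: fun_eq_iff act_inv_apply)

lemma act_lift: "p \<in> alternating S \<Longrightarrow> \<exists>g\<in>carrier G. act g = p"
  using act_onto by (metis imageE)

definition ker where "ker = {g \<in> carrier G. act g = id}"

lemma kerD: "m \<in> ker \<Longrightarrow> m \<in> carrier G" "m \<in> ker \<Longrightarrow> act m = id" "m \<in> ker \<Longrightarrow> act m i = i"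
  by (auto simp: ker_def)

lemma subgroup_ker: "subgroup ker G"
  by (rule subgroupI) (auto simp: ker_def act_one act_mult act_inv intro!: exI[of _ \<one>])

lemma ker_conj: "g \<in> carrier G \<Longrightarrow> m \<in> ker \<Longrightarrow> g \<otimes> m \<otimes> inv g \<in> ker"
  by (auto simp: ker_def fun_eq_iff act_mult act_inv_apply)

lemma same_act: "g \<in> carrier G \<Longrightarrow> h \<in> carrier G \<Longrightarrow> act g = act h \<Longrightarrow> inv g \<otimes> h \<in> ker"
  using act_inv_apply(1)[of h] by (auto simp: ker_def fun_eq_iff act_mult) (metis act_inv_apply(1))

lemma act_onto_of_cyc3:
  assumes K: "subgroup K G"
    and cyc: "\<And>a b c. distinct [a, b, c] \<Longrightarrow> {a, b, c} \<subseteq> S \<Longrightarrow> \<exists>h\<in>K. act h = cyc3 a b c"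
  shows "act ` K = alternating S"
proof
  show "act ` K \<subseteq> alternating S" using act_alternating subgroup.subset[OF K] by blast
  show "alternating S \<subseteq> act ` K"
  proof (rule alternating_subset_of_cyc3[OF finite_S])
    show "id \<in> act ` K" using act_one subgroup.one_closed[OF K] by (metis imageI)
    show "p \<circ> q \<in> act ` K" if pq: "p \<in> act ` K" "q \<in> act ` K" for p q
    proof -
      obtain g h where gh: "g \<in> K" "h \<in> K" "p = act g" "q = act h" using pq by blast
      then have "act (g \<otimes> h) = p \<circ> q" using act_mult subgroup.subset[OF K] by blast
      then show ?thesis using subgroup.m_closed[OF K gh(1,2)] by (metis imageI)
    qed
    show "cyc3 a b c \<in> act ` K" if "distinct [a, b, c]" "{a, b, c} \<subseteq> S" for a b c
      using cyc[OF that] by (metis imageI)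
  qed
qed

end

text \<open>A monomial representation on the points: \<open>g\<close> sends the basis vector at
  \<open>i\<close> to \<open>\<kappa> g i\<close> times the one at \<open>act g i\<close>, and
  \<open>\<kappa>_mult\<close> is the multiplication of such matrices. On \<open>ker\<close> the
  matrices are diagonal, and they are not all the identity.\<close>

locale root_cocycle = alternating_cover G S act for G :: "('a, 'm) monoid_scheme" (structure) and S :: "'b set" and act +
  fixes p :: nat and \<kappa> :: "'a \<Rightarrow> 'b \<Rightarrow> complex"
  assumes prime_p: "Factorial_Ring.prime p"
    and \<kappa>_mult: "\<lbrakk>g \<in> carrier G; h \<in> carrier G; i \<in> S\<rbrakk> \<Longrightarrow> \<kappa> (g \<otimes> h) i = \<kappa> g (act h i) * \<kappa> h i"
    and \<kappa>_root: "\<lbrakk>g \<in> carrier G; i \<in> S\<rbrakk> \<Longrightarrow> \<kappa> g i ^ p = 1"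
    and nontrivial: "\<exists>m\<in>ker. \<exists>i\<in>S. \<kappa> m i \<noteq> 1"
    and card_S: "card S > 9"
begin

section \<open>Values of the cocycle and its invariant sections\<close>

lemma \<kappa>_nz: "\<lbrakk>g \<in> carrier G; i \<in> S\<rbrakk> \<Longrightarrow> \<kappa> g i \<noteq> 0"
  using \<kappa>_root[of g i] prime_p prime_gt_0_nat[of p] by (auto simp: power_0_left)

lemma \<kappa>_one: "i \<in> S \<Longrightarrow> \<kappa> \<one> i = 1"
  using \<kappa>_mult[of \<one> \<one> i] \<kappa>_nz[of \<one> i] by (simp add: act_one)

lemma \<kappa>_inv: "g \<in> carrier G \<Longrightarrow> i \<in> S \<Longrightarrow> \<kappa> (inv g) (act g i) * \<kappa> g i = 1"
  using \<kappa>_mult[of "inv g" g i] by (simp add: \<kappa>_one)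

lemma \<kappa>_ker: "\<lbrakk>m \<in> ker; n \<in> ker; i \<in> S\<rbrakk> \<Longrightarrow> \<kappa> (m \<otimes> n) i = \<kappa> m i * \<kappa> n i"
  using \<kappa>_mult[of m n i] kerD by simp

lemma \<kappa>_ker_inv: "\<lbrakk>m \<in> ker; i \<in> S\<rbrakk> \<Longrightarrow> \<kappa> (inv m) i = inverse (\<kappa> m i)"
  using \<kappa>_inv[of m i] kerD[of m] inverse_unique[of "\<kappa> m i" "\<kappa> (inv m) i"]
  by (simp add: mult.commute)

lemma \<kappa>_ker_pow: "\<lbrakk>m \<in> ker; i \<in> S\<rbrakk> \<Longrightarrow> m [^] (j::nat) \<in> ker \<and> \<kappa> (m [^] j) i = \<kappa> m i ^ j"
proof (induction j)
  case 0
  then show ?case using subgroup.one_closed[OF subgroup_ker] by (simp add: \<kappa>_one)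
next
  case (Suc j)
  then show ?case using subgroup.m_closed[OF subgroup_ker] by (simp add: \<kappa>_ker)
qed

text \<open>Conjugation by \<open>g\<close> permutes the entries of the diagonal matrix of
  \<open>m\<close>, so the vectors coming from \<open>ker\<close> are closed under even permutations
  of coordinates.\<close>

lemma \<kappa>_ker_conj:
  assumes "g \<in> carrier G" "m \<in> ker" "i \<in> S"
  shows "\<kappa> (g \<otimes> m \<otimes> inv g) (act g i) = \<kappa> m i"
proof -
  have "\<kappa> (g \<otimes> m \<otimes> inv g) (act g i) = \<kappa> g i * \<kappa> m i * \<kappa> (inv g) (act g i)"
    using assms kerD[OF assms(2)] by (simp add: \<kappa>_mult act_in act_inv_apply)
  also have "\<dots> = \<kappa> m i * (\<kappa> (inv g) (act g i) * \<kappa> g i)" by simp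
  finally show ?thesis using \<kappa>_inv[OF assms(1,3)] by simp
qed

text \<open>As \<open>p\<close> is prime, a root \<open>c\<close> other than 1 has \<open>p\<close>
  distinct powers, and these are all the roots of unity of order dividing \<open>p\<close>.\<close>

lemma root_power:
  assumes "c ^ p = 1" "c \<noteq> 1" "r ^ p = (1 :: complex)"
  shows "\<exists>j::nat. r = c ^ j"
proof -
  have p0: "p > 0" using prime_p prime_gt_0_nat by blast
  have inj: "inj_on (\<lambda>j::nat. c ^ j) {..<p}"
  proof (rule linorder_inj_onI)
    fix i j assume ij: "i < j" "i \<in> {..<p}" "j \<in> {..<p}"
    show "c ^ i \<noteq> c ^ j"
    proof
      assume "c ^ i = c ^ j"
      moreover have "c \<noteq> 0" using assms(1) p0 by (auto simp: power_0_left)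
      moreover have "c ^ j = c ^ i * c ^ (j - i)" using ij by (simp flip: power_add)
      ultimately have c1: "c ^ (j - i) = 1" by simp
      have "coprime (j - i) p"
        using ij prime_p by (metis coprime_commute dvd_imp_le lessThan_iff less_imp_diff_less linorder_not_le prime_imp_coprime zero_less_diff)
      then obtain x y where "(j - i) * x = Suc (p * y)"
        using coprime_bezout_strong[of "j - i" p] prime_p prime_gt_1_nat[of p] by (metis One_nat_def Suc_eq_plus1 less_numeral_extra(4) plus_1_eq_Suc)
      then have "c ^ ((j - i) * x) = c ^ Suc (p * y)" by simp
      then show False using assms(1,2) c1 by (simp add: power_mult)
    qed
  qed auto
  have sub: "(\<lambda>j::nat. c ^ j) ` {..<p} \<subseteq> {z. z ^ p = 1}"
  proof (rule image_subsetI)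
    fix j
    have "(c ^ j) ^ p = (c ^ p) ^ j" by (simp only: power_mult[symmetric] mult.commute)
    then show "c ^ j \<in> {z. z ^ p = 1}" using assms(1) by simp
  qed
  have "card {z::complex. z ^ p = 1} = p" using p0 by (rule card_roots_unity_eq)
  moreover have "finite {z::complex. z ^ p = 1}" using p0 by (intro finite_roots_unity) simp
  ultimately have "(\<lambda>j::nat. c ^ j) ` {..<p} = {z. z ^ p = 1}"
    using card_subset_eq[OF _ sub] card_image[OF inj] by simp
  then show ?thesis using assms(3) by blast
qed

text \<open>The elements compatible with \<open>s\<close> form the stabilizer of the vector
  \<open>s\<close>, so lifts of 3-cycles in it are enough. A kernel element in it has
  \<open>\<kappa>\<close> equal to 1 everywhere, since \<open>s\<close> has no zero; by
  \<open>nontrivial\<close> the stabilizer is proper.\<close>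

lemma supplement_of_section:
  assumes s: "\<And>i. i \<in> S \<Longrightarrow> s i \<noteq> 0"
    and cyc: "\<And>a b c. distinct [a, b, c] \<Longrightarrow> {a, b, c} \<subseteq> S \<Longrightarrow>
      \<exists>h\<in>carrier G. act h = cyc3 a b c \<and> (\<forall>i\<in>S. s (act h i) = s i * \<kappa> h i)"
  shows "\<exists>K. subgroup K G \<and> K \<noteq> carrier G \<and> act ` K = alternating S"
proof -
  define K where "K = {h \<in> carrier G. \<forall>i\<in>S. s (act h i) = s i * \<kappa> h i}"
  have K: "subgroup K G"
  proof (rule subgroupI)
    show "K \<noteq> {}" using \<kappa>_one by (auto simp: K_def act_one intro!: exI[of _ \<one>])
    show "inv h \<in> K" if "h \<in> K" for h
    proof -
      have h: "h \<in> carrier G" using that by (simp add: K_def)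
      have "s (act (inv h) i) = s i * \<kappa> (inv h) i" if "i \<in> S" for i
      proof -
        let ?j = "act (inv h) i"
        have j: "?j \<in> S" using act_in h that by simp
        have "s (act h ?j) = s ?j * \<kappa> h ?j" using \<open>h \<in> K\<close> j by (simp add: K_def)
        then have "s i = s ?j * \<kappa> h ?j" using act_inv_apply(2)[OF h] by simp
        moreover have "\<kappa> (inv h) i * \<kappa> h ?j = 1" using \<kappa>_inv[OF h j] act_inv_apply(2)[OF h] by simp
        ultimately have "s i * \<kappa> (inv h) i = s ?j * (\<kappa> (inv h) i * \<kappa> h ?j)" by (simp add: mult.commute)
        then show ?thesis using \<open>\<kappa> (inv h) i * \<kappa> h ?j = 1\<close> by (simp add: mult.commute)
      qed
      then show ?thesis using h by (simp add: K_def)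
    qed
    show "g \<otimes> h \<in> K" if "g \<in> K" "h \<in> K" for g h
      using that by (auto simp: K_def act_mult_apply act_in \<kappa>_mult)
  qed (auto simp: K_def)
  moreover have "K \<noteq> carrier G"
  proof -
    obtain m i where "m \<in> ker" "i \<in> S" "\<kappa> m i \<noteq> 1" using nontrivial by blast
    then have "m \<notin> K" using s kerD[of m] by (auto simp: K_def)
    then show ?thesis using \<open>m \<in> ker\<close> kerD(1) by blast
  qed
  moreover have "act ` K = alternating S"
  proof (rule act_onto_of_cyc3[OF K])
    fix a b c assume "distinct [a, b, c]" "{a, b, c} \<subseteq> S"
    from cyc[OF this] show "\<exists>h\<in>K. act h = cyc3 a b c" unfolding K_def by blast
  qed
  ultimately show ?thesis by blast
qed

text \<open>A commutator as lift makes quantities that are multiplicative on \<open>G\<close>, or on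
  the stabilizer of a point, equal to 1.\<close>

lemma commutator_lift:
  assumes "distinct [a, b, c, d, e]" "{a, b, c, d, e} \<subseteq> S"
  shows "\<exists>g\<in>carrier G. \<exists>h\<in>carrier G. act g = cyc3 a b d \<and> act h = cyc3 a c e \<and>
    act (g \<otimes> h \<otimes> inv g \<otimes> inv h) = cyc3 a b c"
proof -
  have "cyc3 a b d \<in> alternating S" "cyc3 a c e \<in> alternating S"
    using assms by (auto intro!: cyc3_alternating)
  then obtain g h where gh: "g \<in> carrier G" "h \<in> carrier G" "act g = cyc3 a b d" "act h = cyc3 a c e"
    using act_lift by metis
  moreover have "act (g \<otimes> h \<otimes> inv g \<otimes> inv h) = cyc3 a b c"
    using gh by (simp add: act_mult act_inv cyc3_commutator[OF assms(1)])
  ultimately show ?thesis by blast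
qed


text \<open>By constancy on \<open>ker\<close>, the ratio of \<open>\<kappa> h a\<close> to
  \<open>\<kappa> h b\<close> depends only on \<open>act h\<close>. It is thus a homomorphism from
  the alternating group on the other points to an abelian group, and 3-cycles are sent to 1 because
  they lift to commutators of elements fixing \<open>a\<close> and \<open>b\<close>.\<close>

lemma constant_case_two_fixed_points:
  assumes const: "\<forall>m\<in>ker. \<forall>i\<in>S. \<forall>j\<in>S. \<kappa> m i = \<kappa> m j"
    and ab: "a \<in> S" "b \<in> S" and h: "h \<in> carrier G" "act h a = a" "act h b = b"
  shows "\<kappa> h a = \<kappa> h b"
proof -
  define Q where "Q = {q. \<exists>g\<in>carrier G. act g = q \<and> q a = a \<and> q b = b \<and> \<kappa> g a = \<kappa> g b}"
  have "alternating (S - {a, b}) \<subseteq> Q"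
  proof (rule alternating_subset_of_cyc3)
    show "finite (S - {a, b})" using finite_S by simp
    show "id \<in> Q" unfolding Q_def using \<kappa>_one ab act_one by (auto intro!: bexI[of _ \<one>])
    show "q \<circ> r \<in> Q" if qr: "q \<in> Q" "r \<in> Q" for q r
    proof -
      obtain g g' where g: "g \<in> carrier G" "act g = q" "\<kappa> g a = \<kappa> g b"
        and g': "g' \<in> carrier G" "act g' = r" "\<kappa> g' a = \<kappa> g' b"
        and fx: "q a = a" "q b = b" "r a = a" "r b = b"
        using qr unfolding Q_def by blast
      show ?thesis unfolding Q_def using g g' fx ab
        by (intro CollectI bexI[of _ "g \<otimes> g'"]) (simp_all add: act_mult \<kappa>_mult)
    qed
    show "cyc3 u v w \<in> Q" if uvw: "distinct [u, v, w]" "{u, v, w} \<subseteq> S - {a, b}" for u v w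
    proof -
      obtain d where d: "d \<in> S" "d \<notin> set [u, v, w, a, b]"
        using exists_fresh[of "[u, v, w, a, b]" S] card_S by auto
      obtain e where e: "e \<in> S" "e \<notin> set [u, v, w, a, b, d]"
        using exists_fresh[of "[u, v, w, a, b, d]" S] card_S by auto
      have "distinct [u, v, w, d, e]" "{u, v, w, d, e} \<subseteq> S" using uvw d e by auto
      then obtain g k where g: "g \<in> carrier G" "act g = cyc3 u v d" and k: "k \<in> carrier G" "act k = cyc3 u w e"
        and gk: "act (g \<otimes> k \<otimes> inv g \<otimes> inv k) = cyc3 u v w"
        using commutator_lift[of u v w d e] by blast
      have comm: "\<kappa> (g \<otimes> k \<otimes> inv g \<otimes> inv k) i = 1" if "i \<in> S" "cyc3 u v d i = i" "cyc3 u w e i = i" for i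
      proof -
        have fx: "act g i = i" "act k i = i" using g k that by simp_all
        then have fx': "act (inv g) i = i" "act (inv k) i = i" using act_inv_apply(1) g k by metis+
        have "\<kappa> (g \<otimes> k \<otimes> inv g \<otimes> inv k) i = (\<kappa> (inv g) i * \<kappa> g i) * (\<kappa> (inv k) i * \<kappa> k i)"
          using g k that fx fx' by (simp add: \<kappa>_mult)
        then show ?thesis using \<kappa>_inv[OF g(1) that(1)] \<kappa>_inv[OF k(1) that(1)] fx by simp
      qed
      have "cyc3 u v d i = i" "cyc3 u w e i = i" "cyc3 u v w i = i" if "i = a \<or> i = b" for i
        using that uvw(2) d(2) e(2) by (auto simp: cyc3_def)
      then show ?thesis unfolding Q_def using gk g(1) k(1) comm ab
        by (intro CollectI bexI[of _ "g \<otimes> k \<otimes> inv g \<otimes> inv k"]) auto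
    qed
  qed
  moreover have "act h \<in> alternating (S - {a, b})"
    using act_alternating[OF h(1)] permutes_superset[of "act h" S "S - {a, b}"] h
    by (auto simp: alternating_def)
  ultimately have "act h \<in> Q" by blast
  then obtain g where g: "g \<in> carrier G" "act g = act h" "\<kappa> g a = \<kappa> g b" unfolding Q_def by auto
  have m: "inv g \<otimes> h \<in> ker" using same_act g h by simp
  have "\<kappa> h i = \<kappa> g i * \<kappa> (inv g \<otimes> h) i" if "i \<in> S" for i
    using \<kappa>_mult[OF g(1) kerD(1)[OF m] that] kerD(3)[OF m] g(1) h(1) by (simp add: m_assoc[symmetric])
  moreover have "\<kappa> (inv g \<otimes> h) a = \<kappa> (inv g \<otimes> h) b" using const m ab by blast
  ultimately show ?thesis using ab g(3) by simp
qed

text \<open>An even permutation with a fixed point is lifted so that \<open>\<kappa>\<close> is 1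
  there, after correction by a power of \<open>m0\<close>; by the preceding lemma all fixed points
  impose the same condition. The value of such a normalized lift at a base point \<open>z\<close>
  depends only on the image of \<open>z\<close>, and this dependence is the section.\<close>

lemma constant_case:
  assumes const: "\<forall>m\<in>ker. \<forall>i\<in>S. \<forall>j\<in>S. \<kappa> m i = \<kappa> m j"
  shows "\<exists>K. subgroup K G \<and> K \<noteq> carrier G \<and> act ` K = alternating S"
proof -
  note two = constant_case_two_fixed_points[OF const]
  obtain m0 i0 where m0: "m0 \<in> ker" "i0 \<in> S" "\<kappa> m0 i0 \<noteq> 1" using nontrivial by blast
  have lift: "\<exists>h\<in>carrier G. act h = q \<and> \<kappa> h a = 1" if q: "q \<in> alternating S" "a \<in> S" for q a
  proof -
    obtain g where g: "g \<in> carrier G" "act g = q" using act_lift q(1) by blast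
    have "inverse (\<kappa> g a) ^ p = 1" using \<kappa>_root[OF g(1) q(2)] by (simp add: power_inverse)
    moreover have "\<kappa> m0 a = \<kappa> m0 i0" using const m0(1,2) q(2) by blast
    then have "\<kappa> m0 a \<noteq> 1" using m0(3) by simp
    ultimately obtain j where "inverse (\<kappa> g a) = \<kappa> m0 a ^ (j::nat)"
      using root_power[OF \<kappa>_root[OF kerD(1)[OF m0(1)] q(2)]] by blast
    then have j: "m0 [^] j \<in> ker" "\<kappa> (m0 [^] j) a = inverse (\<kappa> g a)" using \<kappa>_ker_pow m0 q(2) by auto
    have "\<kappa> (g \<otimes> m0 [^] j) a = 1"
      using \<kappa>_mult[OF g(1) kerD(1)[OF j(1)] q(2)] kerD(3)[OF j(1)] j(2) \<kappa>_nz[OF g(1) q(2)] by simp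
    moreover have "act (g \<otimes> m0 [^] j) = q" using g kerD[OF j(1)] by (simp add: act_mult)
    ultimately show ?thesis using g(1) kerD(1)[OF j(1)] by blast
  qed
  define z where "z = i0"
  have z: "z \<in> S" using m0 by (simp add: z_def)
  \<comment> \<open>A normalized lift taking the base point \<open>z\<close> to \<open>i\<close>;
    one fixed point with value 1 stands for all of them by \<open>good_fix\<close>.\<close>
  define good where "good h i \<longleftrightarrow> h \<in> carrier G \<and> act h z = i \<and> (\<exists>a\<in>S. act h a = a \<and> \<kappa> h a = 1)" for h i
  have good_fix: "\<kappa> h a = 1" if "good h i" "a \<in> S" "act h a = a" for h i a
    using that two[of _ a h] unfolding good_def by metis
  \<comment> \<open>The quotient of \<open>h\<close> and \<open>k\<close> fixes both
    \<open>z\<close> and the common fixed point \<open>a\<close>, so \<open>two\<close> carries the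
    value 1 from \<open>a\<close> to \<open>z\<close>.\<close>
  have good1: "\<kappa> h z = \<kappa> k z" if "good h i" "good k i" "a \<in> S" "act h a = a" "act k a = a" for h k i a
  proof -
    have hk: "h \<in> carrier G" "k \<in> carrier G" "act h z = i" "act k z = i" using that by (auto simp: good_def)
    let ?g = "inv h \<otimes> k"
    have g: "?g \<in> carrier G" "act ?g z = z" "act ?g a = a"
      using hk that act_inv_apply(1)[OF hk(1)] by (simp_all add: act_mult_apply) metis+
    have k: "k = h \<otimes> ?g" using hk by (simp add: m_assoc[symmetric])
    have "\<kappa> k a = \<kappa> h a * \<kappa> ?g a" using \<kappa>_mult[OF hk(1) g(1) that(3)] g(3) k by simp
    then have "\<kappa> ?g a = 1" using good_fix that by simp
    then have "\<kappa> ?g z = 1" using two[OF z that(3) g] by simp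
    then show ?thesis using \<kappa>_mult[OF hk(1) g(1) z] g(2) k by simp
  qed
  have ex: "\<exists>h. good h i \<and> (\<forall>a\<in>set xs. act h a = a)"
    if i: "i \<in> S" and xs: "set xs \<subseteq> S - {z, i} \<or> i = z \<and> set xs \<subseteq> S" "length xs \<le> 4" for i xs
  proof -
    obtain c where c: "c \<in> S" "c \<notin> set (z # i # xs)"
      using exists_fresh[of "z # i # xs" S] card_S xs by auto
    obtain a where a: "a \<in> S" "a \<notin> set (z # i # c # xs)"
      using exists_fresh[of "z # i # c # xs" S] card_S xs by auto
    show ?thesis
    proof (cases "i = z")
      case True
      then show ?thesis using z by (intro exI[of _ \<one>]) (auto simp: good_def act_one \<kappa>_one)
    next
      case False
      have "cyc3 z i c \<in> alternating S" by (rule cyc3_alternating) (use False c i z in auto)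
      then obtain h where h: "h \<in> carrier G" "act h = cyc3 z i c" "\<kappa> h a = 1" using lift a(1) by blast
      have "act h a = a" using a h(2) by (auto simp: cyc3_def)
      moreover have "act h z = i" using h(2) by (simp add: cyc3_def)
      ultimately have "good h i" using h(1,3) a(1) unfolding good_def by blast
      moreover have "act h b = b" if "b \<in> set xs" for b
        using that c xs(1) False h(2) by (auto simp: cyc3_def)
      ultimately show ?thesis by blast
    qed
  qed
  \<comment> \<open>Without a common fixed point, \<open>h\<close> and \<open>k\<close> are compared
    through a third normalized lift sharing one fixed point with each. If \<open>i\<close> is not
    \<open>z\<close>, neither of these points is \<open>z\<close> or \<open>i\<close>, as
    \<open>ex\<close> requires.\<close>
  have good2: "\<kappa> h z = \<kappa> k z" if hk: "good h i" "good k i" for h k i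
  proof -
    obtain a b where a: "a \<in> S" "act h a = a" and b: "b \<in> S" "act k b = b" using hk by (auto simp: good_def)
    have hk': "h \<in> carrier G" "k \<in> carrier G" "act h z = i" "act k z = i" using hk by (auto simp: good_def)
    have i: "i \<in> S" using act_in[OF hk'(1) z] hk'(3) by simp
    have fa: "a = z \<or> a = i \<Longrightarrow> i = z"
      using a hk' permutes_inj[OF act_permutes[OF hk'(1)]] by (metis injD)
    have fb: "b = z \<or> b = i \<Longrightarrow> i = z"
      using b hk' permutes_inj[OF act_permutes[OF hk'(2)]] by (metis injD)
    have "set [a, b] \<subseteq> S - {z, i} \<or> i = z \<and> set [a, b] \<subseteq> S" using a b fa fb by auto
    then obtain g where "good g i" "act g a = a" "act g b = b" using ex[OF i, of "[a, b]"] by auto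
    then show ?thesis using good1[OF hk(1) _ a(1)] good1[OF hk(2) _ b(1)] a b by metis
  qed
  define s where "s i = \<kappa> (SOME h. good h i) z" for i
  have s: "s i = \<kappa> h z" if "good h i" for h i
    unfolding s_def by (rule good2[OF someI[of "\<lambda>h. good h i", OF that] that])
  show ?thesis
  proof (rule supplement_of_section[where s = s])
    fix i assume "i \<in> S"
    then obtain h where h: "good h i" using ex[of i "[]"] by (auto simp: good_def)
    then show "s i \<noteq> 0" using s[OF h] \<kappa>_nz z by (simp add: good_def)
  next
    fix a b c assume abc: "distinct [a, b, c]" "{a, b, c} \<subseteq> S"
    obtain d where d: "d \<in> S" "d \<notin> set [a, b, c]" using exists_fresh[of "[a, b, c]" S] card_S by auto
    obtain h where h: "h \<in> carrier G" "act h = cyc3 a b c" "\<kappa> h d = 1"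
      using lift[OF cyc3_alternating[OF abc] d(1)] by blast
    have hd: "act h d = d" using d h(2) by (auto simp: cyc3_def)
    have "s (act h i) = s i * \<kappa> h i" if i: "i \<in> S" for i
    proof -
      \<comment> \<open>A point fixed by \<open>h\<close> and also by the normalized lift
        \<open>g\<close> for \<open>i\<close>: the product \<open>h \<otimes> g\<close> is then
        normalized too and computes the section at \<open>act h i\<close>.\<close>
      obtain f where f: "f \<in> S" "f \<notin> set [a, b, c, z, i]"
        using exists_fresh[of "[a, b, c, z, i]" S] card_S by auto
      obtain g where g: "good g i" "act g f = f" using ex[OF i, of "[f]"] f by auto
      have g': "g \<in> carrier G" "act g z = i" using g by (auto simp: good_def)
      have hf: "act h f = f" using f h(2) by (auto simp: cyc3_def)
      have "\<kappa> h f = 1" using two[OF d(1) f(1) h(1) hd hf] h(3) by simp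
      then have "\<kappa> (h \<otimes> g) f = 1"
        using \<kappa>_mult[OF h(1) g'(1) f(1)] good_fix[OF g(1) f(1) g(2)] g(2) by simp
      then have "good (h \<otimes> g) (act h i)"
        using h(1) g' g(2) hf f(1) by (auto simp: good_def act_mult_apply intro!: bexI[of _ f])
      then have "s (act h i) = \<kappa> (h \<otimes> g) z" by (rule s)
      then show ?thesis using \<kappa>_mult[OF h(1) g'(1) z] g'(2) s[OF g(1)] by simp
    qed
    then show "\<exists>h\<in>carrier G. act h = cyc3 a b c \<and> (\<forall>i\<in>S. s (act h i) = s i * \<kappa> h i)"
      using h by blast
  qed
qed


text \<open>Dividing a kernel element by its conjugate under a 3-cycle leaves a vector supported on
  the three points of the cycle. Doing this twice, with 3-cycles sharing one point, leaves two
  nontrivial entries, inverse to each other.\<close>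

lemma elementary_kernel_element:
  assumes m: "m \<in> ker" "i \<in> S" "j \<in> S" "\<kappa> m i \<noteq> \<kappa> m j"
  shows "\<exists>n\<in>ker. \<exists>a\<in>S. \<exists>b\<in>S. a \<noteq> b \<and> \<kappa> n a \<noteq> 1 \<and> \<kappa> n b = inverse (\<kappa> n a) \<and>
    (\<forall>w\<in>S - {a, b}. \<kappa> n w = 1)"
proof -
  have step: "\<exists>n'\<in>ker. \<kappa> n' x = \<kappa> n x / \<kappa> n z \<and> \<kappa> n' y = \<kappa> n y / \<kappa> n x \<and>
      \<kappa> n' z = \<kappa> n z / \<kappa> n y \<and> (\<forall>w\<in>S - {x, y, z}. \<kappa> n' w = 1)"
    if n: "n \<in> ker" and xyz: "distinct [x, y, z]" "{x, y, z} \<subseteq> S" for n x y z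
  proof -
    obtain h where h: "h \<in> carrier G" "act h = cyc3 x y z" using act_lift cyc3_alternating[OF xyz] by blast
    let ?m = "h \<otimes> n \<otimes> inv h"
    have m: "?m \<in> ker" by (rule ker_conj[OF h(1) n])
    have n': "n \<otimes> inv ?m \<in> ker"
      by (intro subgroup.m_closed[OF subgroup_ker] subgroup.m_inv_closed[OF subgroup_ker] n m)
    have k: "\<kappa> (n \<otimes> inv ?m) w = \<kappa> n w / \<kappa> ?m w" if "w \<in> S" for w
      using \<kappa>_ker[OF n subgroup.m_inv_closed[OF subgroup_ker m] that] \<kappa>_ker_inv[OF m that]
      by (simp add: divide_inverse)
    have c: "\<kappa> ?m (cyc3 x y z w) = \<kappa> n w" if "w \<in> S" for w
      using \<kappa>_ker_conj[OF h(1) n that] h(2) by simp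
    have "\<kappa> ?m y = \<kappa> n x" "\<kappa> ?m z = \<kappa> n y" "\<kappa> ?m x = \<kappa> n z"
      using c[of x] c[of y] c[of z] xyz by (simp_all add: cyc3_def split: if_splits)
    moreover have "\<kappa> ?m w = \<kappa> n w" if "w \<in> S - {x, y, z}" for w
      using c[of w] that by (simp add: cyc3_def)
    ultimately show ?thesis using k xyz \<kappa>_nz[OF kerD(1)[OF n]]
      by (intro bexI[OF _ n']) auto
  qed
  have ij: "i \<noteq> j" using m(4) by auto
  obtain e where e: "e \<in> S" "e \<notin> set [i, j]" using exists_fresh[of "[i, j]" S] card_S by auto
  have d1: "distinct [i, j, e]" "{i, j, e} \<subseteq> S" using ij e m by auto
  obtain n where n: "n \<in> ker" "\<kappa> n j = \<kappa> m j / \<kappa> m i" "\<forall>w\<in>S - {i, j, e}. \<kappa> n w = 1"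
    using step[OF m(1) d1] by blast
  have c: "\<kappa> n j \<noteq> 1" using n(2) m \<kappa>_nz[OF kerD(1)[OF m(1)] m(2)] by simp
  obtain d where d: "d \<in> S" "d \<notin> set [i, j, e]" using exists_fresh[of "[i, j, e]" S] card_S by auto
  obtain f where f: "f \<in> S" "f \<notin> set [i, j, e, d]" using exists_fresh[of "[i, j, e, d]" S] card_S by auto
  \<comment> \<open>\<open>j\<close> carries a nontrivial entry of \<open>n\<close>, while
    \<open>n\<close> is 1 at \<open>d\<close> and \<open>f\<close>; the second division therefore
    gives 1 at \<open>f\<close> and inverse entries at \<open>j\<close> and
    \<open>d\<close>.\<close>
  have d2: "distinct [j, d, f]" "{j, d, f} \<subseteq> S" using d f m by auto
  have nd: "\<kappa> n d = 1" "\<kappa> n f = 1" using n(3) d f by auto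
  obtain n' where n': "n' \<in> ker" "\<kappa> n' j = \<kappa> n j / \<kappa> n f" "\<kappa> n' d = \<kappa> n d / \<kappa> n j"
      "\<kappa> n' f = \<kappa> n f / \<kappa> n d" "\<forall>w\<in>S - {j, d, f}. \<kappa> n' w = 1"
    using step[OF n(1) d2] by blast
  have "\<kappa> n' w = 1" if "w \<in> S - {j, d}" for w
    using that n' nd by (cases "w = f") auto
  then show ?thesis using n' nd c d m(3)
    by (intro bexI[OF _ n'(1)] bexI[of _ j] bexI[of _ d]) (auto simp: divide_inverse)
qed

text \<open>Powers of the elementary element and its conjugates give r and its inverse at any two
  points, because the action is 2-transitive and every root is a power of a nontrivial one. Such
  vectors generate all vectors of product 1.\<close>

lemma nonconstant_case_kernel:
  assumes m: "m \<in> ker" "i \<in> S" "j \<in> S" "\<kappa> m i \<noteq> \<kappa> m j"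
    and f: "\<And>w. w \<in> S \<Longrightarrow> f w ^ p = 1" "(\<Prod>w\<in>S. f w) = 1"
  shows "\<exists>n\<in>ker. \<forall>w\<in>S. \<kappa> n w = f w"
proof -
  obtain n a b where n: "n \<in> ker" "a \<in> S" "b \<in> S" "a \<noteq> b" "\<kappa> n a \<noteq> 1" "\<kappa> n b = inverse (\<kappa> n a)"
      "\<forall>w\<in>S - {a, b}. \<kappa> n w = 1"
    using elementary_kernel_element[OF m] by blast
  have basic: "\<exists>n\<in>ker. \<kappa> n u = r \<and> \<kappa> n v = inverse r \<and> (\<forall>w\<in>S - {u, v}. \<kappa> n w = 1)"
    if uv: "u \<in> S" "v \<in> S" "u \<noteq> v" "r ^ p = 1" for u v r
  proof -
    obtain q where q: "q \<in> alternating S" "q a = u" "q b = v"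
      using alternating_2_transitive[OF finite_S _ n(2,3) uv(1,2) n(4) uv(3)] card_S by auto
    obtain h where h: "h \<in> carrier G" "act h = q" using act_lift q(1) by blast
    obtain k :: nat where k: "r = \<kappa> n a ^ k"
      using root_power[OF \<kappa>_root[OF kerD(1)[OF n(1)] n(2)] n(5) uv(4)] by blast
    let ?n = "n [^] k"
    have nk: "?n \<in> ker" "\<And>w. w \<in> S \<Longrightarrow> \<kappa> ?n w = \<kappa> n w ^ k" using \<kappa>_ker_pow n(1,2) by blast+
    have c: "\<kappa> (h \<otimes> ?n \<otimes> inv h) (q w) = \<kappa> n w ^ k" if "w \<in> S" for w
      using \<kappa>_ker_conj[OF h(1) nk(1) that] h(2) nk(2)[OF that] by simp
    have "\<kappa> (h \<otimes> ?n \<otimes> inv h) w = 1" if w: "w \<in> S - {u, v}" for w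
    proof -
      have qS: "q permutes S" using alternating_permutes q(1) by blast
      obtain x where x: "w = q x" using permutes_surj[OF qS] by (metis surjD)
      then have "x \<in> S - {a, b}" using w q permutes_in_image[OF qS] by auto
      then show ?thesis using c[of x] n(7) x by simp
    qed
    moreover have "\<kappa> (h \<otimes> ?n \<otimes> inv h) u = r" using c[OF n(2)] q k by simp
    moreover have "\<kappa> (h \<otimes> ?n \<otimes> inv h) v = inverse r" using c[OF n(3)] q k n(6) by (simp add: power_inverse)
    ultimately show ?thesis using ker_conj[OF h(1) nk(1)] by blast
  qed
  \<comment> \<open>The coordinate that absorbs the inverses while the others are adjusted one by
    one; the product condition determines it at the end.\<close>
  define v where "v = i"
  have v: "v \<in> S" using m by (simp add: v_def)
  have "\<exists>n\<in>ker. (\<forall>w\<in>T. \<kappa> n w = f w) \<and> (\<forall>w\<in>S - {v} - T. \<kappa> n w = 1) \<and> (\<Prod>w\<in>S. \<kappa> n w) = 1"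
    if "finite T" "T \<subseteq> S - {v}" for T
    using that
  proof (induction T rule: finite_induct)
    case empty
    show ?case using subgroup.one_closed[OF subgroup_ker] \<kappa>_one by (intro bexI[of _ \<one>]) auto
  next
    case (insert u T)
    then obtain n1 where n1: "n1 \<in> ker" "\<forall>w\<in>T. \<kappa> n1 w = f w" "\<forall>w\<in>S - {v} - T. \<kappa> n1 w = 1"
        "(\<Prod>w\<in>S. \<kappa> n1 w) = 1" by blast
    have u: "u \<in> S" "u \<noteq> v" using insert.prems by auto
    obtain n2 where n2: "n2 \<in> ker" "\<kappa> n2 u = f u" "\<kappa> n2 v = inverse (f u)" "\<forall>w\<in>S - {u, v}. \<kappa> n2 w = 1"
      using basic[OF u(1) v u(2) f(1)[OF u(1)]] by blast
    have "f u \<noteq> 0" using \<kappa>_nz[OF kerD(1)[OF n2(1)] u(1)] n2(2) by simp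
    moreover have "(\<Prod>w\<in>S. \<kappa> n2 w) = (\<Prod>w\<in>{u, v}. \<kappa> n2 w)"
      by (rule prod.mono_neutral_right) (use finite_S u v n2(4) in auto)
    ultimately have "(\<Prod>w\<in>S. \<kappa> n2 w) = 1" using n2(2,3) u(2) by simp
    then have "(\<Prod>w\<in>S. \<kappa> (n1 \<otimes> n2) w) = 1" using n1(4) \<kappa>_ker[OF n1(1) n2(1)] by (simp add: prod.distrib)
    moreover have "\<kappa> (n1 \<otimes> n2) w = f w" if "w \<in> insert u T" for w
    proof (cases "w = u")
      case True
      then have "\<kappa> n1 w = 1" using n1(3) u insert.hyps by auto
      then show ?thesis using \<kappa>_ker[OF n1(1) n2(1), of w] n2(2) u True by simp
    next
      case False
      then have w: "w \<in> T" "w \<in> S - {u, v}" using that insert.prems by auto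
      then show ?thesis using \<kappa>_ker[OF n1(1) n2(1), of w] n2(4) n1(2) by simp
    qed
    moreover have "\<kappa> (n1 \<otimes> n2) w = 1" if "w \<in> S - {v} - insert u T" for w
      using \<kappa>_ker[OF n1(1) n2(1), of w] n2(4) n1(3) that by simp
    ultimately show ?case using subgroup.m_closed[OF subgroup_ker n1(1) n2(1)] by blast
  qed
  from this[of "S - {v}"] obtain n1 where n1: "n1 \<in> ker" "\<forall>w\<in>S - {v}. \<kappa> n1 w = f w" "(\<Prod>w\<in>S. \<kappa> n1 w) = 1"
    using finite_S by auto
  have "\<kappa> n1 v * (\<Prod>w\<in>S - {v}. f w) = f v * (\<Prod>w\<in>S - {v}. f w)"
    using n1(2,3) f(2) prod.remove[OF finite_S v, of f] prod.remove[OF finite_S v, of "\<kappa> n1"] by simp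
  moreover have "(\<Prod>w\<in>S - {v}. f w) \<noteq> 0"
    using f(2) prod.remove[OF finite_S v, of f] by auto
  ultimately have "\<kappa> n1 v = f v" by simp
  then show ?thesis using n1(1,2) by blast
qed

text \<open>The product \<open>T\<close> of all entries is a homomorphism to an abelian group, so a
  commutator lift of a 3-cycle has entries of product 1. A kernel element with the inverse entries
  cancels them, which makes the constant section 1 invariant.\<close>

lemma nonconstant_case:
  assumes m: "m \<in> ker" "i \<in> S" "j \<in> S" "\<kappa> m i \<noteq> \<kappa> m j"
  shows "\<exists>K. subgroup K G \<and> K \<noteq> carrier G \<and> act ` K = alternating S"
proof (rule supplement_of_section[where s = "\<lambda>_. 1"])
  define T where "T h = (\<Prod>w\<in>S. \<kappa> h w)" for h
  have T_mult: "T (g \<otimes> h) = T g * T h" if "g \<in> carrier G" "h \<in> carrier G" for g h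
  proof -
    have "T (g \<otimes> h) = (\<Prod>w\<in>S. \<kappa> g (act h w)) * T h"
      unfolding T_def using that by (simp add: \<kappa>_mult prod.distrib)
    also have "(\<Prod>w\<in>S. \<kappa> g (act h w)) = T g"
      unfolding T_def using prod.permute[OF act_permutes[OF that(2)], of "\<kappa> g"] by (simp add: o_def)
    finally show ?thesis .
  qed
  have T_inv: "T (inv g) * T g = 1" if "g \<in> carrier G" for g
    using T_mult[of "inv g" g] that \<kappa>_one by (simp add: T_def)
  fix a b c assume abc: "distinct [a, b, c]" "{a, b, c} \<subseteq> S"
  obtain d where d: "d \<in> S" "d \<notin> set [a, b, c]" using exists_fresh[of "[a, b, c]" S] card_S by auto
  obtain e where e: "e \<in> S" "e \<notin> set [a, b, c, d]" using exists_fresh[of "[a, b, c, d]" S] card_S by auto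
  obtain g k where gk: "g \<in> carrier G" "k \<in> carrier G" "act (g \<otimes> k \<otimes> inv g \<otimes> inv k) = cyc3 a b c"
    using commutator_lift[of a b c d e] abc d e by auto
  define h where "h = g \<otimes> k \<otimes> inv g \<otimes> inv k"
  have h: "h \<in> carrier G" "act h = cyc3 a b c" using gk by (auto simp: h_def)
  have "T h = (T (inv g) * T g) * (T (inv k) * T k)" using gk by (simp add: h_def T_mult)
  then have Th: "T h = 1" using T_inv gk by simp
  have "inverse (\<kappa> h w) ^ p = 1" if "w \<in> S" for w using \<kappa>_root[OF h(1) that] by (simp add: power_inverse)
  moreover have "(\<Prod>w\<in>S. inverse (\<kappa> h w)) = 1"
    using Th prod_inversef[of "\<kappa> h" S] by (simp add: T_def o_def)
  ultimately obtain n where n: "n \<in> ker" "\<forall>w\<in>S. \<kappa> n w = inverse (\<kappa> h w)"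
    using nonconstant_case_kernel[OF m, of "\<lambda>w. inverse (\<kappa> h w)"] by blast
  have "\<kappa> (h \<otimes> n) w = 1" if "w \<in> S" for w
    using \<kappa>_mult[OF h(1) kerD(1)[OF n(1)] that] kerD(3)[OF n(1)] n(2) \<kappa>_nz[OF h(1)] that by simp
  moreover have "act (h \<otimes> n) = cyc3 a b c" using h kerD[OF n(1)] by (simp add: act_mult)
  ultimately show "\<exists>h\<in>carrier G. act h = cyc3 a b c \<and> (\<forall>i\<in>S. 1 = 1 * \<kappa> h i)"
    using h(1) kerD(1)[OF n(1)] by (intro bexI[of _ "h \<otimes> n"]) auto
qed simp

theorem proper_supplement:
  "\<exists>K. subgroup K G \<and> K \<noteq> carrier G \<and> act ` K = alternating S"
  using constant_case nonconstant_case by blast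

end

section \<open>Actions of groups of prime power order\<close>

context group
begin

section \<open>Cosets and counting modulo p\<close>

lemma subgroup_card_dvd:
  assumes "subgroup A G" "subgroup B G" "A \<subseteq> B"
  shows "card A dvd card B"
proof -
  have "subgroup A (G\<lparr>carrier := B\<rparr>)" by (rule subgroup_incl[OF assms])
  then have "card (rcosets\<^bsub>G\<lparr>carrier := B\<rparr>\<^esub> A) * card A = card B"
    using group.lagrange[OF subgroup_imp_group[OF assms(2)]] by (simp add: order_def)
  then show ?thesis by (metis dvd_triv_right)
qed

lemma mem_l_coset:
  assumes "subgroup B G" "x \<in> carrier G" "y \<in> carrier G"
  shows "y \<in> x <# B \<longleftrightarrow> inv x \<otimes> y \<in> B"
proof
  assume "y \<in> x <# B"
  then obtain b where b: "b \<in> B" "y = x \<otimes> b" by (auto simp: l_coset_def)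
  have "b \<in> carrier G" using b assms(1) subgroup.mem_carrier by metis
  then show "inv x \<otimes> y \<in> B" using b assms(2) by (simp add: m_assoc[symmetric])
next
  assume "inv x \<otimes> y \<in> B"
  moreover have "y = x \<otimes> (inv x \<otimes> y)" using assms by (simp add: m_assoc[symmetric])
  ultimately show "y \<in> x <# B" by (auto simp: l_coset_def)
qed

lemma l_coset_eq_iff:
  assumes B: "subgroup B G" and x: "x \<in> carrier G" "y \<in> carrier G"
  shows "x <# B = y <# B \<longleftrightarrow> inv x \<otimes> y \<in> B"
proof
  assume "x <# B = y <# B"
  moreover have "y \<in> y <# B" using mem_l_coset[OF B x(2,2)] x subgroup.one_closed[OF B] by simp
  ultimately show "inv x \<otimes> y \<in> B" using mem_l_coset[OF B x] by simp
next
  assume xy: "inv x \<otimes> y \<in> B"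
  have sub: "u <# B \<subseteq> v <# B" if uv: "u \<in> carrier G" "v \<in> carrier G" "inv v \<otimes> u \<in> B" for u v
  proof
    fix w assume w: "w \<in> u <# B"
    then have wc: "w \<in> carrier G" using l_coset_subset_G[OF subgroup.subset[OF B] uv(1)] by blast
    have "(inv v \<otimes> u) \<otimes> (inv u \<otimes> w) \<in> B"
      using w wc uv mem_l_coset[OF B uv(1) wc] subgroup.m_closed[OF B] by blast
    moreover have "(inv v \<otimes> u) \<otimes> (inv u \<otimes> w) = inv v \<otimes> w"
      using uv wc by (metis inv_closed l_one m_assoc m_closed r_inv)
    ultimately show "w \<in> v <# B" using mem_l_coset[OF B uv(2) wc] by simp
  qed
  have "inv y \<otimes> x = inv (inv x \<otimes> y)" using x by (simp add: inv_mult_group)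
  then have "inv y \<otimes> x \<in> B" using xy subgroup.m_inv_closed[OF B] by metis
  then show "x <# B = y <# B" using sub x xy by blast
qed

lemma card_l_coset: "B \<subseteq> carrier G \<Longrightarrow> x \<in> carrier G \<Longrightarrow> card (x <# B) = card B"
  unfolding l_coset_def by (subst UNION_singleton_eq_range) (auto intro!: card_image inj_onI simp: l_cancel subset_iff)

lemma card_l_cosets:
  assumes B: "subgroup B G" and T: "subgroup T G" "B \<subseteq> T" and fin: "finite T"
  shows "card ((\<lambda>x. x <# B) ` T) * card B = card T"
proof -
  let ?E = "(\<lambda>x. x <# B) ` T"
  have Tc: "T \<subseteq> carrier G" using subgroup.subset[OF T(1)] .
  have Bc: "B \<subseteq> carrier G" using subgroup.subset[OF B] .
  have un: "\<Union>?E = T"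
  proof
    show "\<Union>?E \<subseteq> T" using T subgroup.m_closed[OF T(1)] by (auto simp: l_coset_def)
    show "T \<subseteq> \<Union>?E" using lcos_self[OF _ B] Tc by blast
  qed
  have "card B * card ?E = card (\<Union>?E)"
  proof (rule card_partition)
    show "finite ?E" "finite (\<Union>?E)" using fin un by auto
    show "card c = card B" if "c \<in> ?E" for c using that card_l_coset[OF Bc] Tc by auto
    show "c1 \<inter> c2 = {}" if c12: "c1 \<in> ?E" "c2 \<in> ?E" "c1 \<noteq> c2" for c1 c2
    proof (rule ccontr)
      assume "c1 \<inter> c2 \<noteq> {}"
      then obtain w where w: "w \<in> c1" "w \<in> c2" by blast
      obtain x y where "x \<in> T" "y \<in> T" and xy': "c1 = x <# B" "c2 = y <# B" using c12(1,2) by blast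
      then have xy: "x \<in> carrier G" "y \<in> carrier G" "c1 = x <# B" "c2 = y <# B" using Tc by auto
      have wc: "w \<in> carrier G" using w xy l_coset_subset_G[OF Bc] by blast
      have "c1 = w <# B" "c2 = w <# B"
        using w xy mem_l_coset[OF B _ wc] l_coset_eq_iff[OF B _ wc] by simp_all
      then show False using c12(3) by simp
    qed
  qed
  then show ?thesis by (simp add: un mult.commute)
qed

text \<open>The points that are not fixed fall into orbits whose lengths are powers of
  \<open>p\<close> greater than 1.\<close>

lemma p_group_nonfixed_points:
  assumes Q: "subgroup Q G" "finite Q" "card Q = p ^ n" and p: "Factorial_Ring.prime (p::nat)"
    and E: "finite E" and f: "\<And>x e. x \<in> Q \<Longrightarrow> e \<in> E \<Longrightarrow> f x e \<in> E"
    and f1: "\<And>e. e \<in> E \<Longrightarrow> f \<one> e = e"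
    and fm: "\<And>x y e. x \<in> Q \<Longrightarrow> y \<in> Q \<Longrightarrow> e \<in> E \<Longrightarrow> f (x \<otimes> y) e = f x (f y e)"
  shows "p dvd card {e \<in> E. \<exists>x\<in>Q. f x e \<noteq> e}"
proof -
  let ?N = "{e \<in> E. \<exists>x\<in>Q. f x e \<noteq> e}"
  define orb where "orb e = (\<lambda>x. f x e) ` Q" for e
  have Qc: "Q \<subseteq> carrier G" using subgroup.subset[OF Q(1)] .
  note Q1 = subgroup.one_closed[OF Q(1)] and Qm = subgroup.m_closed[OF Q(1)] and Qi = subgroup.m_inv_closed[OF Q(1)]
  have finv: "f (inv x) (f x e) = e" if "x \<in> Q" "e \<in> E" for x e
    using fm[OF Qi[OF that(1)] that] f1[OF that(2)] that Qc by (simp add: l_inv subset_iff)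
  have orb_self: "e \<in> orb e" if "e \<in> E" for e unfolding orb_def using Q1 f1[OF that] by (metis imageI)
  have orb_eq: "orb e' = orb e" if e: "e \<in> E" "e' \<in> orb e" for e e'
  proof -
    obtain x where x: "x \<in> Q" "e' = f x e" using e by (auto simp: orb_def)
    have e': "e' \<in> E" using x e f by simp
    have "orb (f y d) \<subseteq> orb d" if "y \<in> Q" "d \<in> E" for y d
      unfolding orb_def using that Qm fm by (auto simp flip: fm)
    from this[OF x(1) e(1)] this[OF Qi[OF x(1)] e'] show ?thesis using finv[OF x(1) e(1)] x(2) by auto
  qed
  have dvd: "p dvd card (orb e)" if eN: "e \<in> ?N" for e
  proof -
    have e: "e \<in> E" using eN by simp
    obtain x where x: "x \<in> Q" "f x e \<noteq> e" using eN by blast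
    let ?B = "{x \<in> Q. f x e = e}"
    have B: "subgroup ?B G"
    proof (rule subgroupI)
      show "inv a \<in> ?B" if "a \<in> ?B" for a using that finv[of a e] Qi e by auto
    qed (use Qc Q1 f1 e Qm fm in auto)
    \<comment> \<open>A point of the orbit corresponds to the set of group elements that carry
      \<open>e\<close> to it, a left coset of the stabilizer.\<close>
    have "bij_betw (\<lambda>e'. {x \<in> Q. f x e = e'}) (orb e) ((\<lambda>x. x <# ?B) ` Q)"
    proof (rule bij_betw_imageI)
      show "inj_on (\<lambda>e'. {x \<in> Q. f x e = e'}) (orb e)" by (rule inj_onI) (auto simp: orb_def)
      have "{y \<in> Q. f y e = f x e} = x <# ?B" if x: "x \<in> Q" for x
      proof (rule Set.set_eqI)
        fix y
        show "y \<in> {y \<in> Q. f y e = f x e} \<longleftrightarrow> y \<in> x <# ?B"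
        proof (cases "y \<in> Q")
          case True
          have "f y e = f x e \<longleftrightarrow> f (inv x) (f y e) = e"
            using finv[OF x e] finv[OF Qi[OF x] f[OF True e]] x Qc by auto
          then show ?thesis using mem_l_coset[OF B, of x y] x True Qc Qm Qi fm e by auto
        next
          case False
          have "y \<notin> x <# ?B" using False x Qm by (auto simp: l_coset_def)
          then show ?thesis using False by simp
        qed
      qed
      then show "(\<lambda>e'. {x \<in> Q. f x e = e'}) ` orb e = (\<lambda>x. x <# ?B) ` Q"
        unfolding orb_def image_image by (intro image_cong) auto
    qed
    then have "card (orb e) * card ?B = card Q"
      using card_l_cosets[OF B Q(1) _ Q(2)] bij_betw_same_card by fastforce
    then have "card (orb e) dvd p ^ n" using Q(3) by (metis dvd_triv_left)
    then obtain k where k: "card (orb e) = p ^ k" using divides_primepow_nat[OF p] by blast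
    have "card (orb e) \<noteq> 1"
    proof
      assume "card (orb e) = 1"
      then obtain d where "orb e = {d}" by (rule card_1_singletonE)
      moreover have "f x e \<in> orb e" using x by (auto simp: orb_def)
      ultimately show False using orb_self[OF e] x(2) by auto
    qed
    then show ?thesis using k by (cases k) auto
  qed
  have stable: "orb e \<subseteq> ?N" if "e \<in> ?N" for e
  proof
    fix d assume d: "d \<in> orb e"
    have e: "e \<in> E" using that by simp
    have dE: "d \<in> E" using d f e by (auto simp: orb_def)
    have "orb d = orb e" by (rule orb_eq[OF e d])
    moreover have "orb d = {d}" if "d \<notin> ?N" using that dE Q1 by (auto simp: orb_def)
    moreover obtain x where x: "x \<in> Q" "f x e \<noteq> e" using \<open>e \<in> ?N\<close> by blast
    moreover have "f x e \<in> orb e" using x by (auto simp: orb_def)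
    ultimately show "d \<in> ?N" using orb_self[OF e] by (metis singletonD)
  qed
  have un: "\<Union>(orb ` ?N) = ?N" using stable orb_self by blast
  have "p dvd card (\<Union>(orb ` ?N))"
  proof (rule dvd_partition)
    show "finite (\<Union>(orb ` ?N))" unfolding un using E by simp
    show "\<forall>c\<in>orb ` ?N. p dvd card c" using dvd by blast
    show "\<forall>c1\<in>orb ` ?N. \<forall>c2\<in>orb ` ?N. c1 \<noteq> c2 \<longrightarrow> c1 \<inter> c2 = {}"
    proof clarify
      fix d e assume de: "d \<in> E" "e \<in> E" "orb d \<noteq> orb e"
      then show "orb d \<inter> orb e = {}" using orb_eq by (metis disjoint_iff)
    qed
  qed
  then show ?thesis unfolding un .
qed

lemma p_group_coset_action:
  assumes A: "subgroup A G" "A \<subseteq> T" "card A = p ^ n" and p: "Factorial_Ring.prime (p::nat)"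
    and B: "subgroup B G" "B \<subseteq> T" and T: "subgroup T G" "finite T"
  shows "p dvd card {C \<in> (\<lambda>x. x <# B) ` T. \<exists>a\<in>A. a <# C \<noteq> C}"
proof (rule p_group_nonfixed_points[OF A(1) _ A(3) p])
  have c: "A \<subseteq> carrier G" "T \<subseteq> carrier G" "B \<subseteq> carrier G"
    using subgroup.subset A(1) B(1) T(1) by blast+
  show "finite A" "finite ((\<lambda>x. x <# B) ` T)" using A(2) T(2) finite_subset by auto
  have mult: "a <# (x <# B) = (a \<otimes> x) <# B" if "a \<in> T" "x \<in> T" for a x
    using that c by (intro lcos_m_assoc) auto
  show "a <# C \<in> (\<lambda>x. x <# B) ` T" if aC: "a \<in> A" "C \<in> (\<lambda>x. x <# B) ` T" for a C
  proof -
    obtain x where x: "x \<in> T" "C = x <# B" using aC by blast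
    have "a \<in> T" using aC A(2) by blast
    then show ?thesis using x mult subgroup.m_closed[OF T(1)] by (metis imageI)
  qed
  show "\<one> <# C = C" if "C \<in> (\<lambda>x. x <# B) ` T" for C
    using that c l_coset_subset_G[OF c(3)] by (intro lcos_mult_one) blast
  show "(a \<otimes> b) <# C = a <# (b <# C)" if "a \<in> A" "b \<in> A" "C \<in> (\<lambda>x. x <# B) ` T" for a b C
    using that c l_coset_subset_G[OF c(3)] by (intro lcos_m_assoc[symmetric]) blast+
qed

text \<open>\<open>A\<close> acts by left multiplication on the cosets of \<open>B\<close> in
  \<open>T\<close>. Their number is prime to \<open>p\<close>, so some coset x\<open>B\<close> is
  fixed, which means that conjugation by x moves \<open>A\<close> into \<open>B\<close>.\<close>

lemma sylow_conjugate:
  assumes A: "subgroup A G" "A \<subseteq> T" "card A = p ^ n" and p: "Factorial_Ring.prime (p::nat)"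
    and B: "subgroup B G" "B \<subseteq> T" and T: "subgroup T G" "finite T"
    and index: "\<not> p dvd card T div card B"
  shows "\<exists>x\<in>T. \<forall>a\<in>A. inv x \<otimes> a \<otimes> x \<in> B"
proof -
  let ?E = "(\<lambda>x. x <# B) ` T"
  have c: "A \<subseteq> carrier G" "T \<subseteq> carrier G" "B \<subseteq> carrier G"
    using subgroup.subset A(1) B(1) T(1) by blast+
  have "card B > 0" using subgroup.one_closed[OF B(1)] B(2) T(2) finite_subset by (metis card_gt_0_iff empty_iff)
  then have "card ?E = card T div card B" using card_l_cosets[OF B(1) T(1) B(2) T(2)] by (metis nonzero_mult_div_cancel_right less_numeral_extra(3))
  then have "\<not> p dvd card ?E" using index by simp
  then have "{C \<in> ?E. \<exists>a\<in>A. a <# C \<noteq> C} \<noteq> ?E" using p_group_coset_action[OF A p B T] by metis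
  then obtain x where x: "x \<in> T" "\<forall>a\<in>A. a <# (x <# B) = x <# B" by blast
  have "inv x \<otimes> a \<otimes> x \<in> B" if a: "a \<in> A" for a
  proof -
    have ac: "a \<in> carrier G" "x \<in> carrier G" using a x c by auto
    have "(a \<otimes> x) <# B = x <# B" using x(2) a lcos_m_assoc[OF c(3) ac] by simp
    then have "inv x \<otimes> (a \<otimes> x) \<in> B" using l_coset_eq_iff[OF B(1), of x "a \<otimes> x"] ac by simp
    then show ?thesis using ac by (simp add: m_assoc)
  qed
  then show ?thesis using x(1) by blast
qed

lemma exists_other:
  assumes "a \<in> D" "card D \<noteq> 1"
  shows "\<exists>b\<in>D. b \<noteq> a"
proof (rule ccontr)
  assume "\<not> ?thesis"
  then have "D = {a}" using assms(1) by blast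
  then show False using assms(2) by simp
qed

text \<open>\<open>R\<close> acts on the cosets of \<open>R\<close> in \<open>P\<close>. The number
  of all cosets and that of the nonfixed ones are divisible by \<open>p\<close>, so besides
  \<open>R\<close> itself another coset is fixed; the inverse of its representative normalizes
  \<open>R\<close>.\<close>

lemma p_subgroup_normalizer_grows:
  assumes R: "subgroup R G" "R \<subset> P" and P: "subgroup P G" "finite P" "card P = p ^ n"
    and p: "Factorial_Ring.prime (p::nat)"
  shows "\<exists>x\<in>P - R. \<forall>r\<in>R. x \<otimes> r \<otimes> inv x \<in> R"
proof -
  let ?E = "(\<lambda>x. x <# R) ` P" and ?F = "{C \<in> (\<lambda>x. x <# R) ` P. \<exists>a\<in>R. a <# C \<noteq> C}"
  have c: "P \<subseteq> carrier G" "R \<subseteq> carrier G" using subgroup.subset P(1) R(1) by blast+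
  have RP: "R \<subseteq> P" using R(2) by blast
  have "card R dvd p ^ n" using subgroup_card_dvd[OF R(1) P(1) RP] P(3) by simp
  then obtain k where k: "card R = p ^ k" using divides_primepow_nat[OF p] by blast
  have E: "card ?E * card R = card P" by (rule card_l_cosets[OF R(1) P(1) RP P(2)])
  have "card R < card P" using R(2) P(2) psubset_card_mono by blast
  then have "card ?E \<noteq> 1" using E by auto
  moreover have "card ?E dvd p ^ n" using E P(3) by (metis dvd_triv_left)
  ultimately have pE: "p dvd card ?E" using divides_primepow_nat[OF p, of "card ?E" n]
    by (metis dvd_power not_gr_zero power_0)
  have pF: "p dvd card ?F" by (rule p_group_coset_action[OF R(1) RP k p R(1) RP P(1,2)])
  have R_fix: "\<forall>a\<in>R. a <# (\<one> <# R) = \<one> <# R"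
    using c lcos_mult_one[OF c(2)] coset_join3[OF _ R(1)] by (auto simp: subset_iff)
  have "\<one> <# R \<in> ?E" using subgroup.one_closed[OF P(1)] by blast
  then have mem: "\<one> <# R \<in> ?E - ?F" using R_fix by blast
  have "p dvd card (?E - ?F)" using pE pF P(2) by (subst card_Diff_subset) (auto intro: dvd_diff_nat)
  then have "card (?E - ?F) \<noteq> 1" using p by (metis nat_dvd_1_iff_1 not_prime_1)
  from exists_other[OF mem this] obtain C where C: "C \<in> ?E - ?F" "C \<noteq> \<one> <# R" by (elim bexE)
  have fixC: "\<forall>a\<in>R. a <# C = C" using C(1) by simp
  have "C \<in> ?E" using C(1) by simp
  then obtain y where y: "y \<in> P" "C = y <# R" by (elim imageE)
  have yc: "y \<in> carrier G" using y c by blast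
  have "y \<notin> R" using C(2) y l_coset_eq_iff[OF R(1) one_closed yc] yc by auto
  then have "inv y \<in> P - R" using y subgroup.m_inv_closed[OF P(1)] subgroup.m_inv_closed[OF R(1)] yc by (metis Diff_iff inv_inv)
  moreover have "inv y \<otimes> r \<otimes> inv (inv y) \<in> R" if r: "r \<in> R" for r
  proof -
    have rc: "r \<in> carrier G" using r c by blast
    have "r <# (y <# R) = y <# R" using fixC y(2) r by simp
    then have "(r \<otimes> y) <# R = y <# R" using lcos_m_assoc[OF c(2) rc yc] by simp
    then have "inv y \<otimes> (r \<otimes> y) \<in> R" using l_coset_eq_iff[OF R(1) yc, of "r \<otimes> y"] rc yc by simp
    then show ?thesis using rc yc by (simp add: m_assoc)
  qed
  ultimately show ?thesis by blast
qed

text \<open>The quotient of \<open>P\<close> by \<open>R\<close> has a nontrivial centre. The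
  counting is that of normalizer growth, now for \<open>P\<close> conjugating the cosets: fixed
  cosets are the central elements of the quotient.\<close>

lemma p_group_center_mod:
  assumes R: "subgroup R G" "R \<subset> P" and P: "subgroup P G" "finite P" "card P = p ^ n"
    and p: "Factorial_Ring.prime (p::nat)"
    and normal: "\<And>x r. x \<in> P \<Longrightarrow> r \<in> R \<Longrightarrow> x \<otimes> r \<otimes> inv x \<in> R"
  shows "\<exists>x\<in>P - R. \<forall>y\<in>P. y \<otimes> x \<otimes> inv y \<otimes> inv x \<in> R"
proof -
  define f where "f y C = (\<lambda>c. y \<otimes> c \<otimes> inv y) ` C" for y and C :: "'a set"
  let ?E = "(\<lambda>x. x <# R) ` P" and ?F = "{C \<in> (\<lambda>x. x <# R) ` P. \<exists>a\<in>P. f a C \<noteq> C}"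
  have c: "P \<subseteq> carrier G" "R \<subseteq> carrier G" using subgroup.subset P(1) R(1) by blast+
  have RP: "R \<subseteq> P" using R(2) by blast
  note Pm = subgroup.m_closed[OF P(1)] and Pi = subgroup.m_inv_closed[OF P(1)]
  have f_coset: "f y (x <# R) = (y \<otimes> x \<otimes> inv y) <# R" if yx: "y \<in> P" "x \<in> P" for x y
  proof -
    have xyc: "x \<in> carrier G" "y \<in> carrier G" using yx c by auto
    have e1: "y \<otimes> (x \<otimes> r) \<otimes> inv y = (y \<otimes> x \<otimes> inv y) \<otimes> (y \<otimes> r \<otimes> inv y)" if "r \<in> R" for r
    proof -
      have "r \<in> carrier G" using that c by blast
      then show ?thesis using xyc by (simp add: m_assoc[symmetric]) (simp add: m_assoc)
    qed
    have e2: "y \<otimes> (inv y \<otimes> r \<otimes> y) \<otimes> inv y = r" if "r \<in> R" for r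
    proof -
      have "r \<in> carrier G" using that c by blast
      then show ?thesis using xyc by (simp add: m_assoc[symmetric]) (simp add: m_assoc)
    qed
    have n2: "inv y \<otimes> r \<otimes> y \<in> R" if "r \<in> R" for r
      using normal[OF Pi[OF yx(1)] that] xyc by simp
    have "(\<lambda>r. y \<otimes> r \<otimes> inv y) ` R = R"
    proof
      show "(\<lambda>r. y \<otimes> r \<otimes> inv y) ` R \<subseteq> R" using normal yx by blast
      show "R \<subseteq> (\<lambda>r. y \<otimes> r \<otimes> inv y) ` R"
      proof
        fix r assume r: "r \<in> R"
        show "r \<in> (\<lambda>r. y \<otimes> r \<otimes> inv y) ` R"
          by (rule image_eqI[where x = "inv y \<otimes> r \<otimes> y"]) (use e2 n2 r in auto)
      qed
    qed
    moreover have "f y (x <# R) = (\<lambda>r. (y \<otimes> x \<otimes> inv y) \<otimes> (y \<otimes> r \<otimes> inv y)) ` R"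
    proof -
      have "x <# R = (\<lambda>r. x \<otimes> r) ` R" by (auto simp: l_coset_def)
      then show ?thesis unfolding f_def using e1 by (simp add: image_image)
    qed
    ultimately have "f y (x <# R) = (\<lambda>r. (y \<otimes> x \<otimes> inv y) \<otimes> r) ` R" by (metis image_image)
    then show ?thesis by (auto simp: l_coset_def)
  qed
  have E: "card ?E * card R = card P" by (rule card_l_cosets[OF R(1) P(1) RP P(2)])
  have "card R < card P" using R(2) P(2) psubset_card_mono by blast
  then have "card ?E \<noteq> 1" using E by auto
  moreover have "card ?E dvd p ^ n" using E P(3) by (metis dvd_triv_left)
  ultimately have pE: "p dvd card ?E" using divides_primepow_nat[OF p, of "card ?E" n]
    by (metis dvd_power not_gr_zero power_0)
  have pF: "p dvd card ?F"
  proof (rule p_group_nonfixed_points[OF P p])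
    show "finite ?E" using P(2) by simp
    show "f y C \<in> ?E" if "y \<in> P" "C \<in> ?E" for y C using that f_coset Pm Pi by force
    show "f \<one> C = C" if "C \<in> ?E" for C
    proof -
      obtain x where x: "x \<in> P" "C = x <# R" using \<open>C \<in> ?E\<close> by blast
      then show ?thesis using f_coset[OF subgroup.one_closed[OF P(1)] x(1)] c by (auto simp: subset_iff)
    qed
    show "f (y \<otimes> w) C = f y (f w C)" if ywC: "y \<in> P" "w \<in> P" "C \<in> ?E" for y w C
    proof -
      obtain x where x: "x \<in> P" "C = x <# R" using ywC by blast
      have "x \<in> carrier G" "y \<in> carrier G" "w \<in> carrier G" using x ywC c by auto
      then have "y \<otimes> w \<otimes> x \<otimes> inv (y \<otimes> w) = y \<otimes> (w \<otimes> x \<otimes> inv w) \<otimes> inv y"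
        by (simp add: inv_mult_group m_assoc)
      then show ?thesis using f_coset x ywC Pm Pi by simp
    qed
  qed
  have R1: "\<one> <# R \<in> ?E" using subgroup.one_closed[OF P(1)] by blast
  have "f y (\<one> <# R) = \<one> <# R" if "y \<in> P" for y
    using f_coset[OF that subgroup.one_closed[OF P(1)]] that c by (auto simp: subset_iff)
  then have mem: "\<one> <# R \<in> ?E - ?F" using R1 by blast
  have "p dvd card (?E - ?F)" using pE pF P(2) by (subst card_Diff_subset) (auto intro: dvd_diff_nat)
  then have "card (?E - ?F) \<noteq> 1" using p by (metis nat_dvd_1_iff_1 not_prime_1)
  from exists_other[OF mem this] obtain C where C: "C \<in> ?E - ?F" "C \<noteq> \<one> <# R" by (elim bexE)
  have fixC: "\<forall>a\<in>P. f a C = C" using C(1) by simp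
  have "C \<in> ?E" using C(1) by simp
  then obtain x where x: "x \<in> P" "C = x <# R" by (elim imageE)
  have xc: "x \<in> carrier G" using x c by blast
  have "x \<notin> R" using C(2) x l_coset_eq_iff[OF R(1) one_closed xc] xc by auto
  moreover have "y \<otimes> x \<otimes> inv y \<otimes> inv x \<in> R" if y: "y \<in> P" for y
  proof -
    have yc: "y \<in> carrier G" using y c by blast
    have "(y \<otimes> x \<otimes> inv y) <# R = x <# R" using fixC x(2) f_coset[OF y x(1)] y by simp
    then have "inv x \<otimes> (y \<otimes> x \<otimes> inv y) \<in> R" using l_coset_eq_iff[OF R(1) xc, of "y \<otimes> x \<otimes> inv y"] xc yc by simp
    then have "x \<otimes> (inv x \<otimes> (y \<otimes> x \<otimes> inv y)) \<otimes> inv x \<in> R" by (rule normal[OF x(1)])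
    then show ?thesis using xc yc by (simp add: m_assoc[symmetric])
  qed
  ultimately show ?thesis using x(1) by blast
qed

end

section \<open>Frattini covers\<close>

lemma card_image_le_of_determined:
  assumes "finite T" "\<And>x y. x \<in> T \<Longrightarrow> y \<in> T \<Longrightarrow> g x = g y \<Longrightarrow> f x = f y"
  shows "card (f ` T) \<le> card (g ` T)"
proof -
  have "f ` T \<subseteq> (\<lambda>c. f (inv_into T g c)) ` (g ` T)"
  proof (rule image_subsetI)
    fix x assume x: "x \<in> T"
    then have "f (inv_into T g (g x)) = f x"
      by (intro assms(2)) (auto intro: inv_into_into f_inv_into_f)
    then show "f x \<in> (\<lambda>c. f (inv_into T g c)) ` (g ` T)" using x by (metis imageI)
  qed
  then have "card (f ` T) \<le> card ((\<lambda>c. f (inv_into T g c)) ` (g ` T))"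
    using assms(1) by (intro card_mono) auto
  also have "\<dots> \<le> card (g ` T)" using assms(1) by (intro card_image_le) auto
  finally show ?thesis .
qed

context group
begin

lemma inv_cancel:
  assumes "x \<in> carrier G" "y \<in> carrier G"
  shows "inv x \<otimes> (x \<otimes> y) = y" "x \<otimes> (inv x \<otimes> y) = y"
  using assms by (simp_all add: m_assoc[symmetric])

lemmas word_simps = m_assoc inv_mult_group inv_cancel

text \<open>One inclusion suffices to describe the normalizer: on a finite \<open>Q\<close>
  conjugation is injective, hence onto, which gives closure under inverses.\<close>

lemma normalizing_subgroup:
  assumes Q: "subgroup Q G" "finite Q"
  shows "subgroup {g \<in> carrier G. \<forall>x\<in>Q. g \<otimes> x \<otimes> inv g \<in> Q} G"
proof (rule subgroupI)
  have Qc: "x \<in> carrier G" if "x \<in> Q" for x using subgroup.mem_carrier[OF Q(1) that] .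
  show "{g \<in> carrier G. \<forall>x\<in>Q. g \<otimes> x \<otimes> inv g \<in> Q} \<noteq> {}" using Qc by (auto intro!: exI[of _ \<one>])
  fix g assume g: "g \<in> {g \<in> carrier G. \<forall>x\<in>Q. g \<otimes> x \<otimes> inv g \<in> Q}"
  then have gc: "g \<in> carrier G" by simp
  have "inj_on (\<lambda>x. g \<otimes> x \<otimes> inv g) Q" by (rule inj_onI) (use gc Qc in auto)
  then have onto: "(\<lambda>x. g \<otimes> x \<otimes> inv g) ` Q = Q" using g Q(2) by (intro endo_inj_surj) auto
  have "inv g \<otimes> x \<otimes> inv (inv g) \<in> Q" if "x \<in> Q" for x
  proof -
    have "x \<in> (\<lambda>x. g \<otimes> x \<otimes> inv g) ` Q" using onto that by simp
    then obtain y where "x = g \<otimes> y \<otimes> inv g" "y \<in> Q" by (rule imageE)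
    then show ?thesis using gc Qc by (simp add: word_simps)
  qed
  then show "inv g \<in> {g \<in> carrier G. \<forall>x\<in>Q. g \<otimes> x \<otimes> inv g \<in> Q}" using gc by simp
next
  have Qc: "x \<in> carrier G" if "x \<in> Q" for x using subgroup.mem_carrier[OF Q(1) that] .
  fix g h assume gh: "g \<in> {g \<in> carrier G. \<forall>x\<in>Q. g \<otimes> x \<otimes> inv g \<in> Q}" "h \<in> {g \<in> carrier G. \<forall>x\<in>Q. g \<otimes> x \<otimes> inv g \<in> Q}"
  have "g \<otimes> h \<otimes> x \<otimes> inv (g \<otimes> h) \<in> Q" if x: "x \<in> Q" for x
  proof -
    have "g \<otimes> (h \<otimes> x \<otimes> inv h) \<otimes> inv g \<in> Q" using gh x by simp
    then show ?thesis using gh Qc[OF x] by (simp add: word_simps)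
  qed
  then show "g \<otimes> h \<in> {g \<in> carrier G. \<forall>x\<in>Q. g \<otimes> x \<otimes> inv g \<in> Q}" using gh by simp
qed auto

lemma normalized_product_subgroup:
  assumes U: "subgroup U G" and Z: "subgroup Z G"
    and normalized: "\<And>u z. u \<in> U \<Longrightarrow> z \<in> Z \<Longrightarrow> u \<otimes> z \<otimes> inv u \<in> Z"
  shows "subgroup (U <#> Z) G"
proof (rule subgroupI)
  note c = subgroup.mem_carrier[OF U] subgroup.mem_carrier[OF Z]
  have mem: "u \<otimes> z \<in> U <#> Z" if "u \<in> U" "z \<in> Z" for u z
    using that by (auto simp: set_mult_def)
  show "U <#> Z \<subseteq> carrier G" using c by (auto simp: set_mult_def)
  show "U <#> Z \<noteq> {}" using subgroup.one_closed[OF U] subgroup.one_closed[OF Z] by (auto simp: set_mult_def)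
  fix a assume "a \<in> U <#> Z"
  then obtain u z where a: "u \<in> U" "z \<in> Z" "a = u \<otimes> z" by (auto simp: set_mult_def)
  have "inv a = inv u \<otimes> (u \<otimes> inv z \<otimes> inv u)" using a c by (simp add: word_simps)
  then show "inv a \<in> U <#> Z"
    using mem[OF subgroup.m_inv_closed[OF U a(1)] normalized[OF a(1) subgroup.m_inv_closed[OF Z a(2)]]] by simp
  fix b assume "b \<in> U <#> Z"
  then obtain v w where b: "v \<in> U" "w \<in> Z" "b = v \<otimes> w" by (auto simp: set_mult_def)
  have "a \<otimes> b = (u \<otimes> v) \<otimes> ((inv v \<otimes> z \<otimes> inv (inv v)) \<otimes> w)" using a b c by (simp add: word_simps)
  moreover have "(inv v \<otimes> z \<otimes> inv (inv v)) \<otimes> w \<in> Z"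
    using normalized[OF subgroup.m_inv_closed[OF U b(1)] a(2)] b(2) subgroup.m_closed[OF Z] by simp
  ultimately show "a \<otimes> b \<in> U <#> Z"
    using mem[OF subgroup.m_closed[OF U a(1) b(1)]] by simp
qed

end

context alternating_cover
begin

lemma card_act_image:
  assumes T: "subgroup T G" "finite T"
  shows "card (act ` T) * card (T \<inter> ker) = card T"
proof -
  let ?B = "T \<inter> ker"
  have B: "subgroup ?B G" by (rule subgroups_Inter_pair[OF T(1) subgroup_ker])
  have Tc: "x \<in> carrier G" if "x \<in> T" for x using subgroup.mem_carrier[OF T(1) that] .
  have iff: "x <# ?B = y <# ?B \<longleftrightarrow> act x = act y" if "x \<in> T" "y \<in> T" for x y
  proof -
    have "inv x \<otimes> y \<in> ?B \<longleftrightarrow> act x = act y"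
    proof
      assume "inv x \<otimes> y \<in> ?B"
      then have "act (inv x \<otimes> y) = id" using kerD(2) by blast
      then have "act x (act (inv x) (act y i)) = act x i" for i
        using that Tc by (simp add: act_mult fun_eq_iff)
      then show "act x = act y" using that Tc act_inv_apply by (simp add: fun_eq_iff)
    next
      assume "act x = act y"
      then show "inv x \<otimes> y \<in> ?B"
        using same_act that Tc subgroup.m_closed[OF T(1)] subgroup.m_inv_closed[OF T(1)] by simp
    qed
    then show ?thesis using l_coset_eq_iff[OF B] that Tc by simp
  qed
  have "card (act ` T) = card ((\<lambda>x. x <# ?B) ` T)"
    by (intro antisym card_image_le_of_determined T(2)) (use iff in auto)
  then show ?thesis using card_l_cosets[OF B T(1) _ T(2)] by simp
qed

end

text \<open>The condition \<open>frattini\<close> says that \<open>ker\<close> has no proper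
  supplement, in other words that it lies in the Frattini subgroup.\<close>

locale frattini_cover = alternating_cover G S act for G :: "('a, 'm) monoid_scheme" (structure) and S :: "'b set" and act +
  assumes finite_G: "finite (carrier G)"
    and frattini: "\<lbrakk>subgroup K G; act ` K = alternating S\<rbrakk> \<Longrightarrow> K = carrier G"
begin

section \<open>Sylow subgroups of the kernel\<close>

lemma finite_subgroup: "subgroup T G \<Longrightarrow> finite T"
  using finite_G subgroup.subset finite_subset by blast

text \<open>The conjugate of \<open>P\<close> by \<open>g\<close> is carried back into
  \<open>P\<close> by some x in \<open>ker\<close>. Then \<open>inv x \<otimes> g\<close> normalizes
  \<open>P\<close> and has the same image as \<open>g\<close>, so the normalizer maps onto the
  alternating group and is everything.\<close>

lemma sylow_kernel_normal:
  assumes r: "Factorial_Ring.prime (r::nat)"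
  shows "\<exists>P. subgroup P G \<and> P \<subseteq> ker \<and> card P = r ^ multiplicity r (card ker) \<and>
    (\<forall>g\<in>carrier G. \<forall>x\<in>P. g \<otimes> x \<otimes> inv g \<in> P)"
proof -
  let ?a = "multiplicity r (card ker)"
  have kc: "ker \<subseteq> carrier G" using subgroup.subset[OF subgroup_ker] .
  have fk: "finite ker" by (rule finite_subgroup[OF subgroup_ker])
  have ck: "card ker \<noteq> 0" using fk subgroup.one_closed[OF subgroup_ker] by auto
  have index: "\<not> r dvd card ker div r ^ ?a" using ck r by (intro multiplicity_decompose) auto
  have "order (G\<lparr>carrier := ker\<rparr>) = r ^ ?a * (card ker div r ^ ?a)"
    by (simp add: order_def multiplicity_dvd)
  then obtain P where P': "subgroup P (G\<lparr>carrier := ker\<rparr>)" "card P = r ^ ?a"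
    using sylow_thm[OF r subgroup_imp_group[OF subgroup_ker]] fk by fastforce
  have P: "subgroup P G" by (rule incl_subgroup[OF subgroup_ker P'(1)])
  have Pk: "P \<subseteq> ker" using subgroup.subset[OF P'(1)] by simp
  let ?N = "{g \<in> carrier G. \<forall>x\<in>P. g \<otimes> x \<otimes> inv g \<in> P}"
  have N: "subgroup ?N G" by (rule normalizing_subgroup[OF P finite_subgroup[OF P]])
  have Pc: "x \<in> carrier G" if "x \<in> P" for x using subgroup.mem_carrier[OF P that] .
  have "act ` ?N = alternating S"
  proof
    show "act ` ?N \<subseteq> alternating S" using act_alternating by blast
    show "alternating S \<subseteq> act ` ?N"
    proof
      fix q assume "q \<in> alternating S"
      then obtain g where g: "g \<in> carrier G" "act g = q" using act_lift by blast
      define A where "A = (\<lambda>x. g \<otimes> x \<otimes> inv g) ` P"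
      have A: "subgroup A G" "A \<subseteq> ker" "card A = r ^ ?a"
      proof -
        show "subgroup A G"
        proof (rule subgroupI)
          show "A \<subseteq> carrier G" using g Pc by (auto simp: A_def)
          show "A \<noteq> {}" using subgroup.one_closed[OF P] by (auto simp: A_def)
          show "inv a \<in> A" if "a \<in> A" for a
          proof -
            obtain x where x: "x \<in> P" "a = g \<otimes> x \<otimes> inv g" using \<open>a \<in> A\<close> by (auto simp: A_def)
            then have "inv a = g \<otimes> inv x \<otimes> inv g" using g Pc by (simp add: word_simps)
            then show ?thesis using subgroup.m_inv_closed[OF P x(1)] by (simp add: A_def)
          qed
          show "a \<otimes> b \<in> A" if "a \<in> A" "b \<in> A" for a b
          proof -
            obtain x y where x: "x \<in> P" "a = g \<otimes> x \<otimes> inv g" "y \<in> P" "b = g \<otimes> y \<otimes> inv g"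
              using \<open>a \<in> A\<close> \<open>b \<in> A\<close> by (auto simp: A_def)
            then have "a \<otimes> b = g \<otimes> (x \<otimes> y) \<otimes> inv g" using g Pc by (simp add: word_simps)
            then show ?thesis using subgroup.m_closed[OF P x(1,3)] by (simp add: A_def)
          qed
        qed
        show "A \<subseteq> ker" using ker_conj[OF g(1)] Pk by (auto simp: A_def)
        have "inj_on (\<lambda>x. g \<otimes> x \<otimes> inv g) P" by (rule inj_onI) (use g Pc in auto)
        then show "card A = r ^ ?a" using P'(2) card_image by (simp add: A_def card_image)
      qed
      have "\<exists>x\<in>ker. \<forall>a\<in>A. inv x \<otimes> a \<otimes> x \<in> P"
        using sylow_conjugate[OF A r P Pk subgroup_ker fk] index P'(2) by simp
      then obtain x where x: "x \<in> ker" "\<forall>a\<in>A. inv x \<otimes> a \<otimes> x \<in> P" by blast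
      have xc: "x \<in> carrier G" using kerD(1)[OF x(1)] .
      have "(inv x \<otimes> g) \<otimes> y \<otimes> inv (inv x \<otimes> g) \<in> P" if y: "y \<in> P" for y
      proof -
        have "inv x \<otimes> (g \<otimes> y \<otimes> inv g) \<otimes> x \<in> P" using x(2) y by (simp add: A_def)
        then show ?thesis using g(1) xc Pc[OF y] by (simp add: word_simps)
      qed
      then have a1: "inv x \<otimes> g \<in> ?N" using g xc by simp
      have a2: "act (inv x \<otimes> g) = q"
        using g xc kerD(2)[OF subgroup.m_inv_closed[OF subgroup_ker x(1)]] by (simp add: act_mult)
      show "q \<in> act ` ?N" 
        by (rule image_eqI[where f = act and x = "inv x \<otimes> g"], rule a2[symmetric], rule a1)
    qed
  qed
  then have "?N = carrier G" by (rule frattini[OF N])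
  then have "\<forall>g\<in>carrier G. \<forall>x\<in>P. g \<otimes> x \<otimes> inv g \<in> P" by blast
  then show ?thesis using P Pk P'(2) by (intro exI[of _ P] conjI)
qed

text \<open>For a prime not dividing \<open>card ker\<close> this is the trivial subgroup, so
  statements can range over all primes.\<close>

definition syl :: "nat \<Rightarrow> 'a set" where
  "syl r = (SOME P. subgroup P G \<and> P \<subseteq> ker \<and> card P = r ^ multiplicity r (card ker) \<and>
    (\<forall>g\<in>carrier G. \<forall>x\<in>P. g \<otimes> x \<otimes> inv g \<in> P))"

lemma syl:
  assumes "Factorial_Ring.prime r"
  shows "subgroup (syl r) G" "syl r \<subseteq> ker" "card (syl r) = r ^ multiplicity r (card ker)"
    "g \<in> carrier G \<Longrightarrow> x \<in> syl r \<Longrightarrow> g \<otimes> x \<otimes> inv g \<in> syl r"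
  using someI_ex[OF sylow_kernel_normal[OF assms]] unfolding syl_def by blast+

text \<open>Every prime power in \<open>card ker\<close> divides the order of
  \<open>C \<inter> ker\<close>, so the two orders agree.\<close>

lemma ker_subset_of_syl:
  assumes C: "subgroup C G" and syls: "\<And>r. Factorial_Ring.prime r \<Longrightarrow> syl r \<subseteq> C"
  shows "ker \<subseteq> C"
proof -
  have D: "subgroup (C \<inter> ker) G" by (rule subgroups_Inter_pair[OF C subgroup_ker])
  have fk: "finite ker" by (rule finite_subgroup[OF subgroup_ker])
  have nz: "card ker \<noteq> 0" "card (C \<inter> ker) \<noteq> 0"
    using fk subgroup.one_closed[OF D] subgroup.one_closed[OF subgroup_ker] by auto
  have "card ker dvd card (C \<inter> ker)"
  proof (rule multiplicity_le_imp_dvd)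
    fix r :: nat assume r: "Factorial_Ring.prime r"
    have "syl r \<subseteq> C \<inter> ker" using syls[OF r] syl(2)[OF r] by blast
    then have "card (syl r) dvd card (C \<inter> ker)" by (rule subgroup_card_dvd[OF syl(1)[OF r] D])
    then show "multiplicity r (card ker) \<le> multiplicity r (card (C \<inter> ker))"
      using nz r syl(3)[OF r] by (intro multiplicity_geI) auto
  qed (rule nz)
  then have "card ker \<le> card (C \<inter> ker)" using nz by (intro dvd_imp_le) auto
  then have "C \<inter> ker = ker" using fk by (intro card_seteq) auto
  then show ?thesis by blast
qed

text \<open>The commutator lies in both normal subgroups, whose coprime orders make the intersection
  trivial.\<close>

lemma syl_commute:
  assumes r: "Factorial_Ring.prime r" "Factorial_Ring.prime q" "r \<noteq> q" and xy: "x \<in> syl r" "y \<in> syl q"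
  shows "x \<otimes> y = y \<otimes> x"
proof -
  have c: "x \<in> carrier G" "y \<in> carrier G"
    using subgroup.mem_carrier[OF syl(1)[OF r(1)] xy(1)] subgroup.mem_carrier[OF syl(1)[OF r(2)] xy(2)] .
  let ?D = "syl r \<inter> syl q"
  have D: "subgroup ?D G" by (rule subgroups_Inter_pair[OF syl(1)[OF r(1)] syl(1)[OF r(2)]])
  have "card ?D dvd r ^ multiplicity r (card ker)" "card ?D dvd q ^ multiplicity q (card ker)"
    using subgroup_card_dvd[OF D syl(1)[OF r(1)]] subgroup_card_dvd[OF D syl(1)[OF r(2)]]
      syl(3)[OF r(1)] syl(3)[OF r(2)] by auto
  moreover have "coprime (r ^ multiplicity r (card ker)) (q ^ multiplicity q (card ker))"
    using primes_coprime[OF r] by simp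
  ultimately have "card ?D = 1" by (rule coprime_common_divisor_nat[rotated])
  then have D1: "?D = {\<one>}" using subgroup.one_closed[OF D] by (metis card_1_singletonE singletonD)
  have "x \<otimes> (y \<otimes> inv x \<otimes> inv y) \<in> syl r"
    using subgroup.m_closed[OF syl(1)[OF r(1)] xy(1) syl(4)[OF r(1) c(2)
      subgroup.m_inv_closed[OF syl(1)[OF r(1)] xy(1)]]] .
  moreover have "(x \<otimes> y \<otimes> inv x) \<otimes> inv y \<in> syl q"
    using subgroup.m_closed[OF syl(1)[OF r(2)] syl(4)[OF r(2) c(1) xy(2)]
      subgroup.m_inv_closed[OF syl(1)[OF r(2)] xy(2)]] .
  ultimately have "x \<otimes> y \<otimes> inv x \<otimes> inv y \<in> ?D" using c by (simp add: m_assoc)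
  then have "x \<otimes> y \<otimes> inv x \<otimes> inv y = \<one>" using D1 by blast
  then have "x \<otimes> y \<otimes> inv x \<otimes> inv y \<otimes> (y \<otimes> x) = y \<otimes> x" using c by simp
  then show ?thesis using c by (simp add: word_simps)
qed

end

section \<open>Reduction to index p\<close>

text \<open>The hypotheses here are played against each other until \<open>contradiction\<close>.
  The bound \<open>small\<close> says that the index of \<open>U\<close> is below k(k - 1).\<close>

locale maximal_avoiding = frattini_cover G S act for G :: "('a, 'm) monoid_scheme" (structure) and S :: "'b set" and act +
  fixes p :: nat and U :: "'a set"
  assumes prime_p: "Factorial_Ring.prime p"
    and U: "subgroup U G"
    and avoid: "\<not> syl p \<subseteq> U"
    and maximal: "\<lbrakk>subgroup T G; U \<subseteq> T; \<not> T \<subseteq> U\<rbrakk> \<Longrightarrow> syl p \<subseteq> T"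
    and card_S: "card S > 20"
    and small: "card (carrier G) < card S * (card S - 1) * card U"
begin

abbreviation "P \<equiv> syl p"
definition "R = P \<inter> U"

section \<open>P modulo R as an irreducible section under U\<close>

lemma P: "subgroup P G" by (rule syl(1)[OF prime_p])
lemma P_normal: "g \<in> carrier G \<Longrightarrow> x \<in> P \<Longrightarrow> g \<otimes> x \<otimes> inv g \<in> P" by (rule syl(4)[OF prime_p])
lemma P_ker: "P \<subseteq> ker" by (rule syl(2)[OF prime_p])
lemma R: "subgroup R G" unfolding R_def by (rule subgroups_Inter_pair[OF P U])
lemma R_psubset: "R \<subset> P" using avoid by (auto simp: R_def)
lemma carr: "x \<in> P \<Longrightarrow> x \<in> carrier G" "u \<in> U \<Longrightarrow> u \<in> carrier G" "r \<in> R \<Longrightarrow> r \<in> carrier G"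
  by (erule subgroup.mem_carrier[OF P] subgroup.mem_carrier[OF U] subgroup.mem_carrier[OF R])+

lemmas P_m = subgroup.m_closed[OF P] and P_i = subgroup.m_inv_closed[OF P]
lemmas U_m = subgroup.m_closed[OF U] and U_i = subgroup.m_inv_closed[OF U]
lemmas R_m = subgroup.m_closed[OF R] and R_i = subgroup.m_inv_closed[OF R]

lemma R_subset: "r \<in> R \<Longrightarrow> r \<in> P" "r \<in> R \<Longrightarrow> r \<in> U"
  by (auto simp: R_def)

lemma R_normal_U: "u \<in> U \<Longrightarrow> r \<in> R \<Longrightarrow> u \<otimes> r \<otimes> inv u \<in> R"
  unfolding R_def using P_normal[OF carr(2)] U_m U_i by simp

text \<open>The normalizer of \<open>R\<close> contains \<open>U\<close> and, since normalizers grow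
  in p-groups, an element of \<open>P\<close> outside \<open>U\<close>; by maximality it contains
  \<open>P\<close>.\<close>

lemma R_normal:
  assumes "y \<in> P" "s \<in> R"
  shows "y \<otimes> s \<otimes> inv y \<in> R"
proof -
  let ?N = "{g \<in> carrier G. \<forall>x\<in>R. g \<otimes> x \<otimes> inv g \<in> R}"
  have N: "subgroup ?N G" by (rule normalizing_subgroup[OF R finite_subgroup[OF R]])
  have UN: "U \<subseteq> ?N"
  proof
    fix u assume u: "u \<in> U"
    then show "u \<in> ?N" using R_normal_U[OF u] carr(2)[OF u] by simp
  qed
  obtain x where x: "x \<in> P - R" "\<forall>r\<in>R. x \<otimes> r \<otimes> inv x \<in> R"
    using p_subgroup_normalizer_grows[OF R R_psubset P finite_subgroup[OF P] syl(3)[OF prime_p] prime_p] by (elim bexE)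
  have "x \<in> ?N" using x carr(1) by simp
  moreover have "x \<notin> U" using x by (simp add: R_def)
  ultimately have "\<not> ?N \<subseteq> U" by (rule_tac notI) (drule (1) subsetD, simp)
  have "P \<subseteq> ?N" by (rule maximal[OF N UN \<open>\<not> ?N \<subseteq> U\<close>])
  then show ?thesis using subsetD[OF _ assms(1)] assms(2) by fastforce
qed

text \<open>Irreducibility: \<open>U <#> Z\<close> is larger than \<open>U\<close>, so it contains
  \<open>P\<close>, and by the modular law an element of \<open>P\<close> in \<open>U <#> Z\<close>
  lies in R\<open>Z\<close>, which is \<open>Z\<close>.\<close>

lemma intermediate:
  assumes Z: "subgroup Z G" "R \<subseteq> Z" "Z \<subseteq> P" "Z \<noteq> R"
    and normalized: "\<And>u z. u \<in> U \<Longrightarrow> z \<in> Z \<Longrightarrow> u \<otimes> z \<otimes> inv u \<in> Z"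
  shows "Z = P"
proof -
  have T: "subgroup (U <#> Z) G" by (rule normalized_product_subgroup[OF U Z(1) normalized])
  have Zc: "z \<in> carrier G" if "z \<in> Z" for z using subgroup.mem_carrier[OF Z(1) that] .
  have mem: "u \<otimes> z \<in> U <#> Z" if "u \<in> U" "z \<in> Z" for u z using that by (auto simp: set_mult_def)
  have "U \<subseteq> U <#> Z" using mem[OF _ subgroup.one_closed[OF Z(1)]] carr(2) by fastforce
  moreover have "\<not> U <#> Z \<subseteq> U"
  proof
    assume "U <#> Z \<subseteq> U"
    then have "z \<in> U" if "z \<in> Z" for z using mem[OF subgroup.one_closed[OF U] that] Zc[OF that] by auto
    then show False using Z(2-4) by (auto simp: R_def)
  qed
  ultimately have PT: "P \<subseteq> U <#> Z" by (rule maximal[OF T])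
  have "P \<subseteq> Z"
  proof
    fix x assume x: "x \<in> P"
    then have "x \<in> U <#> Z" using PT by (rule_tac subsetD)
    then obtain u z where uz: "u \<in> U" "z \<in> Z" "x = u \<otimes> z" by (auto simp: set_mult_def)
    have "u = x \<otimes> inv z" using uz carr Zc by (simp add: word_simps)
    moreover have "x \<otimes> inv z \<in> P" using x uz(2) Z(3) by (intro P_m P_i) auto
    ultimately have "u \<in> R" using uz(1) by (simp add: R_def)
    then show "x \<in> Z" using uz Z(2) subgroup.m_closed[OF Z(1)] by (metis subsetD)
  qed
  then show ?thesis using Z(3) by (rule_tac equalityI)
qed

text \<open>The preimage of the centre of the quotient is invariant under \<open>U\<close> and
  larger than \<open>R\<close>, hence all of \<open>P\<close>.\<close>

lemma P_mod_R_abelian: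
  assumes "a \<in> P" "b \<in> P"
  shows "b \<otimes> a \<otimes> inv b \<otimes> inv a \<in> R"
proof -
  let ?Z = "{x \<in> P. \<forall>y\<in>P. y \<otimes> x \<otimes> inv y \<otimes> inv x \<in> R}"
  have Z: "subgroup ?Z G"
  proof (rule subgroupI)
    show "?Z \<subseteq> carrier G" using carr(1) by auto
    show "?Z \<noteq> {}" using subgroup.one_closed[OF P] subgroup.one_closed[OF R] carr(1) by (auto intro!: exI[of _ \<one>])
    fix x assume x: "x \<in> ?Z"
    then have xP: "x \<in> P" by simp
    have "y \<otimes> inv x \<otimes> inv y \<otimes> inv (inv x) \<in> R" if y: "y \<in> P" for y
    proof -
      have "inv (y \<otimes> x \<otimes> inv y \<otimes> inv x) \<in> R" using x y by (intro R_i) simp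
      then have "inv x \<otimes> inv (y \<otimes> x \<otimes> inv y \<otimes> inv x) \<otimes> inv (inv x) \<in> R" by (rule R_normal[OF P_i[OF xP]])
      then show ?thesis using carr(1)[OF xP] carr(1)[OF y] by (simp add: word_simps)
    qed
    then show "inv x \<in> ?Z" using P_i[OF xP] by simp
    fix z assume z: "z \<in> ?Z"
    then have zP: "z \<in> P" by simp
    have "y \<otimes> (x \<otimes> z) \<otimes> inv y \<otimes> inv (x \<otimes> z) \<in> R" if y: "y \<in> P" for y
    proof -
      have "y \<otimes> x \<otimes> inv y \<otimes> inv x \<in> R" "y \<otimes> z \<otimes> inv y \<otimes> inv z \<in> R" using x y z by simp_all
      then have "(y \<otimes> x \<otimes> inv y \<otimes> inv x) \<otimes> (x \<otimes> (y \<otimes> z \<otimes> inv y \<otimes> inv z) \<otimes> inv x) \<in> R"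
        by (rule R_m[OF _ R_normal[OF xP]])
      then show ?thesis using carr(1)[OF xP] carr(1)[OF y] carr(1)[OF zP] by (simp add: word_simps)
    qed
    then show "x \<otimes> z \<in> ?Z" using P_m[OF xP zP] by simp
  qed
  have "?Z = P"
  proof (rule intermediate[OF Z])
    show "R \<subseteq> ?Z"
    proof
      fix r assume r: "r \<in> R"
      have "y \<otimes> r \<otimes> inv y \<otimes> inv r \<in> R" if "y \<in> P" for y using R_m[OF R_normal[OF that r] R_i[OF r]] .
      then show "r \<in> ?Z" using R_subset(1)[OF r] by simp
    qed
    have "\<exists>x\<in>P - R. \<forall>y\<in>P. y \<otimes> x \<otimes> inv y \<otimes> inv x \<in> R"
      by (rule p_group_center_mod[OF R R_psubset P finite_subgroup[OF P] syl(3)[OF prime_p] prime_p]) (rule R_normal)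
    then obtain x where "x \<in> P - R" "\<forall>y\<in>P. y \<otimes> x \<otimes> inv y \<otimes> inv x \<in> R" by (elim bexE)
    then have "x \<in> ?Z" "x \<notin> R" by simp_all
    then show "?Z \<noteq> R" by metis
    fix u x assume u: "u \<in> U" and x: "x \<in> ?Z"
    then have xP: "x \<in> P" by simp
    have "y \<otimes> (u \<otimes> x \<otimes> inv u) \<otimes> inv y \<otimes> inv (u \<otimes> x \<otimes> inv u) \<in> R" if y: "y \<in> P" for y
    proof -
      have "inv u \<otimes> y \<otimes> inv (inv u) \<in> P" using P_normal[OF carr(2)[OF U_i[OF u]] y] .
      then have "u \<otimes> ((inv u \<otimes> y \<otimes> inv (inv u)) \<otimes> x \<otimes> inv (inv u \<otimes> y \<otimes> inv (inv u)) \<otimes> inv x) \<otimes> inv u \<in> R"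
        using x by (intro R_normal_U[OF u]) simp
      then show ?thesis using carr(1)[OF xP] carr(1)[OF y] carr(2)[OF u] by (simp add: word_simps)
    qed
    then show "u \<otimes> x \<otimes> inv u \<in> ?Z" using P_normal[OF carr(2)[OF u] xP] by simp
  qed simp
  then have "a \<in> ?Z" using assms(1) by simp
  then show ?thesis using assms(2) by simp
qed

text \<open>The normalizer of \<open>R\<close> restricted to the elements acting trivially on the
  quotient of \<open>P\<close> by \<open>R\<close>.\<close>

definition "C = {g \<in> carrier G. (\<forall>r\<in>R. g \<otimes> r \<otimes> inv g \<in> R) \<and> (\<forall>x\<in>P. g \<otimes> x \<otimes> inv g \<otimes> inv x \<in> R)}"

lemma subgroup_C: "subgroup C G"
proof (rule subgroupI)
  let ?N = "{g \<in> carrier G. \<forall>x\<in>R. g \<otimes> x \<otimes> inv g \<in> R}"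
  have N: "subgroup ?N G" by (rule normalizing_subgroup[OF R finite_subgroup[OF R]])
  show "C \<subseteq> carrier G" by (auto simp: C_def)
  show "C \<noteq> {}" using subgroup.one_closed[OF R] carr by (auto simp: C_def intro!: exI[of _ \<one>])
  fix g assume g: "g \<in> C"
  then have gc: "g \<in> carrier G" and gR: "\<And>r. r \<in> R \<Longrightarrow> g \<otimes> r \<otimes> inv g \<in> R"
    and gP: "\<And>x. x \<in> P \<Longrightarrow> g \<otimes> x \<otimes> inv g \<otimes> inv x \<in> R" by (auto simp: C_def)
  have "inv g \<in> ?N" using gc gR by (intro subgroup.m_inv_closed[OF N]) simp
  moreover have "inv g \<otimes> x \<otimes> inv (inv g) \<otimes> inv x \<in> R" if x: "x \<in> P" for x
  proof -
    have y: "inv g \<otimes> x \<otimes> inv (inv g) \<in> P" by (rule P_normal) (use gc x in auto)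
    have "inv (g \<otimes> (inv g \<otimes> x \<otimes> inv (inv g)) \<otimes> inv g \<otimes> inv (inv g \<otimes> x \<otimes> inv (inv g))) \<in> R"
      by (rule R_i[OF gP[OF y]])
    then show ?thesis using gc carr(1)[OF x] by (simp add: word_simps)
  qed
  ultimately show "inv g \<in> C" by (simp add: C_def)
  fix h assume h: "h \<in> C"
  then have hc: "h \<in> carrier G" and hR: "\<And>r. r \<in> R \<Longrightarrow> h \<otimes> r \<otimes> inv h \<in> R"
    and hP: "\<And>x. x \<in> P \<Longrightarrow> h \<otimes> x \<otimes> inv h \<otimes> inv x \<in> R" by (auto simp: C_def)
  have "g \<otimes> h \<in> ?N" using gc gR hc hR by (intro subgroup.m_closed[OF N]) simp_all
  moreover have "g \<otimes> h \<otimes> x \<otimes> inv (g \<otimes> h) \<otimes> inv x \<in> R" if x: "x \<in> P" for x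
  proof -
    have "(g \<otimes> (h \<otimes> x \<otimes> inv h \<otimes> inv x) \<otimes> inv g) \<otimes> (g \<otimes> x \<otimes> inv g \<otimes> inv x) \<in> R"
      by (rule R_m[OF gR[OF hP[OF x]] gP[OF x]])
    then show ?thesis using gc hc carr(1)[OF x] by (simp add: word_simps)
  qed
  ultimately show "g \<otimes> h \<in> C" by (simp add: C_def)
qed

text \<open>\<open>P\<close> acts trivially because the quotient is abelian, and the Sylow subgroups
  for the other primes centralize \<open>P\<close>.\<close>

lemma ker_C: "ker \<subseteq> C"
proof (rule ker_subset_of_syl[OF subgroup_C])
  fix r :: nat assume r: "Factorial_Ring.prime r"
  show "syl r \<subseteq> C"
  proof (cases "r = p")
    case True
    then show ?thesis using R_normal P_mod_R_abelian carr(1) by (simp add: C_def subset_iff)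
  next
    case False
    show ?thesis
    proof
      fix y assume y: "y \<in> syl r"
      have yc: "y \<in> carrier G" using subgroup.mem_carrier[OF syl(1)[OF r] y] .
      have fix_x: "y \<otimes> x \<otimes> inv y = x" if x: "x \<in> P" for x
        using syl_commute[OF r prime_p False y x] yc carr(1)[OF x] by (simp add: m_assoc)
      have "y \<otimes> x \<otimes> inv y \<otimes> inv x \<in> R" if x: "x \<in> P" for x
        using fix_x[OF x] carr(1)[OF x] subgroup.one_closed[OF R] by simp
      then show "y \<in> C" using fix_x R_subset(1) yc by (simp add: C_def)
    qed
  qed
qed

text \<open>Otherwise \<open>P\<close> lies in \<open>U <#> syl r\<close>. Write an element x of
  \<open>P\<close> outside \<open>R\<close> as uw. Since x and w commute, raising u to the power
  \<open>card (syl r)\<close> gives the same power of x, which is therefore in \<open>R\<close>.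
  This exponent is prime to the order of x, so x would be in \<open>R\<close>.\<close>

lemma syl_U:
  assumes r: "Factorial_Ring.prime r" "r \<noteq> p"
  shows "syl r \<subseteq> U"
proof (rule ccontr)
  assume not: "\<not> syl r \<subseteq> U"
  let ?T = "U <#> syl r"
  have mem: "u \<otimes> z \<in> ?T" if "u \<in> U" "z \<in> syl r" for u z using that by (auto simp: set_mult_def)
  have Qc: "z \<in> carrier G" if "z \<in> syl r" for z using subgroup.mem_carrier[OF syl(1)[OF r(1)] that] .
  have T: "subgroup ?T G"
    by (rule normalized_product_subgroup[OF U syl(1)[OF r(1)]]) (rule syl(4)[OF r(1) carr(2)])
  have "U \<subseteq> ?T" using mem[OF _ subgroup.one_closed[OF syl(1)[OF r(1)]]] carr(2) by fastforce
  moreover have "\<not> ?T \<subseteq> U"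
  proof
    assume sub: "?T \<subseteq> U"
    have "z \<in> U" if "z \<in> syl r" for z
      using subsetD[OF sub mem[OF subgroup.one_closed[OF U] that]] Qc[OF that] by simp
    then show False using not by (simp add: subset_iff)
  qed
  ultimately have PT: "P \<subseteq> ?T" by (rule maximal[OF T])
  obtain x where x: "x \<in> P" "x \<notin> R" using R_psubset by (metis psubsetE subsetI)
  have xT: "x \<in> ?T" by (rule subsetD[OF PT x(1)])
  obtain u w where uw: "u \<in> U" "w \<in> syl r" "x = u \<otimes> w" using xT by (auto simp: set_mult_def)
  have c: "u \<in> carrier G" "w \<in> carrier G" "x \<in> carrier G" using uw carr x Qc by simp_all
  let ?n = "r ^ multiplicity r (card ker)" and ?m = "p ^ multiplicity p (card ker)"
  have comm: "inv w \<otimes> x = x \<otimes> inv w"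
    using syl_commute[OF r(1) prime_p r(2) subgroup.m_inv_closed[OF syl(1)[OF r(1)] uw(2)] x(1)] .
  have "u = x \<otimes> inv w" using uw c by (simp add: word_simps)
  then have "u [^] ?n = x [^] ?n \<otimes> inv w [^] ?n"
    using pow_mult_distrib[of x "inv w" ?n] comm c by simp
  also have "inv w [^] ?n = inv (w [^] ?n)" using c by (simp add: nat_pow_inv)
  also have "w [^] ?n = \<one>"
  proof -
    have "w [^]\<^bsub>G\<lparr>carrier := syl r\<rparr>\<^esub> order (G\<lparr>carrier := syl r\<rparr>) = \<one>"
      using group.pow_order_eq_1[OF subgroup_imp_group[OF syl(1)[OF r(1)]], of w] uw(2) by simp
    then show ?thesis using syl(3)[OF r(1)] by (simp add: order_def nat_pow_consistent[symmetric])
  qed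
  finally have un: "u [^] ?n = x [^] ?n" using c by simp
  have "x [^] ?m = \<one>"
  proof -
    have "x [^]\<^bsub>G\<lparr>carrier := P\<rparr>\<^esub> order (G\<lparr>carrier := P\<rparr>) = \<one>"
      using group.pow_order_eq_1[OF subgroup_imp_group[OF P], of x] x(1) by simp
    then show ?thesis using syl(3)[OF prime_p] by (simp add: order_def nat_pow_consistent[symmetric])
  qed
  have powP: "x [^] (j::nat) \<in> P" for j using x(1) subgroup.one_closed[OF P] by (induction j) (auto intro: P_m)
  have powU: "u [^] (j::nat) \<in> U" for j using uw(1) subgroup.one_closed[OF U] by (induction j) (auto intro: U_m)
  have xn: "x [^] ?n \<in> R" using un powP[of ?n] powU[of ?n] by (simp add: R_def)
  have co: "coprime ?n ?m" using primes_coprime[OF r(1) prime_p r(2)] by simp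
  have ne: "?m \<noteq> 1"
  proof
    assume m1: "?m = 1"
    have "x [^] (1::nat) = \<one>" using \<open>x [^] ?m = \<one>\<close> unfolding m1 .
    then have "x = \<one>" using c(3) by simp
    then show False using x(2) subgroup.one_closed[OF R] by simp
  qed
  obtain a b where ab: "?n * a = ?m * b + 1"
    using coprime_bezout_strong[OF co ne] by (elim exE)
  have "x [^] (?n * a) = x [^] (?m * b + 1)" by (simp only: ab)
  then have "(x [^] ?n) [^] a = (x [^] ?m) [^] b \<otimes> x" using c by (simp add: nat_pow_pow nat_pow_mult[symmetric])
  then have "(x [^] ?n) [^] a = x" using \<open>x [^] ?m = \<one>\<close> c by simp
  moreover have "(x [^] ?n) [^] (j::nat) \<in> R" for j
    using xn subgroup.one_closed[OF R] by (induction j) (auto intro: R_m)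
  ultimately show False using x(2) by metis
qed

lemma ker_subset_UP: "subgroup (U <#> P) G" "ker \<subseteq> U <#> P"
proof -
  show T: "subgroup (U <#> P) G" by (rule normalized_product_subgroup[OF U P]) (rule P_normal[OF carr(2)])
  have mem: "u \<otimes> z \<in> U <#> P" if "u \<in> U" "z \<in> P" for u z using that by (auto simp: set_mult_def)
  have UT: "U \<subseteq> U <#> P" using mem[OF _ subgroup.one_closed[OF P]] carr(2) by fastforce
  have PT: "P \<subseteq> U <#> P" using mem[OF subgroup.one_closed[OF U]] carr(1) by fastforce
  show "ker \<subseteq> U <#> P"
  proof (rule ker_subset_of_syl[OF T])
    fix r :: nat assume "Factorial_Ring.prime r"
    then show "syl r \<subseteq> U <#> P" using syl_U[of r] UT PT by (cases "r = p") auto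
  qed
qed

end

context alternating_cover
begin

section \<open>The image of U and its action on P modulo R\<close>

lemma perm_subgroup_act_image:
  assumes T: "subgroup T G" and sub: "act ` T \<subseteq> alternating A"
  shows "perm_subgroup A (act ` T)"
  unfolding perm_subgroup_def
proof (intro conjI ballI)
  note c = subgroup.mem_carrier[OF T]
  show "id \<in> act ` T" using subgroup.one_closed[OF T] act_one by (metis imageI)
  show "inv' q \<in> act ` T" if "q \<in> act ` T" for q
  proof -
    obtain g where g: "q = act g" "g \<in> T" using \<open>q \<in> act ` T\<close> by (rule imageE)
    have "inv' q = act (inv g)" using act_inv[OF c[OF g(2)]] g(1) by simp
    then show ?thesis using subgroup.m_inv_closed[OF T g(2)] by simp
  qed
  show "q \<circ> r \<in> act ` T" if "q \<in> act ` T" "r \<in> act ` T" for q r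
  proof -
    obtain g where g: "q = act g" "g \<in> T" using \<open>q \<in> act ` T\<close> by (rule imageE)
    obtain h where h: "r = act h" "h \<in> T" using \<open>r \<in> act ` T\<close> by (rule imageE)
    have "q \<circ> r = act (g \<otimes> h)" using act_mult[OF c[OF g(2)] c[OF h(2)]] g(1) h(1) by simp
    then show ?thesis using subgroup.m_closed[OF T g(2) h(2)] by simp
  qed
qed (rule sub)

end

context maximal_avoiding
begin

text \<open>The index of \<open>U\<close> is the product of the index of its image and that of
  \<open>U \<inter> ker\<close> in \<open>ker\<close>. A lower bound 2 for the second factor
  identifies the first as k, since index 1 is excluded by \<open>frattini\<close>; dividing by k
  then bounds the second by k - 1. The cosets of \<open>R\<close> in \<open>P\<close> embed in those
  of \<open>U \<inter> ker\<close> in \<open>ker\<close>.\<close>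

lemma act_image_U:
  obtains z where "z \<in> S" "act ` U = alternating (S - {z})"
    "card ((\<lambda>x. x <# R) ` P) < card S - 1"
proof -
  define k where "k = card S"
  let ?W = "act ` U" and ?D = "U \<inter> ker"
  have k: "k > 20" using card_S by (simp add: k_def)
  have D: "subgroup ?D G" by (rule subgroups_Inter_pair[OF U subgroup_ker])
  have fk: "finite ker" by (rule finite_subgroup[OF subgroup_ker])
  have cD: "card ?D > 0" using subgroup.one_closed[OF D] finite_subgroup[OF D] by (metis card_gt_0_iff empty_iff)
  have ck: "card ker > 0" using subgroup.one_closed[OF subgroup_ker] fk by (metis card_gt_0_iff empty_iff)
  have cG: "card (alternating S) * card ker = card (carrier G)"
    using card_act_image[OF subgroup_self finite_G] act_onto subgroup.subset[OF subgroup_ker]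
    by (simp add: Int_absorb1)
  have cU: "card ?W * card ?D = card U" by (rule card_act_image[OF U finite_subgroup[OF U]])
  have fS: "2 * card (alternating S) = fact k" using card_alternating[OF finite_S] k by (simp add: k_def)
  have half: "2 * card ?D \<le> card ker"
  proof -
    have "?D \<noteq> ker" using avoid P_ker by auto
    then have "card ?D < card ker" using fk by (intro psubset_card_mono) auto
    moreover have "card ?D dvd card ker" by (rule subgroup_card_dvd[OF D subgroup_ker]) simp
    then obtain d where d: "card ker = card ?D * d" by (rule dvdE)
    moreover have "d \<noteq> 0" "d \<noteq> 1" using calculation ck by auto
    then have "2 \<le> d" by simp
    then have "card ?D * 2 \<le> card ?D * d" by (rule mult_le_mono2)
    then show ?thesis using d by simp
  qed
  have sm: "card (alternating S) * card ker < k * (k - 1) * (card ?W * card ?D)"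
    using small cG cU by (simp add: k_def)
  have W: "perm_subgroup S ?W"
    by (rule perm_subgroup_act_image[OF U]) (use act_alternating carr(2) in auto)
  have "fact k < k * (k - 1) * card ?W"
  proof -
    have "fact k * card ker = 2 * (card (alternating S) * card ker)" using fS by simp
    also have "\<dots> < 2 * (k * (k - 1) * (card ?W * card ?D))" using sm by simp
    also have "\<dots> = (k * (k - 1) * card ?W) * (2 * card ?D)" by simp
    also have "\<dots> \<le> (k * (k - 1) * card ?W) * card ker" by (rule mult_le_mono2[OF half])
    finally show ?thesis using ck by simp
  qed
  then have "?W = alternating S \<or> (\<exists>z\<in>S. ?W = alternating (S - {z}))"
    using alternating_subgroup_of_small_index[OF finite_S card_S W] by (simp add: k_def)
  moreover have "?W \<noteq> alternating S"
  proof
    assume "?W = alternating S"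
    then have "U = carrier G" by (rule frattini[OF U])
    then show False using avoid subgroup.subset[OF P] by simp
  qed
  ultimately obtain z where z: "z \<in> S" "?W = alternating (S - {z})" by blast
  let ?e = "card ((\<lambda>x. x <# ?D) ` ker)"
  have e: "?e * card ?D = card ker" by (rule card_l_cosets[OF D subgroup_ker _ fk]) simp
  have cW: "2 * card ?W = fact (k - 1)"
    using card_alternating[of "S - {z}"] finite_S z k by (simp add: k_def)
  have "?e < k - 1"
  proof -
    have "k * (fact (k - 1) * (?e * card ?D)) = fact k * card ker"
      using e fact_reduce[of k, where 'a = nat] k by simp
    also have "\<dots> = 2 * (card (alternating S) * card ker)" using fS by simp
    also have "\<dots> < 2 * (k * (k - 1) * (card ?W * card ?D))" using sm by simp
    also have "\<dots> = k * ((k - 1) * ((2 * card ?W) * card ?D))" by simp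
    also have "\<dots> = k * (fact (k - 1) * ((k - 1) * card ?D))" unfolding cW by simp
    finally show ?thesis by simp
  qed
  moreover have "card ((\<lambda>x. x <# R) ` P) \<le> card ((\<lambda>x. x <# ?D) ` P)"
  proof (rule card_image_le_of_determined[OF finite_subgroup[OF P]])
    fix x y assume xy: "x \<in> P" "y \<in> P" "x <# ?D = y <# ?D"
    then have "inv x \<otimes> y \<in> ?D" using l_coset_eq_iff[OF D] carr(1) by simp
    then have "inv x \<otimes> y \<in> R" using xy P_m P_i by (simp add: R_def)
    then show "x <# R = y <# R" using l_coset_eq_iff[OF R] carr(1) xy by simp
  qed
  moreover have "card ((\<lambda>x. x <# ?D) ` P) \<le> ?e"
    using fk P_ker by (intro card_mono) auto
  ultimately show ?thesis using that z by (simp add: k_def)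
qed

lemma conj_coset:
  assumes u: "u \<in> U" and x: "x \<in> P"
  shows "(\<lambda>c. u \<otimes> c \<otimes> inv u) ` (x <# R) = (u \<otimes> x \<otimes> inv u) <# R"
proof
  have c: "u \<in> carrier G" "x \<in> carrier G" using u x carr by simp_all
  have lc: "y <# R = (\<lambda>r. y \<otimes> r) ` R" for y by (auto simp: l_coset_def)
  have e: "u \<otimes> (x \<otimes> r) \<otimes> inv u = (u \<otimes> x \<otimes> inv u) \<otimes> (u \<otimes> r \<otimes> inv u)" if "r \<in> R" for r
    using c carr(3)[OF that] by (simp add: word_simps)
  show "(\<lambda>c. u \<otimes> c \<otimes> inv u) ` (x <# R) \<subseteq> (u \<otimes> x \<otimes> inv u) <# R"
    unfolding lc using e R_normal_U[OF u] by auto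
  show "(u \<otimes> x \<otimes> inv u) <# R \<subseteq> (\<lambda>c. u \<otimes> c \<otimes> inv u) ` (x <# R)"
  proof
    fix w assume "w \<in> (u \<otimes> x \<otimes> inv u) <# R"
    then obtain r where r: "r \<in> R" "w = (u \<otimes> x \<otimes> inv u) \<otimes> r" unfolding lc by auto
    have r': "inv u \<otimes> r \<otimes> u \<in> R" using R_normal_U[OF U_i[OF u] r(1)] c by simp
    have "w = u \<otimes> (x \<otimes> (inv u \<otimes> r \<otimes> u)) \<otimes> inv u" using r c carr(3) by (simp add: word_simps)
    then show "w \<in> (\<lambda>c. u \<otimes> c \<otimes> inv u) ` (x <# R)" unfolding lc using r' by simp
  qed
qed

lemma conj_coset_eq:
  assumes u: "u \<in> U" "v \<in> U" and x: "x \<in> P" "y \<in> P"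
    and eq: "(u \<otimes> x \<otimes> inv u) <# R = (v \<otimes> y \<otimes> inv v) <# R"
  shows "inv x \<otimes> ((inv u \<otimes> v) \<otimes> y \<otimes> inv (inv u \<otimes> v)) \<in> R"
proof -
  have c: "u \<in> carrier G" "v \<in> carrier G" "x \<in> carrier G" "y \<in> carrier G" using u x carr by simp_all
  have "inv (u \<otimes> x \<otimes> inv u) \<otimes> (v \<otimes> y \<otimes> inv v) \<in> R"
    using l_coset_eq_iff[OF R, of "u \<otimes> x \<otimes> inv u" "v \<otimes> y \<otimes> inv v"] eq c by simp
  then have "inv u \<otimes> (inv (u \<otimes> x \<otimes> inv u) \<otimes> (v \<otimes> y \<otimes> inv v)) \<otimes> inv (inv u) \<in> R"
    by (rule R_normal_U[OF U_i[OF u(1)]])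
  then show ?thesis using c by (simp add: word_simps)
qed

text \<open>Conjugation permutes the cosets of \<open>R\<close> in \<open>P\<close>; two elements of
  \<open>U\<close> inducing the same permutation differ by an element of \<open>C\<close>.\<close>

lemma card_U_le: "card U \<le> card (U \<inter> C) * fact (card ((\<lambda>x. x <# R) ` P))"
proof -
  let ?Cos = "(\<lambda>x. x <# R) ` P"
  \<comment> \<open>The identity off the cosets, so that \<open>f u\<close> is a permutation in the
    sense of \<open>permutes\<close>.\<close>
  define f where "f u K = (if K \<in> ?Cos then (\<lambda>c. u \<otimes> c \<otimes> inv u) ` K else K)" for u and K :: "'a set"
  have fc: "f u (x <# R) = (u \<otimes> x \<otimes> inv u) <# R" if "u \<in> U" "x \<in> P" for u x
    using conj_coset[OF that] that by (simp add: f_def)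
  have finC: "finite ?Cos" using finite_subgroup[OF P] by simp
  have perm: "f u permutes ?Cos" if u: "u \<in> U" for u
  proof (rule bij_imp_permutes)
    have inj: "inj_on (f u) ?Cos"
    proof (rule inj_onI)
      fix K L assume "K \<in> ?Cos" "L \<in> ?Cos" and eq: "f u K = f u L"
      then obtain x y where xy: "x \<in> P" "y \<in> P" "K = x <# R" "L = y <# R" by (elim imageE)
      have "inv x \<otimes> ((inv u \<otimes> u) \<otimes> y \<otimes> inv (inv u \<otimes> u)) \<in> R"
        by (rule conj_coset_eq[OF u u xy(1,2)]) (use eq fc[OF u] xy in simp)
      then show "K = L" using l_coset_eq_iff[OF R, of x y] xy u carr by simp
    qed
    have "f u ` ?Cos \<subseteq> ?Cos"
    proof (rule image_subsetI)
      fix K assume "K \<in> ?Cos"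
      then obtain x where x: "K = x <# R" "x \<in> P" by (rule imageE)
      then show "f u K \<in> ?Cos" using fc[OF u x(2)] P_normal[OF carr(2)[OF u] x(2)] by simp
    qed
    then have "f u ` ?Cos = ?Cos" using inj finC by (intro endo_inj_surj)
    then show "bij_betw (f u) ?Cos ?Cos" using inj by (simp add: bij_betw_def)
    show "f u K = K" if "K \<notin> ?Cos" for K using that by (simp add: f_def)
  qed
  have D: "subgroup (U \<inter> C) G" by (rule subgroups_Inter_pair[OF U subgroup_C])
  let ?E = "(\<lambda>u. u <# (U \<inter> C)) ` U"
  have E: "card ?E * card (U \<inter> C) = card U" by (rule card_l_cosets[OF D U _ finite_subgroup[OF U]]) simp
  have "card ?E \<le> card (f ` U)"
  proof (rule card_image_le_of_determined[OF finite_subgroup[OF U]])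
    fix u v assume uv: "u \<in> U" "v \<in> U" and eq: "f u = f v"
    have c: "u \<in> carrier G" "v \<in> carrier G" using uv carr by simp_all
    have w: "inv u \<otimes> v \<in> U" using uv U_m U_i by simp
    have "(inv u \<otimes> v) \<otimes> x \<otimes> inv (inv u \<otimes> v) \<otimes> inv x \<in> R" if x: "x \<in> P" for x
    proof -
      have "f u (x <# R) = f v (x <# R)" using eq by simp
      then have "inv x \<otimes> ((inv u \<otimes> v) \<otimes> x \<otimes> inv (inv u \<otimes> v)) \<in> R"
        using fc uv x by (intro conj_coset_eq) simp_all
      then have "x \<otimes> (inv x \<otimes> ((inv u \<otimes> v) \<otimes> x \<otimes> inv (inv u \<otimes> v))) \<otimes> inv x \<in> R" by (rule R_normal[OF x])
      then show ?thesis using c carr(1)[OF x] by (simp add: word_simps)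
    qed
    moreover have "inv u \<otimes> v \<in> carrier G" using c by simp
    ultimately have "inv u \<otimes> v \<in> C" using R_normal_U[OF w] unfolding C_def by (intro CollectI conjI ballI)
    then show "u <# (U \<inter> C) = v <# (U \<inter> C)" using l_coset_eq_iff[OF D c] w by simp
  qed
  also have "\<dots> \<le> card {s. s permutes ?Cos}"
    using perm finite_permutations[OF finC] by (intro card_mono) auto
  also have "\<dots> = fact (card ?Cos)" by (rule card_permutations[OF refl finC])
  finally have "card ?E * card (U \<inter> C) \<le> fact (card ?Cos) * card (U \<inter> C)" by (rule mult_le_mono1)
  then show ?thesis using E by (metis mult.commute)
qed

lemma U_subset_C: "U \<subseteq> C"
proof -
  obtain z where z: "z \<in> S" "act ` U = alternating (S - {z})" and q: "card ((\<lambda>x. x <# R) ` P) < card S - 1"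
    by (rule act_image_U)
  define k where "k = card S"
  have k: "k > 20" using card_S by (simp add: k_def)
  let ?N = "act ` (U \<inter> C)"
  have D: "subgroup (U \<inter> C) G" by (rule subgroups_Inter_pair[OF U subgroup_C])
  have N: "perm_subgroup (S - {z}) ?N" by (rule perm_subgroup_act_image[OF D]) (use z(2) in auto)
  have "?N = alternating (S - {z})"
  proof (rule alternating_normal_subgroup[OF _ _ N])
    show "finite (S - {z})" "card (S - {z}) \<ge> 10" using finite_S z(1) k by (simp_all add: k_def)
    show "a \<circ> b \<circ> inv' a \<in> ?N" if ab: "a \<in> alternating (S - {z})" "b \<in> ?N" for a b
    proof -
      have "a \<in> act ` U" using ab(1) z(2) by simp
      then obtain u where u: "a = act u" "u \<in> U" by (rule imageE)
      obtain g where g: "b = act g" "g \<in> U \<inter> C" using ab(2) by (rule imageE)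
      have c: "u \<in> carrier G" "g \<in> carrier G" using u g carr by auto
      have gC: "\<And>x. x \<in> P \<Longrightarrow> g \<otimes> x \<otimes> inv g \<otimes> inv x \<in> R" using g(2) by (simp add: C_def)
      have w: "u \<otimes> g \<otimes> inv u \<in> U" using u(2) g(2) U_m U_i by simp
      have "(u \<otimes> g \<otimes> inv u) \<otimes> x \<otimes> inv (u \<otimes> g \<otimes> inv u) \<otimes> inv x \<in> R" if x: "x \<in> P" for x
      proof -
        have y: "inv u \<otimes> x \<otimes> inv (inv u) \<in> P" by (rule P_normal) (use c x in auto)
        have "u \<otimes> (g \<otimes> (inv u \<otimes> x \<otimes> inv (inv u)) \<otimes> inv g \<otimes> inv (inv u \<otimes> x \<otimes> inv (inv u))) \<otimes> inv u \<in> R"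
          by (rule R_normal_U[OF u(2) gC[OF y]])
        then show ?thesis using c carr(1)[OF x] by (simp add: word_simps)
      qed
      then have "u \<otimes> g \<otimes> inv u \<in> U \<inter> C" using R_normal_U[OF w] carr(2)[OF w] w
        unfolding C_def by (intro IntI CollectI conjI ballI)
      moreover have "a \<circ> b \<circ> inv' a = act (u \<otimes> g \<otimes> inv u)" using u g c by (simp add: act_mult act_inv)
      ultimately show ?thesis by simp
    qed
    show "?N \<noteq> {id}"
    proof
      assume triv: "?N = {id}"
      have "U \<inter> C \<subseteq> U \<inter> ker"
      proof
        fix g assume g: "g \<in> U \<inter> C"
        then have "act g \<in> ?N" by simp
        then have "act g = id" unfolding triv by simp
        then show "g \<in> U \<inter> ker" using g carr(2) by (auto simp: ker_def)
      qed
      then have "card (U \<inter> C) \<le> card (U \<inter> ker)" using finite_subgroup[OF U] by (intro card_mono) auto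
      moreover have "fact (card ((\<lambda>x. x <# R) ` P)) \<le> (fact (k - 2) :: nat)"
        using q by (intro fact_mono) (simp add: k_def)
      ultimately have "card U \<le> card (U \<inter> ker) * fact (k - 2)" using card_U_le by (meson le_trans mult_le_mono)
      then have "card (act ` U) * card (U \<inter> ker) \<le> fact (k - 2) * card (U \<inter> ker)"
        using card_act_image[OF U finite_subgroup[OF U]] by (simp add: mult.commute)
      moreover have "card (U \<inter> ker) > 0"
        using subgroup.one_closed[OF U] subgroup.one_closed[OF subgroup_ker] finite_subgroup[OF U] by (auto simp: card_gt_0_iff)
      ultimately have "2 * card (act ` U) \<le> 2 * fact (k - 2)" by simp
      moreover have "2 * card (act ` U) = fact (k - 1)"
        using card_alternating[of "S - {z}"] finite_S z k by (simp add: k_def)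
      moreover have "fact (k - 1) = (k - 1) * (fact (k - 2) :: nat)"
        using fact_reduce[of "k - 1", where 'a = nat] k by (simp add: numeral_2_eq_2)
      ultimately have "(k - 1) * fact (k - 2) \<le> 2 * (fact (k - 2) :: nat)" by simp
      then show False using k by simp
    qed
  qed
  then have NU: "?N = act ` U" using z(2) by simp
  show ?thesis
  proof
    fix u assume u: "u \<in> U"
    then have "act u \<in> ?N" using NU by simp
    then obtain n where n: "act u = act n" "n \<in> U \<inter> C" by (rule imageE)
    have c: "u \<in> carrier G" "n \<in> carrier G" using u n carr by auto
    have "inv n \<otimes> u \<in> C" using subsetD[OF ker_C same_act[OF c(2,1)]] n(1) by simp
    then have "n \<otimes> (inv n \<otimes> u) \<in> C"
      using subgroup.m_closed[OF subgroup_C, of n "inv n \<otimes> u"] n(2) by simp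
    then show "u \<in> C" using c by (simp add: word_simps)
  qed
qed

end

context maximal_avoiding
begin

section \<open>A character of order p and the cocycle induced from it\<close>

lemma U_trivial_on_P_mod_R: "u \<in> U \<Longrightarrow> x \<in> P \<Longrightarrow> u \<otimes> x \<otimes> inv u \<otimes> inv x \<in> R"
  using U_subset_C by (auto simp: C_def)

text \<open>The last element outside \<open>R\<close> in the sequence of iterated p-th powers of
  some y outside \<open>R\<close>.\<close>

lemma element_of_order_p_mod_R:
  obtains x where "x \<in> P" "x \<notin> R" "x [^] p \<in> R"
proof -
  obtain y where y: "y \<in> P" "y \<notin> R" using R_psubset by (metis psubsetE subsetI)
  have yc: "y \<in> carrier G" by (rule carr(1)[OF y(1)])
  define Q where "Q i \<longleftrightarrow> y [^] (p ^ i) \<in> R" for i :: nat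
  have "y [^]\<^bsub>G\<lparr>carrier := P\<rparr>\<^esub> order (G\<lparr>carrier := P\<rparr>) = \<one>"
    using group.pow_order_eq_1[OF subgroup_imp_group[OF P], of y] y(1) by simp
  then have "Q (multiplicity p (card ker))" using syl(3)[OF prime_p] subgroup.one_closed[OF R]
    by (simp add: order_def nat_pow_consistent[symmetric] Q_def)
  then have Q: "Q (LEAST i. Q i)" by (rule LeastI)
  have "\<not> Q 0" using y(2) yc by (simp add: Q_def)
  then obtain i where i: "(LEAST i. Q i) = Suc i" using Q by (metis not0_implies_Suc)
  have "\<not> Q i" by (rule not_less_Least) (simp add: i)
  moreover have "y [^] (p ^ i) \<in> P"
    using subgroup_int_pow_closed[OF P y(1), of "int (p ^ i)"] unfolding int_pow_int .
  moreover have "Q (Suc i)" using Q unfolding i .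
  then have "(y [^] (p ^ i)) [^] p \<in> R" using yc by (simp add: Q_def nat_pow_pow mult.commute)
  ultimately show ?thesis using that by (simp add: Q_def)
qed

context
  fixes x assumes x: "x \<in> P" "x \<notin> R" "x [^] p \<in> R"
begin

lemma x_carrier: "x \<in> carrier G" by (rule carr(1)[OF x(1)])

lemma x_pow_P: "x [^] (j::int) \<in> P" by (rule subgroup_int_pow_closed[OF P x(1)])

text \<open>As \<open>U\<close> acts trivially on the quotient, every subgroup of \<open>P\<close>
  above \<open>R\<close> is invariant under \<open>U\<close>; irreducibility leaves only the one
  generated by \<open>x\<close> and \<open>R\<close>. The quotient is thus cyclic of order
  p.\<close>

lemma P_eq_powers:
  assumes "y \<in> P"
  shows "\<exists>j::int. \<exists>r\<in>R. y = x [^] j \<otimes> r"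
proof -
  let ?X = "range (\<lambda>j::int. x [^] j)"
  let ?Z = "?X <#> R"
  have X: "subgroup ?X G"
  proof (rule subgroupI)
    show "?X \<subseteq> carrier G" using x_carrier by auto
    show "inv a \<in> ?X" if "a \<in> ?X" for a
    proof -
      obtain j :: int where "a = x [^] j" using \<open>a \<in> ?X\<close> by (rule imageE)
      then have "inv a = x [^] (- j)" using x_carrier by (simp add: int_pow_neg)
      then show ?thesis by simp
    qed
    show "a \<otimes> b \<in> ?X" if "a \<in> ?X" "b \<in> ?X" for a b
    proof -
      obtain i :: int where "a = x [^] i" using \<open>a \<in> ?X\<close> by (rule imageE)
      moreover obtain j :: int where "b = x [^] j" using \<open>b \<in> ?X\<close> by (rule imageE)
      ultimately have "a \<otimes> b = x [^] (i + j)" using x_carrier by (simp add: int_pow_mult)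
      then show ?thesis by simp
    qed
  qed simp
  have Z: "subgroup ?Z G"
    by (rule normalized_product_subgroup[OF X R]) (use R_normal x_pow_P in auto)
  have mem: "x [^] (j::int) \<otimes> r \<in> ?Z" if "r \<in> R" for j r using that by (auto simp: set_mult_def)
  have "?Z = P"
  proof (rule intermediate[OF Z])
    show "R \<subseteq> ?Z"
    proof
      fix r assume "r \<in> R"
      then show "r \<in> ?Z" using mem[of r 0] carr(3) by simp
    qed
    show "?Z \<subseteq> P" using x_pow_P R_subset(1) P_m by (auto simp: set_mult_def)
    show "?Z \<noteq> R" using mem[OF subgroup.one_closed[OF R], of 1] x(2) x_carrier by auto
    fix u z assume u: "u \<in> U" and "z \<in> ?Z"
    then obtain j :: int and r where z: "r \<in> R" "z = x [^] j \<otimes> r" by (auto simp: set_mult_def)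
    define y where "y = x [^] j"
    have y: "y \<in> P" using x_pow_P by (simp add: y_def)
    have "inv y \<otimes> (u \<otimes> y \<otimes> inv u \<otimes> inv y) \<otimes> inv (inv y) \<in> R"
      by (rule R_normal[OF P_i[OF y] U_trivial_on_P_mod_R[OF u y]])
    then have "(inv y \<otimes> (u \<otimes> y \<otimes> inv u \<otimes> inv y) \<otimes> inv (inv y)) \<otimes> (u \<otimes> r \<otimes> inv u) \<in> R"
      by (rule R_m[OF _ R_normal_U[OF u z(1)]])
    from mem[OF this, of j] show "u \<otimes> z \<otimes> inv u \<in> ?Z"
      using carr(1)[OF y] carr(2)[OF u] carr(3)[OF z(1)] unfolding z(2) y_def[symmetric] by (simp add: word_simps)
  qed
  then have "y \<in> ?Z" using assms by simp
  then show ?thesis by (auto simp: set_mult_def)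
qed

lemma pow_in_R_imp_dvd:
  assumes "x [^] (j::int) \<in> R"
  shows "int p dvd j"
proof (rule ccontr)
  assume "\<not> int p dvd j"
  then have "coprime (int p) j" using prime_p by (intro prime_imp_coprime) simp_all
  then have "coprime j (int p)" by (simp only: coprime_commute)
  then have "gcd j (int p) = 1" by (rule coprime_imp_gcd_eq_1)
  then obtain a b where "a * j + b * int p = 1" using bezout_int[of j "int p"] by auto
  then have ab: "j * a + int p * b = 1" by (simp add: mult.commute)
  have "x = x [^] (j * a + int p * b)" unfolding ab using x_carrier by simp
  also have "\<dots> = (x [^] j) [^] a \<otimes> (x [^] int p) [^] b" using x_carrier by (simp add: int_pow_mult int_pow_pow)
  also have "\<dots> \<in> R" 
    by (rule R_m[OF subgroup_int_pow_closed[OF R assms] subgroup_int_pow_closed[OF R]]) (simp add: int_pow_int x(3))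
  finally show False using x(2) by simp
qed

text \<open>\<open>U\<close> is normalized by \<open>P\<close>, and the quotient of
  \<open>U <#> P\<close> by \<open>U\<close> is cyclic of order p, generated by \<open>x\<close>.
  The character sends \<open>x [^] j \<otimes> u\<close> to the j-th power of
  \<open>\<zeta>\<close>.\<close>

lemma root_character:
  assumes W: "W \<subseteq> U <#> P" and \<zeta>: "\<zeta> ^ p = 1" "\<zeta> \<noteq> (1 :: complex)"
  obtains \<chi> where "\<And>v w. v \<in> W \<Longrightarrow> w \<in> W \<Longrightarrow> v \<otimes> w \<in> W \<Longrightarrow> \<chi> (v \<otimes> w) = \<chi> v * \<chi> w"
    "\<And>v. v \<in> W \<Longrightarrow> \<chi> v ^ p = 1" "x \<in> W \<Longrightarrow> \<chi> x = \<zeta>"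
proof -
  have \<zeta>0: "\<zeta> \<noteq> 0" using \<zeta>(1) prime_p prime_gt_0_nat[of p] by (auto simp: power_0_left)
  have \<zeta>_dvd: "\<zeta> powi i = \<zeta> powi j" if "int p dvd i - j" for i j
  proof -
    obtain c where c: "i - j = int p * c" using \<open>int p dvd i - j\<close> by (rule dvdE)
    have "\<zeta> powi i = \<zeta> powi (int p * c + j)" using c by (metis diff_add_cancel)
    also have "\<dots> = \<zeta> powi (int p * c) * \<zeta> powi j" using \<zeta>0 by (simp add: power_int_add)
    also have "\<zeta> powi (int p * c) = 1" using \<zeta>(1) by (simp add: power_int_mult)
    finally show ?thesis by simp
  qed
  \<comment> \<open>The exponent is determined only modulo p, because a power of \<open>x\<close>
    lies in \<open>U\<close> exactly when its exponent is a multiple of p; the value does not depend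
    on the choice.\<close>
  define \<chi> where "\<chi> v = \<zeta> powi (SOME j. inv (x [^] (j::int)) \<otimes> v \<in> U)" for v
  have \<chi>: "\<chi> v = \<zeta> powi j" if j: "inv (x [^] (j::int)) \<otimes> v \<in> U" and v: "v \<in> carrier G" for v j
  proof -
    let ?i = "SOME j. inv (x [^] (j::int)) \<otimes> v \<in> U"
    have i: "inv (x [^] ?i) \<otimes> v \<in> U" using someI[of "\<lambda>j. inv (x [^] (j::int)) \<otimes> v \<in> U", OF j] .
    have "(inv (x [^] j) \<otimes> v) \<otimes> inv (inv (x [^] ?i) \<otimes> v) \<in> U" by (rule U_m[OF j U_i[OF i]])
    then have "inv (x [^] j) \<otimes> x [^] ?i \<in> U" using v x_carrier by (simp add: word_simps)
    then have "x [^] (?i - j) \<in> U" using x_carrier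
      by (simp add: int_pow_neg[symmetric] int_pow_mult[symmetric])
    then have "x [^] (?i - j) \<in> R" using x_pow_P by (simp add: R_def)
    then have "int p dvd ?i - j" by (rule pow_in_R_imp_dvd)
    then show ?thesis unfolding \<chi>_def by (rule \<zeta>_dvd)
  qed
  have ex: "\<exists>j::int. \<exists>u\<in>U. v = x [^] j \<otimes> u" if vW: "v \<in> W" for v
  proof -
    obtain u y where uy: "u \<in> U" "y \<in> P" "v = u \<otimes> y" using subsetD[OF W vW] by (auto simp: set_mult_def)
    have "u \<otimes> y \<otimes> inv u \<in> P" by (rule P_normal[OF carr(2)[OF uy(1)] uy(2)])
    then obtain j :: int and r where r: "r \<in> R" "u \<otimes> y \<otimes> inv u = x [^] j \<otimes> r" using P_eq_powers by blast
    have "v = (u \<otimes> y \<otimes> inv u) \<otimes> u" using uy carr by (simp add: word_simps)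
    also have "\<dots> = x [^] j \<otimes> (r \<otimes> u)" unfolding r(2) using uy(1) carr r(1) x_carrier by (simp add: m_assoc)
    finally show ?thesis using U_m[OF R_subset(2)[OF r(1)] uy(1)] by blast
  qed
  show ?thesis
  proof (rule that)
    fix v assume "v \<in> W"
    then obtain i a where v: "a \<in> U" "v = x [^] (i::int) \<otimes> a" using ex by blast
    have vc: "v \<in> carrier G" using v carr x_carrier by simp
    have \<chi>v: "\<chi> v = \<zeta> powi i" by (rule \<chi>[OF _ vc]) (use v carr x_carrier in \<open>simp add: word_simps\<close>)
    have "\<chi> v ^ p = \<zeta> powi (int p * i)" unfolding \<chi>v by (metis mult.commute power_int_mult power_int_of_nat)
    then show "\<chi> v ^ p = 1" using \<zeta>(1) by (simp add: power_int_mult)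
    fix w assume "w \<in> W" and "v \<otimes> w \<in> W"
    then obtain j b where w: "b \<in> U" "w = x [^] (j::int) \<otimes> b" using ex by blast
    have wc: "w \<in> carrier G" using w carr x_carrier by simp
    have \<chi>w: "\<chi> w = \<zeta> powi j" by (rule \<chi>[OF _ wc]) (use w carr x_carrier in \<open>simp add: word_simps\<close>)
    define y where "y = x [^] j"
    have y: "y \<in> P" using x_pow_P by (simp add: y_def)
    \<comment> \<open>Trivial action on the quotient shows that conjugation by the power
      \<open>y\<close> of \<open>x\<close> keeps \<open>a\<close> in \<open>U\<close>, which lets
      \<open>a\<close> be moved past \<open>x [^] j\<close> in the product.\<close>
    have "a \<otimes> inv y \<otimes> inv a \<otimes> inv (inv y) \<in> R" by (rule U_trivial_on_P_mod_R[OF v(1) P_i[OF y]])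
    then have "inv (a \<otimes> inv y \<otimes> inv a \<otimes> inv (inv y)) \<otimes> a \<in> U"
      by (intro U_m U_i R_subset(2) v(1))
    then have yay: "inv y \<otimes> a \<otimes> y \<in> U" using carr(1)[OF y] carr(2)[OF v(1)] by (simp add: word_simps)
    have "inv (x [^] (i + j)) \<otimes> (v \<otimes> w) = inv y \<otimes> a \<otimes> y \<otimes> b"
      unfolding v(2) w(2) y_def using x_carrier carr(2)[OF v(1)] carr(2)[OF w(1)]
      by (simp add: int_pow_mult word_simps)
    then have "inv (x [^] (i + j)) \<otimes> (v \<otimes> w) \<in> U" using U_m[OF yay w(1)] by simp
    then have "\<chi> (v \<otimes> w) = \<zeta> powi (i + j)" using vc wc by (intro \<chi>) simp_all
    then show "\<chi> (v \<otimes> w) = \<chi> v * \<chi> w" using \<chi>v \<chi>w \<zeta>0 by (simp add: power_int_add)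
  next
    assume "x \<in> W"
    show "\<chi> x = \<zeta>" using \<chi>[of 1 x] x_carrier subgroup.one_closed[OF U] by simp
  qed
qed

end

text \<open>The stabilizer \<open>W\<close> of \<open>z\<close> carries a character of order p that
  is nontrivial on \<open>ker\<close>. The monomial representation induced from it is a
  \<open>root_cocycle\<close>, and \<open>proper_supplement\<close> then violates
  \<open>frattini\<close>.\<close>

lemma contradiction: False
proof -
  obtain x where x: "x \<in> P" "x \<notin> R" "x [^] p \<in> R" by (rule element_of_order_p_mod_R)
  obtain z where z: "z \<in> S" "act ` U = alternating (S - {z})" by (rule act_image_U)
  define W where "W = {g \<in> carrier G. act g z = z}"
  have WUP: "W \<subseteq> U <#> P"
  proof
    fix v assume v: "v \<in> W"
    have vc: "v \<in> carrier G" "act v z = z" using v by (auto simp: W_def)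
    have "act v permutes S - {z}" using permutes_superset[OF act_permutes[OF vc(1)], of "S - {z}"] vc(2) by auto
    then have "act v \<in> act ` U" using z(2) act_alternating[OF vc(1)] by (simp add: alternating_def)
    then obtain u where u: "act v = act u" "u \<in> U" by (rule imageE)
    have "inv u \<otimes> v \<in> ker" using same_act[OF carr(2)[OF u(2)] vc(1)] u(1) by simp
    then have "inv u \<otimes> v \<in> U <#> P" using ker_subset_UP(2) by blast
    moreover have "u \<otimes> \<one> \<in> U <#> P" using u(2) subgroup.one_closed[OF P] unfolding set_mult_def by blast
    ultimately have "(u \<otimes> \<one>) \<otimes> (inv u \<otimes> v) \<in> U <#> P"
      by (rule subgroup.m_closed[OF ker_subset_UP(1), rotated])
    then show "v \<in> U <#> P" using carr(2)[OF u(2)] vc(1) by (simp add: word_simps)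
  qed
  have "1 < card {z::complex. z ^ p = 1}"
    using card_roots_unity_eq[of p] prime_gt_1_nat[OF prime_p] by simp
  then have "\<exists>\<zeta>\<in>{z::complex. z ^ p = 1}. \<zeta> \<noteq> 1" using exists_other[of 1 "{z::complex. z ^ p = 1}"] by simp
  then obtain \<zeta> :: complex where \<zeta>: "\<zeta> ^ p = 1" "\<zeta> \<noteq> 1" by blast
  obtain \<chi> where \<chi>: "\<And>v w. v \<in> W \<Longrightarrow> w \<in> W \<Longrightarrow> v \<otimes> w \<in> W \<Longrightarrow> \<chi> (v \<otimes> w) = \<chi> v * \<chi> w"
    "\<And>v. v \<in> W \<Longrightarrow> \<chi> v ^ p = 1" "x \<in> W \<Longrightarrow> \<chi> x = \<zeta>"
    using root_character[OF x WUP \<zeta>] by metis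
  have "\<exists>g\<in>carrier G. act g z = i" if i: "i \<in> S" for i
  proof -
    obtain u where u: "u \<in> S" "u \<notin> set [z, i]" using exists_fresh[of "[z, i]" S] card_S by auto
    obtain q where q: "q \<in> alternating S" "q z = i"
      using alternating_transitive[of S z i u] z(1) i u card_S by auto
    then show ?thesis using act_lift[OF q(1)] by blast
  qed
  then obtain e where e: "\<And>i. i \<in> S \<Longrightarrow> e i \<in> carrier G \<and> act (e i) z = i" by metis
  \<comment> \<open>The matrix entries of the representation induced from \<open>W\<close>, with
    respect to the transversal \<open>e\<close>.\<close>
  define \<kappa> where "\<kappa> h i = \<chi> (inv (e (act h i)) \<otimes> h \<otimes> e i)" for h i
  have inW: "inv (e (act h i)) \<otimes> h \<otimes> e i \<in> W" if "h \<in> carrier G" "i \<in> S" for h i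
  proof -
    have i: "e i \<in> carrier G" "act (e i) z = i" using e[OF that(2)] by auto
    have hi: "e (act h i) \<in> carrier G" "act (e (act h i)) z = act h i" using e[OF act_in[OF that]] by auto
    have "act (inv (e (act h i))) (act h i) = z" using act_inv_apply(1)[OF hi(1), of z] hi(2) by simp
    then show ?thesis using i hi that by (simp add: W_def act_mult_apply)
  qed
  interpret root_cocycle G S act p \<kappa>
  proof
    show "Factorial_Ring.prime p" by (rule prime_p)
    show "\<kappa> (g \<otimes> h) i = \<kappa> g (act h i) * \<kappa> h i" if gh: "g \<in> carrier G" "h \<in> carrier G" "i \<in> S" for g h i
    proof -
      let ?a = "inv (e (act g (act h i))) \<otimes> g \<otimes> e (act h i)" and ?b = "inv (e (act h i)) \<otimes> h \<otimes> e i"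
      have hi: "act h i \<in> S" by (rule act_in[OF gh(2,3)])
      have c: "e i \<in> carrier G" "e (act h i) \<in> carrier G" "e (act g (act h i)) \<in> carrier G"
        using e gh(3) hi act_in[OF gh(1) hi] by auto
      have eq: "inv (e (act (g \<otimes> h) i)) \<otimes> (g \<otimes> h) \<otimes> e i = ?a \<otimes> ?b"
        using c gh by (simp add: act_mult_apply word_simps)
      have "inv (e (act (g \<otimes> h) i)) \<otimes> (g \<otimes> h) \<otimes> e i \<in> W" using inW gh by simp
      then have "?a \<otimes> ?b \<in> W" unfolding eq .
      then have "\<chi> (?a \<otimes> ?b) = \<chi> ?a * \<chi> ?b" by (rule \<chi>(1)[OF inW[OF gh(1) hi] inW[OF gh(2,3)]])
      then show ?thesis unfolding \<kappa>_def eq .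
    qed
    show "\<kappa> g i ^ p = 1" if "g \<in> carrier G" "i \<in> S" for g i
      unfolding \<kappa>_def by (rule \<chi>(2)[OF inW[OF that]])
    have xW: "x \<in> W" using x(1) P_ker kerD z by (auto simp: W_def)
    have ez: "e z \<in> carrier G" using e z(1) by simp
    have xk: "x \<in> ker" using x(1) P_ker by blast
    \<comment> \<open>The representative \<open>e z\<close> lies in \<open>W\<close> but need not be
      the identity; conjugating by it makes the entry at \<open>z\<close> exactly
      \<open>\<chi> x\<close>.\<close>
    have m: "e z \<otimes> x \<otimes> inv (e z) \<in> ker" by (rule ker_conj[OF ez xk])
    have "\<kappa> (e z \<otimes> x \<otimes> inv (e z)) z = \<chi> x"
      unfolding \<kappa>_def kerD(3)[OF m] using ez kerD(1)[OF xk] by (simp add: word_simps)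
    then have "\<kappa> (e z \<otimes> x \<otimes> inv (e z)) z \<noteq> 1" using \<chi>(3)[OF xW] \<zeta>(2) by simp
    then show "\<exists>m\<in>ker. \<exists>i\<in>S. \<kappa> m i \<noteq> 1" using m z(1) by blast
    show "card S > 9" using card_S by simp
  qed
  obtain K where "subgroup K G" "K \<noteq> carrier G" "act ` K = alternating S" using proper_supplement by blast
  then show False using frattini by blast
qed

end

context frattini_cover
begin

text \<open>If \<open>ker\<close> is not inside \<open>U\<close>, some Sylow subgroup of
  \<open>ker\<close> is not either. A subgroup of largest order among those above \<open>U\<close>
  avoiding it still satisfies the index bound and meets the conditions of
  \<open>maximal_avoiding\<close>.\<close>

theorem kernel_subset_of_small_index:
  assumes card_S: "card S > 20" and U: "subgroup U G"
    and small: "card (carrier G) < card S * (card S - 1) * card U"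
  shows "ker \<subseteq> U"
proof (rule ccontr)
  assume "\<not> ker \<subseteq> U"
  then obtain p where p: "Factorial_Ring.prime p" "\<not> syl p \<subseteq> U" using ker_subset_of_syl[OF U] by blast
  define F where "F = {T. subgroup T G \<and> U \<subseteq> T \<and> \<not> syl p \<subseteq> T}"
  have "F \<subseteq> Pow (carrier G)" using subgroup.subset by (auto simp: F_def)
  then have finF: "finite F" using finite_G finite_subset by blast
  have "U \<in> F" using U p(2) by (simp add: F_def)
  then have "Max (card ` F) \<in> card ` F" using finF by (intro Max_in) auto
  then obtain V where V: "Max (card ` F) = card V" "V \<in> F" by (rule imageE)
  have V': "subgroup V G" "U \<subseteq> V" "\<not> syl p \<subseteq> V" using V(2) by (auto simp: F_def)
  have max: "syl p \<subseteq> T" if T: "subgroup T G" "V \<subseteq> T" "\<not> T \<subseteq> V" for T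
  proof (rule ccontr)
    assume "\<not> syl p \<subseteq> T"
    then have "T \<in> F" using T V'(2) by (auto simp: F_def)
    then have "card T \<le> card V" using finF by (simp flip: V(1))
    moreover have "card V < card T" using T finite_subgroup[OF T(1)] by (intro psubset_card_mono) auto
    ultimately show False by simp
  qed
  have "card U \<le> card V" using V'(2) finite_subgroup[OF V'(1)] by (rule_tac card_mono)
  then have "card S * (card S - 1) * card U \<le> card S * (card S - 1) * card V" by (rule mult_le_mono2)
  then have small': "card (carrier G) < card S * (card S - 1) * card V" using small by linarith
  have "maximal_avoiding G S act p V"
    by (intro maximal_avoiding.intro maximal_avoiding_axioms.intro frattini_cover_axioms p(1) V'(1,3) max card_S small')
  then show False by (rule maximal_avoiding.contradiction)
qed

end

section \<open>Nonsplit extensions\<close>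

lemma alternating_eq_alt_group: "alternating {1..k} = carrier (alt_group k)"
  by (auto simp: alternating_def alt_group_carrier)

theorem theorem1p1:
  fixes H :: "('a, 'b) monoid_scheme" and M :: "'a set" and k :: nat
  assumes "k > 20"
    and "group H"
    and "finite (carrier H)"
    and "M \<lhd> H"
    and "M \<noteq> {\<one>\<^bsub>H\<^esub>}"
    and "H Mod M \<cong> alt_group k"
    and "\<not> (\<exists>K. is_complement H M K)"
  shows "\<forall>l::nat. (\<exists>f. f \<in> mon H (sym_group l)) \<longrightarrow> l \<ge> k * (k - 1)"
proof (intro allI impI, elim exE)
  fix l :: nat and f assume f: "f \<in> mon H (sym_group l)"
  interpret H: group H by (rule assms(2))
  interpret M: normal M H by (rule assms(4))
  obtain \<phi> where \<phi>: "\<phi> \<in> iso (H Mod M) (alt_group k)" using assms(6) by (auto simp: is_iso_def)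
  have \<phi>_hom: "\<phi> (A <#>\<^bsub>H\<^esub> B) = \<phi> A \<circ> \<phi> B" if "A \<in> carrier (H Mod M)" "B \<in> carrier (H Mod M)" for A B
    using \<phi> that by (auto simp: iso_def hom_def alt_group_mult FactGroup_def)
  have \<phi>_bij: "bij_betw \<phi> (carrier (H Mod M)) (alternating {1..k})"
    using \<phi> unfolding alternating_eq_alt_group iso_def by simp
  define act where "act h = \<phi> (M #>\<^bsub>H\<^esub> h)" for h
  have coset_in: "M #>\<^bsub>H\<^esub> h \<in> carrier (H Mod M)" if "h \<in> carrier H" for h
    using that by (auto simp: FactGroup_def RCOSETS_def)
  interpret cover: alternating_cover H "{1..k}" act
  proof
    show "finite {1..k}" by simp
    show "act (g \<otimes>\<^bsub>H\<^esub> h) = act g \<circ> act h" if "g \<in> carrier H" "h \<in> carrier H" for g h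
      unfolding act_def M.rcos_sum[OF that, symmetric] by (rule \<phi>_hom[OF coset_in[OF that(1)] coset_in[OF that(2)]])
    have "act ` carrier H = \<phi> ` carrier (H Mod M)"
      by (auto simp: act_def FactGroup_def RCOSETS_def image_iff)
    then show "act ` carrier H = alternating {1..k}" using \<phi>_bij by (simp add: bij_betw_def)
  qed
  have ker: "cover.ker = M"
  proof -
    have "act h = id \<longleftrightarrow> h \<in> M" if h: "h \<in> carrier H" for h
    proof -
      have "act \<one>\<^bsub>H\<^esub> = id" by (rule cover.act_one)
      then have "act h = id \<longleftrightarrow> \<phi> (M #>\<^bsub>H\<^esub> h) = \<phi> (M #>\<^bsub>H\<^esub> \<one>\<^bsub>H\<^esub>)" by (simp add: act_def)
      also have "\<dots> \<longleftrightarrow> M #>\<^bsub>H\<^esub> h = M #>\<^bsub>H\<^esub> \<one>\<^bsub>H\<^esub>"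
        using bij_betw_imp_inj_on[OF \<phi>_bij] coset_in[OF h] coset_in[OF H.one_closed] by (auto dest: inj_onD)
      also have "\<dots> \<longleftrightarrow> h \<in> M"
        using H.coset_join1[OF _ h M.subgroup_axioms] H.coset_join2[OF h M.subgroup_axioms]
        by (auto simp: H.coset_mult_one M.subset)
      finally show ?thesis .
    qed
    then show ?thesis unfolding cover.ker_def using M.subset by auto
  qed
  \<comment> \<open>A member of least order is the minimal subgroup to which the theory of Frattini
    covers applies.\<close>
  define F where "F = {L. subgroup L H \<and> act ` L = alternating {1..k}}"
  have "carrier H \<in> F" using H.subgroup_self cover.act_onto by (simp add: F_def)
  then obtain L where LF: "L \<in> F" and L_min: "\<And>L'. L' \<in> F \<Longrightarrow> card L \<le> card L'"
    using ex_has_least_nat[of "\<lambda>L. L \<in> F" "carrier H" card] by blast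
  have L: "subgroup L H" "act ` L = alternating {1..k}" using LF by (auto simp: F_def)
  have Lc: "L \<subseteq> carrier H" by (rule subgroup.subset[OF L(1)])
  have finL: "finite L" using Lc assms(3) finite_subset by blast
  interpret L: frattini_cover "H\<lparr>carrier := L\<rparr>" "{1..k}" act
  proof (intro frattini_cover.intro alternating_cover.intro alternating_cover_axioms.intro frattini_cover_axioms.intro)
    show "group (H\<lparr>carrier := L\<rparr>)" by (rule H.subgroup_imp_group[OF L(1)])
    show "act (g \<otimes>\<^bsub>H\<lparr>carrier := L\<rparr>\<^esub> h) = act g \<circ> act h"
      if "g \<in> carrier (H\<lparr>carrier := L\<rparr>)" "h \<in> carrier (H\<lparr>carrier := L\<rparr>)" for g h
      using that Lc cover.act_mult by auto
    fix K assume K: "subgroup K (H\<lparr>carrier := L\<rparr>)" "act ` K = alternating {1..k}"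
    have "subgroup K H" by (rule H.incl_subgroup[OF L(1) K(1)])
    then have "card L \<le> card K" using K(2) by (intro L_min) (simp add: F_def)
    moreover have "K \<subseteq> L" using subgroup.subset[OF K(1)] by simp
    ultimately show "K = carrier (H\<lparr>carrier := L\<rparr>)" using finL card_seteq by auto
  qed (use L finL in simp_all)
  \<comment> \<open>Nonsplitness enters here: \<open>L\<close> maps onto the quotient, so with
    trivial intersection it would be a complement of \<open>M\<close>.\<close>
  have "L \<inter> M \<noteq> {\<one>\<^bsub>H\<^esub>}"
  proof
    assume triv: "L \<inter> M = {\<one>\<^bsub>H\<^esub>}"
    have "L <#>\<^bsub>H\<^esub> M = carrier H"
    proof
      show "L <#>\<^bsub>H\<^esub> M \<subseteq> carrier H" by (rule H.set_mult_closed[OF Lc M.subset])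
      show "carrier H \<subseteq> L <#>\<^bsub>H\<^esub> M"
      proof
        fix h assume h: "h \<in> carrier H"
        then have "act h \<in> act ` L" using L(2) cover.act_alternating by simp
        then obtain g where g: "act h = act g" "g \<in> L" by (rule imageE)
        have gc: "g \<in> carrier H" using g(2) Lc by blast
        have "inv\<^bsub>H\<^esub> g \<otimes>\<^bsub>H\<^esub> h \<in> M" using cover.same_act[OF gc h] g(1) ker by simp
        moreover have "h = g \<otimes>\<^bsub>H\<^esub> (inv\<^bsub>H\<^esub> g \<otimes>\<^bsub>H\<^esub> h)" using gc h by (simp add: H.inv_cancel)
        ultimately show "h \<in> L <#>\<^bsub>H\<^esub> M" using g(2) unfolding set_mult_def by blast
      qed
    qed
    then have "is_complement H M L" using L(1) triv by (simp add: is_complement_def)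
    then show False using assms(7) by blast
  qed
  moreover have "\<one>\<^bsub>H\<^esub> \<in> L \<inter> M" using subgroup.one_closed[OF L(1)] M.one_closed by simp
  ultimately obtain m where m: "m \<in> L" "m \<in> M" "m \<noteq> \<one>\<^bsub>H\<^esub>" by blast
  have f_hom: "f (g \<otimes>\<^bsub>H\<^esub> h) = f g \<circ> f h" if "g \<in> carrier H" "h \<in> carrier H" for g h
    using f that by (auto simp: mon_def hom_def sym_group_mult)
  have f_perm: "f h permutes {1..l}" if "h \<in> carrier H" for h
    using f that by (auto simp: mon_def hom_def sym_group_carrier)
  have f_inj: "inj_on f (carrier H)" using f by (simp add: mon_def)
  have f_one: "f \<one>\<^bsub>H\<^esub> = id"
  proof -
    have "f \<one>\<^bsub>H\<^esub> (f \<one>\<^bsub>H\<^esub> w) = f \<one>\<^bsub>H\<^esub> w" for w using f_hom[of "\<one>\<^bsub>H\<^esub>" "\<one>\<^bsub>H\<^esub>"] by (metis H.l_one H.one_closed comp_apply)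
    then show ?thesis using permutes_inj[OF f_perm[OF H.one_closed]] by (metis eq_id_iff injD)
  qed
  have f_inv: "f (inv\<^bsub>H\<^esub> h) (f h w) = w" if "h \<in> carrier H" for h w
    using f_hom[of "inv\<^bsub>H\<^esub> h" h] that f_one by (simp add: fun_eq_iff)
  have "f m \<noteq> id" using f_inj f_one m Lc by (metis H.one_closed inj_onD subsetD)
  then obtain w where w: "f m w \<noteq> w" by (auto simp: fun_eq_iff)
  have "f m permutes {1..l}" using m(1) Lc by (intro f_perm) (rule subsetD)
  then have wl: "w \<in> {1..l}" using permutes_not_in[of "f m" "{1..l}" w] w by blast
  \<comment> \<open>The point \<open>w\<close> is moved by the kernel element \<open>m\<close>, so
    \<open>U\<close> does not contain the kernel, while its index in \<open>L\<close> is an orbit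
    length and hence at most \<open>l\<close>.\<close>
  define U where "U = {h \<in> L. f h w = w}"
  have U: "subgroup U H"
  proof (rule H.subgroupI)
    show "U \<subseteq> carrier H" using Lc by (auto simp: U_def)
    show "U \<noteq> {}" using subgroup.one_closed[OF L(1)] f_one by (auto simp: U_def)
    show "inv\<^bsub>H\<^esub> h \<in> U" if "h \<in> U" for h
      using that f_inv[of h w] subgroup.m_inv_closed[OF L(1)] Lc by (auto simp: U_def)
    show "g \<otimes>\<^bsub>H\<^esub> h \<in> U" if gh: "g \<in> U" "h \<in> U" for g h
    proof -
      have L': "g \<in> L" "h \<in> L" and fw: "f g w = w" "f h w = w" using gh by (auto simp: U_def)
      have "f (g \<otimes>\<^bsub>H\<^esub> h) = f g \<circ> f h" by (rule f_hom[OF subsetD[OF Lc L'(1)] subsetD[OF Lc L'(2)]])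
      then show ?thesis using fw subgroup.m_closed[OF L(1) L'] by (simp add: U_def)
    qed
  qed
  have UL: "U \<subseteq> L" by (auto simp: U_def)
  have cU: "card U > 0" using subgroup.one_closed[OF U] finL UL finite_subset by (metis card_gt_0_iff empty_iff)
  let ?E = "(\<lambda>h. h <#\<^bsub>H\<^esub> U) ` L"
  have "(\<lambda>h. f h w) ` L \<subseteq> {1..l}"
    using wl permutes_in_image[OF f_perm] Lc by blast
  then have "card ((\<lambda>h. f h w) ` L) \<le> l" using card_mono[of "{1..l}"] by fastforce
  moreover have "card ?E \<le> card ((\<lambda>h. f h w) ` L)"
  proof (rule card_image_le_of_determined[OF finL])
    fix g h assume gh: "g \<in> L" "h \<in> L" "f g w = f h w"
    have c: "g \<in> carrier H" "h \<in> carrier H" using gh Lc by auto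
    have "f (inv\<^bsub>H\<^esub> g \<otimes>\<^bsub>H\<^esub> h) w = w" using f_hom[of "inv\<^bsub>H\<^esub> g" h] f_inv[OF c(1), of w] c gh(3) by simp
    then have "inv\<^bsub>H\<^esub> g \<otimes>\<^bsub>H\<^esub> h \<in> U"
      using subgroup.m_closed[OF L(1) subgroup.m_inv_closed[OF L(1) gh(1)] gh(2)] by (simp add: U_def)
    then show "g <#\<^bsub>H\<^esub> U = h <#\<^bsub>H\<^esub> U" using H.l_coset_eq_iff[OF U c] by simp
  qed
  ultimately have El: "card ?E \<le> l" by simp
  have EL: "card ?E * card U = card L" by (rule H.card_l_cosets[OF U L(1) UL finL])
  show "l \<ge> k * (k - 1)"
  proof (rule ccontr)
    assume "\<not> l \<ge> k * (k - 1)"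
    then have "card ?E < k * (k - 1)" using El by simp
    then have "card L < k * (k - 1) * card U" using EL cU by (metis mult_less_mono1)
    then have "L.ker \<subseteq> U"
      using assms(1) H.subgroup_incl[OF U L(1) UL] by (intro L.kernel_subset_of_small_index) simp_all
    moreover have "m \<in> L.ker"
      using m cover.kerD(2)[of m] unfolding ker L.ker_def by simp
    ultimately show False using w by (auto simp: U_def)
  qed
qed

end
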